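(* Consider the closed-loop system (CL) described in the context (semilinear wave equation in the variables $(w^1,w^2)$, integral component $\zeta$, and dynamic state feedback $\dot v(t)=KX(t)$, where $K$ is a fixed gain such that $A+BK$ is Hurwitz). Let $\kappa\in(0,1)$ and $\delta>0$ be constants for which the stability property (S) of the context holds, and let $\eta\in[0,1)$. There exist constants $\overline{C}_3,\overline{C}_4>0$ such that, for any (real-valued) initial condition $W(0)\in D(\mathcal{A})$, $\xi(0)\in\mathbb{R}$, $v(0)\in\mathbb{R}$ satisfying $$\Vert W(0)\Vert_{\mathcal{H}}^2+|\xi(0)|^2+|v(0)|^2\leq\delta$$ and any continuously differentiable reference input $z_r:[0,+\infty)\to\mathbb{R}$ with $$\Vert z_r\Vert_{L^\infty(\mathbb{R}_+)}^2\leq\delta,$$ the classical solution of (CL) satisfies $$\left|\partial_xw^1(t,0)-z_r(t)\right|\leq\overline{C}_3e^{-\kappa t}\left\{\Vert W(0)\Vert_{\mathcal{H}}+|\xi(0)|+|v(0)|+\Vert\mathcal{A}W(0)\Vert_{\mathcal{H}}\right\}+\overline{C}_4\sup_{0\leq s\leq t}e^{-\eta\kappa(t-s)}|z_r(s)|$$ for all $t\geq 0$.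
   Context: **Data.** $L>0$; $f:\mathbb{R}\to\mathbb{R}$ of class $\mathcal{C}^2$; $y_e\in\mathcal{C}^2([0,L])$ is a real-valued function with $y_e''+f(y_e)=0$ on $(0,L)$ and $y_e(0)=0$ (a steady state, with $u_e=y_e'(L)$, $z_e=y_e'(0)$). The constant $\alpha>1$ is chosen so that $\frac{1}{2L}\log\left(\frac{\alpha-1}{\alpha+1}\right)<-1$. **Space and operator.** $\mathcal{H}=\{(w^1,w^2)\in H^1(0,L)\times L^2(0,L): w^1(0)=0\}$ (complex-valued functions) with inner product $\langle(w^1,w^2),(z^1,z^2)\rangle_{\mathcal{H}}=\int_0^L (w^1)'\overline{(z^1)'}+w^2\overline{z^2}\,dx$. The operator $\mathcal{A}$ is $\mathcal{A}(w^1,w^2)=(w^2,\,(w^1)''+f'(y_e)w^1)$ on $$D(\mathcal{A})=\{(w^1,w^2)\in\mathcal{H}: w^1\in H^2(0,L),\ w^2\in H^1(0,L),\ w^2(0)=0,\ (w^1)'(L)+\alpha w^2(L)=0\}.$$ Put $a(x)=(x/(\alpha L),0)$, $b(x)=(0,-x/(\alpha L))$, elements of $\mathcal{H}$. **Riesz basis.** The following spectral facts are taken as known. There are a Riesz basis $(e_k)_{k\in\mathbb{Z}}$ of $\mathcal{H}$, $e_k=(e_k^1,e_k^2)\in D(\mathcal{A})$, $\Vert e_k\Vert_{\mathcal H}=1$, with dual Riesz basis $(f_k)_{k\in\mathbb{Z}}$ ($\langle e_k,f_l\rangle_{\mathcal H}=\delta_{k,l}$), an integer $n_0\geq 0$,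 and complex numbers $\lambda_k$, such that: - for $|k|\geq n_0+1$: $\lambda_k$ is an algebraically simple eigenvalue of $\mathcal{A}$, $\mathcal{A}e_k=\lambda_ke_k$, $\mathcal{A}^*f_k=\overline{\lambda_k}f_k$, $\operatorname{Re}\lambda_k<-1$, $e_{-k}=\overline{e_k}$, $f_{-k}=\overline{f_k}$; - $\lambda_k=\frac{1}{2L}\log\left(\frac{\alpha-1}{\alpha+1}\right)+i\frac{k\pi}{L}+O(1/|k|)$ and $(e_k^1)'(0)=O(1)$ as $|k|\to+\infty$; - for $|k|\leq n_0$: $e_k,f_k$ are real-valued, $\mathcal{A}e_k\in\mathrm{span}\{e_p:|p|\leq n_0\}$ and $\mathcal{A}^*f_k\in\mathrm{span}\{f_p:|p|\leq n_0\}$; - all eigenvalues of $\mathcal{A}$ are geometrically simple. Such a family and integer $n_0$ are fixed. **Finite-dimensional matrices.** Let $a_k=\langle a,f_k\rangle_{\mathcal H}$, $b_k=\langle b,f_k\rangle_{\mathcal H}$; $A_0=(\langle\mathcal{A}e_k,f_j\rangle_{\mathcal H})_{-n_0\leq j,k\leq n_0}$ ($j$ row index); $B_{0,1}=(a_k)_{|k|\leq n_0}$, $B_{0,2}=(b_k)_{|k|\leq n_0}$ (columns in $\mathbb{R}^{2n_0+1}$); $$A_1=\begin{bmatrix} 0 & 0 \\ B_{0,1} & A_0 \end{bmatrix},\quad B_1=\begin{bmatrix} 1 \\ B_{0,2} \end{bmatrix},\quad \alpha_0=-\sum_{|k|\geq n_0+1}\frac{(e_k^1)'(0)}{\lambda_k}a_k,\quad\beta_0=-\sum_{|k|\geq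 n_0+1}\frac{(e_k^1)'(0)}{\lambda_k}b_k,$$ $$L_1=\begin{bmatrix}\alpha_0&(e_{-n_0}^1)'(0)&\cdots&(e_{n_0}^1)'(0)\end{bmatrix},\quad A=\begin{bmatrix} A_1 & 0 \\ L_1 & 0 \end{bmatrix}\in\mathbb{R}^{(2n_0+3)\times(2n_0+3)},\quad B=\begin{bmatrix} B_1 \\ \beta_0 \end{bmatrix}\in\mathbb{R}^{2n_0+3}.$$ The pair $(A,B)$ is controllable, and $K\in\mathbb{R}^{1\times(2n_0+3)}$ is a fixed gain such that $A_K=A+BK$ is Hurwitz. **Closed-loop system (CL).** Unknowns: $W(t)=(w^1(t,\cdot),w^2(t,\cdot))\in\mathcal{H}$ (real-valued), $\zeta(t)\in\mathbb{R}$, $v(t)\in\mathbb{R}$; input: the reference signal $z_r(t)\in\mathbb{R}$. For $t>0$, $x\in(0,L)$: $$\partial_tw^1=w^2+\frac{x}{\alpha L}v(t),\qquad\partial_tw^2=\partial_{xx}w^1+f'(y_e)w^1+r(t,x)-\frac{x}{\alpha L}\dot v(t),$$ $$\dot\zeta(t)=\partial_xw^1(t,0)-z_r(t),\qquad w^1(t,0)=0,\qquad\partial_xw^1(t,L)+\alpha w^2(t,L)=0,$$ $$r(t,x)=(w^1(t,x))^2\int_0^1(1-s)f''(y_e(x)+sw^1(t,x))\,ds,$$ $$\dot v(t)=KX(t),\quad X(t)=\begin{bmatrix}v(t)&w_{-n_0}(t)&\cdots&w_{n_0}(t)&\xi(t)\end{bmatrix}^\top,\quad w_k(t)=\langle W(t),f_k\rangle_{\mathcal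 H},$$ $$\xi(t)=\zeta(t)-\sum_{|k|\geq n_0+1}\frac{(e_k^1)'(0)}{\lambda_k}w_k(t).$$ Equivalently $\dot W=\mathcal{A}W+av+b\dot v+(0,r)$ in $\mathcal{H}$ together with the equations for $\zeta$ and $v$. (This is the system $\partial_{tt}y=\partial_{xx}y+f(y)$, $y(t,0)=0$, $\partial_xy(t,L)=u(t)$ with $u=u_e-\alpha\partial_ty(t,L)+v$, $w^1=y-y_e$, $w^2=\partial_ty-\frac{x}{\alpha L}v$.) Prescribing $(W(0),\xi(0),v(0))$ is equivalent to prescribing $(W(0),\zeta(0),v(0))$. For $W(0)\in D(\mathcal{A})$ and $z_r$ continuously differentiable, a classical solution on $[0,T)$ is one with $W\in\mathcal{C}^0([0,T);D(\mathcal{A}))\cap\mathcal{C}^1([0,T);\mathcal{H})$ (graph norm on $D(\mathcal{A})$) and $\zeta,v\in\mathcal{C}^1([0,T))$; "well defined on $\mathbb{R}_+$" means that the maximal classical solution is defined for all $t\geq 0$. **Stability property (S)** for $\kappa\in(0,1)$ and $\delta>0$: there exists $\overline{C}_1>0$ such that for any $\eta\in[0,1)$ there exists $\overline{C}_2>0$ such that, for all real-valued $W(0)\in D(\mathcal{A})$, $\xi(0),v(0)\in\mathbb{R}$ with $\Vert W(0)\Vert_{\mathcal H}^2+|\xi(0)|^2+|v(0)|^2\leq\delta$ and all continuously differentiable $z_r$ with $\Vert z_r\Vert_{L^\infty(\mathbb{R}_+)}^2\leq\delta$, the classical solution of (CL) is well defined on $\mathbb{R}_+$ and satisfies, for all $t\geq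 0$, $\Vert w^1(t,\cdot)\Vert_{L^\infty(0,L)}<1$ and $$\Vert W(t)\Vert_{\mathcal{H}}^2+|\xi(t)|^2+|v(t)|^2\leq\overline{C}_1e^{-2\kappa t}\left(\Vert W(0)\Vert_{\mathcal{H}}^2+|\xi(0)|^2+|v(0)|^2\right)+\overline{C}_2\sup_{0\leq s\leq t}e^{-2\eta\kappa(t-s)}|z_r(s)|^2 .$$ Constants $\kappa,\delta$ with property (S) are known to exist. *)

theory Defs
  imports
    "HOL-Analysis.Analysis"
    "HOL-Probability.Essential_Supremum"
    "HOL-Library.Function_Algebras"
    "HOL-Library.Landau_Symbols"
    "Jordan_Normal_Form.Char_Poly"
begin

section \<open>Functions on intervals\<close>

definition C1_on :: "real set \<Rightarrow> (real \<Rightarrow> real) \<Rightarrow> bool" where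
  "C1_on S g \<longleftrightarrow> (\<exists>g1. (\<forall>x\<in>S. (g has_real_derivative g1 x) (at x within S)) \<and> continuous_on S g1)"

definition C2_on :: "real set \<Rightarrow> (real \<Rightarrow> real) \<Rightarrow> bool" where
  "C2_on S g \<longleftrightarrow> (\<exists>g1. (\<forall>x\<in>S. (g has_real_derivative g1 x) (at x within S)) \<and> C1_on S g1)"

text \<open>The (extended) L-infinity norm on a Lebesgue measurable set.\<close>

definition linf_norm :: "real set \<Rightarrow> (real \<Rightarrow> 'a::real_normed_vector) \<Rightarrow> ereal" where
  "linf_norm S g = esssup (lebesgue_on S) (\<lambda>x. ereal (norm (g x)))"

text \<open>
  Elements of \<open>L\<^sup>2(0,L)\<close>, \<open>H\<^sup>1(0,L)\<close>, \<open>H\<^sup>2(0,L)\<close> are represented by functions on the real line of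
  which only the values on \<open>[0,L]\<close> matter (up to null sets for \<open>L\<^sup>2\<close>).  Elements of \<open>H\<^sup>1\<close> are
  represented by their (absolutely) continuous representative on \<open>[0,L]\<close>, so that point values
  such as \<open>w(0)\<close> are the usual traces.
\<close>

definition L2 :: "real \<Rightarrow> (real \<Rightarrow> complex) set" where
  "L2 L = {g. g \<in> borel_measurable (lebesgue_on {0..L}) \<and>
              integrable (lebesgue_on {0..L}) (\<lambda>x. (cmod (g x))\<^sup>2)}"

definition has_weak_deriv :: "real \<Rightarrow> (real \<Rightarrow> complex) \<Rightarrow> (real \<Rightarrow> complex) \<Rightarrow> bool" where
  "has_weak_deriv L w g \<longleftrightarrow>
     g \<in> L2 L \<and> (\<forall>x\<in>{0..L}. w x = w 0 + (\<integral>y. g y \<partial>lebesgue_on {0..x}))"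

definition H1 :: "real \<Rightarrow> (real \<Rightarrow> complex) set" where
  "H1 L = {w. \<exists>g. has_weak_deriv L w g}"

definition H2 :: "real \<Rightarrow> (real \<Rightarrow> complex) set" where
  "H2 L = {w. \<exists>g. has_weak_deriv L w g \<and> g \<in> H1 L}"

text \<open>The derivative of an \<open>H\<^sup>1\<close> function; it is determined almost everywhere on \<open>[0,L]\<close>.\<close>

definition wderiv :: "real \<Rightarrow> (real \<Rightarrow> complex) \<Rightarrow> real \<Rightarrow> complex" where
  "wderiv L w = (SOME g. has_weak_deriv L w g)"

text \<open>
  Functions in \<open>H\<^sup>2(0,L)\<close> are continuously differentiable on \<open>[0,L]\<close>; \<open>dx L w\<close> is their pointwise
  derivative (one-sided at the end points), i.e. the continuous representative of \<open>w'\<close>.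
\<close>

definition dx :: "real \<Rightarrow> (real \<Rightarrow> complex) \<Rightarrow> real \<Rightarrow> complex" where
  "dx L w x = vector_derivative w (at x within {0..L})"


section \<open>The state space\<close>

type_synonym state = "(real \<Rightarrow> complex) \<times> (real \<Rightarrow> complex)"

definition hspace :: "real \<Rightarrow> state set" where
  "hspace L = {w. fst w \<in> H1 L \<and> snd w \<in> L2 L \<and> fst w 0 = 0}"

definition hinner :: "real \<Rightarrow> state \<Rightarrow> state \<Rightarrow> complex" where
  "hinner L w z = (\<integral>x. wderiv L (fst w) x * cnj (wderiv L (fst z) x) + snd w x * cnj (snd z x)
                     \<partial>lebesgue_on {0..L})"

definition hnorm :: "real \<Rightarrow> state \<Rightarrow> real" where
  "hnorm L w = sqrt (Re (hinner L w w))"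

text \<open>Equality of the elements of the state space represented by two pairs of functions.\<close>

definition heq :: "real \<Rightarrow> state \<Rightarrow> state \<Rightarrow> bool" where
  "heq L w z \<longleftrightarrow> (\<forall>x\<in>{0..L}. fst w x = fst z x) \<and> (AE x in lebesgue_on {0..L}. snd w x = snd z x)"

definition hscale :: "complex \<Rightarrow> state \<Rightarrow> state" where
  "hscale c w = ((\<lambda>x. c * fst w x), (\<lambda>x. c * snd w x))"

definition hcnj :: "state \<Rightarrow> state" where
  "hcnj w = ((\<lambda>x. cnj (fst w x)), (\<lambda>x. cnj (snd w x)))"

definition real_valued :: "real \<Rightarrow> state \<Rightarrow> bool" where
  "real_valued L w \<longleftrightarrow> (\<forall>x\<in>{0..L}. fst w x \<in> \<real>) \<and> (AE x in lebesgue_on {0..L}. snd w x \<in> \<real>)"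

definition in_hspan :: "real \<Rightarrow> (int \<Rightarrow> state) \<Rightarrow> int set \<Rightarrow> state \<Rightarrow> bool" where
  "in_hspan L e I w \<longleftrightarrow> (\<exists>c. heq L w (\<Sum>k\<in>I. hscale (c k) (e k)))"

definition riesz_basis :: "real \<Rightarrow> (int \<Rightarrow> state) \<Rightarrow> bool" where
  "riesz_basis L e \<longleftrightarrow>
     (\<forall>k. e k \<in> hspace L) \<and>
     (\<forall>w\<in>hspace L. \<forall>\<epsilon>>0. \<exists>I c. finite I \<and> hnorm L (w - (\<Sum>k\<in>I. hscale (c k) (e k))) < \<epsilon>) \<and>
     (\<exists>m>0. \<exists>M>0. \<forall>I c. finite I \<longrightarrow>
        m * (\<Sum>k\<in>I. (cmod (c k))\<^sup>2) \<le> (hnorm L (\<Sum>k\<in>I. hscale (c k) (e k)))\<^sup>2 \<and>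
        (hnorm L (\<Sum>k\<in>I. hscale (c k) (e k)))\<^sup>2 \<le> M * (\<Sum>k\<in>I. (cmod (c k))\<^sup>2))"

definition dual_riesz_basis :: "real \<Rightarrow> (int \<Rightarrow> state) \<Rightarrow> (int \<Rightarrow> state) \<Rightarrow> bool" where
  "dual_riesz_basis L e fd \<longleftrightarrow>
     riesz_basis L fd \<and> (\<forall>k l. hinner L (e k) (fd l) = (if k = l then 1 else 0))"


section \<open>The operator\<close>

definition domA :: "real \<Rightarrow> real \<Rightarrow> state set" where
  "domA L \<alpha> = {w \<in> hspace L. fst w \<in> H2 L \<and> snd w \<in> H1 L \<and> snd w 0 = 0 \<and>
                 dx L (fst w) L + of_real \<alpha> * snd w L = 0}"

definition opA :: "real \<Rightarrow> (real \<Rightarrow> real) \<Rightarrow> (real \<Rightarrow> real) \<Rightarrow> state \<Rightarrow> state" where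
  "opA L f ye w =
     (snd w, \<lambda>x. wderiv L (dx L (fst w)) x + of_real (deriv f (ye x)) * fst w x)"

text \<open>\<open>adjA L \<alpha> f ye g h\<close>: \<open>g\<close> lies in the domain of the adjoint of the operator, which maps it to \<open>h\<close>.\<close>

definition adjA ::
    "real \<Rightarrow> real \<Rightarrow> (real \<Rightarrow> real) \<Rightarrow> (real \<Rightarrow> real) \<Rightarrow> state \<Rightarrow> state \<Rightarrow> bool" where
  "adjA L \<alpha> f ye g h \<longleftrightarrow> g \<in> hspace L \<and> h \<in> hspace L \<and>
     (\<forall>w\<in>domA L \<alpha>. hinner L (opA L f ye w) g = hinner L w h)"

definition eigvecA ::
    "real \<Rightarrow> real \<Rightarrow> (real \<Rightarrow> real) \<Rightarrow> (real \<Rightarrow> real) \<Rightarrow> complex \<Rightarrow> state \<Rightarrow> bool" where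
  "eigvecA L \<alpha> f ye \<mu> w \<longleftrightarrow> w \<in> domA L \<alpha> \<and> \<not> heq L w 0 \<and> heq L (opA L f ye w) (hscale \<mu> w)"

definition geom_simple ::
    "real \<Rightarrow> real \<Rightarrow> (real \<Rightarrow> real) \<Rightarrow> (real \<Rightarrow> real) \<Rightarrow> complex \<Rightarrow> bool" where
  "geom_simple L \<alpha> f ye \<mu> \<longleftrightarrow>
     (\<exists>w. eigvecA L \<alpha> f ye \<mu> w \<and> (\<forall>z. eigvecA L \<alpha> f ye \<mu> z \<longrightarrow> (\<exists>c. heq L z (hscale c w))))"

text \<open>The kernel of \<open>(\<A> - \<mu>)\<^sup>n\<close>.\<close>

primrec gen_ker ::
    "real \<Rightarrow> real \<Rightarrow> (real \<Rightarrow> real) \<Rightarrow> (real \<Rightarrow> real) \<Rightarrow> complex \<Rightarrow> nat \<Rightarrow> state set" where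
  "gen_ker L \<alpha> f ye \<mu> 0 = {w \<in> hspace L. heq L w 0}"
| "gen_ker L \<alpha> f ye \<mu> (Suc n) =
     {w \<in> domA L \<alpha>. opA L f ye w - hscale \<mu> w \<in> gen_ker L \<alpha> f ye \<mu> n}"

definition alg_simple ::
    "real \<Rightarrow> real \<Rightarrow> (real \<Rightarrow> real) \<Rightarrow> (real \<Rightarrow> real) \<Rightarrow> complex \<Rightarrow> bool" where
  "alg_simple L \<alpha> f ye \<mu> \<longleftrightarrow>
     (\<exists>w. eigvecA L \<alpha> f ye \<mu> w \<and>
          (\<forall>n. \<forall>z\<in>gen_ker L \<alpha> f ye \<mu> n. \<exists>c. heq L z (hscale c w)))"

definition avec :: "real \<Rightarrow> real \<Rightarrow> state" where
  "avec L \<alpha> = ((\<lambda>x. of_real (x / (\<alpha> * L))), (\<lambda>x. 0))"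

definition bvec :: "real \<Rightarrow> real \<Rightarrow> state" where
  "bvec L \<alpha> = ((\<lambda>x. 0), (\<lambda>x. of_real (- x / (\<alpha> * L))))"


section \<open>The finite-dimensional truncated model\<close>

text \<open>
  Throughout, \<open>e\<close> is the Riesz basis, \<open>fd\<close> its dual basis and \<open>lam\<close> the family of eigenvalues.
  The coefficients indexed by \<open>\<bar>k\<bar> \<le> n0\<close> are real because these \<open>e k\<close> and \<open>fd k\<close> are real-valued, and
  the series over \<open>\<bar>k\<bar> > n0\<close> applied to real-valued states are real because their terms of index
  \<open>k\<close> and \<open>-k\<close> are complex conjugate; taking \<open>Re\<close> below only serves to obtain the type \<open>real\<close>.
\<close>

definition tail_sum ::
    "real \<Rightarrow> (int \<Rightarrow> state) \<Rightarrow> (int \<Rightarrow> state) \<Rightarrow> (int \<Rightarrow> complex) \<Rightarrow> nat \<Rightarrow> state \<Rightarrow> real" where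
  "tail_sum L e fd lam n0 w =
     Re (\<Sum>\<^sub>\<infinity>k\<in>{k. \<bar>k\<bar> \<ge> int n0 + 1}. dx L (fst (e k)) 0 / lam k * hinner L w (fd k))"

definition A0mat ::
    "real \<Rightarrow> (real \<Rightarrow> real) \<Rightarrow> (real \<Rightarrow> real) \<Rightarrow> (int \<Rightarrow> state) \<Rightarrow> (int \<Rightarrow> state) \<Rightarrow> nat \<Rightarrow> real mat" where
  "A0mat L f ye e fd n0 = Matrix.mat (2 * n0 + 1) (2 * n0 + 1)
     (\<lambda>(i, j). Re (hinner L (opA L f ye (e (int j - int n0))) (fd (int i - int n0))))"

definition B0mat :: "real \<Rightarrow> (int \<Rightarrow> state) \<Rightarrow> nat \<Rightarrow> state \<Rightarrow> real mat" where
  "B0mat L fd n0 w = Matrix.mat (2 * n0 + 1) 1 (\<lambda>(i, j). Re (hinner L w (fd (int i - int n0))))"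

definition A1mat ::
    "real \<Rightarrow> real \<Rightarrow> (real \<Rightarrow> real) \<Rightarrow> (real \<Rightarrow> real) \<Rightarrow> (int \<Rightarrow> state) \<Rightarrow> (int \<Rightarrow> state) \<Rightarrow> nat
       \<Rightarrow> real mat" where
  "A1mat L \<alpha> f ye e fd n0 =
     four_block_mat (0\<^sub>m 1 1) (0\<^sub>m 1 (2 * n0 + 1)) (B0mat L fd n0 (avec L \<alpha>)) (A0mat L f ye e fd n0)"

definition B1mat :: "real \<Rightarrow> real \<Rightarrow> (int \<Rightarrow> state) \<Rightarrow> nat \<Rightarrow> real mat" where
  "B1mat L \<alpha> fd n0 = 1\<^sub>m 1 @\<^sub>r B0mat L fd n0 (bvec L \<alpha>)"

definition L1mat ::
    "real \<Rightarrow> real \<Rightarrow> (int \<Rightarrow> state) \<Rightarrow> (int \<Rightarrow> state) \<Rightarrow> (int \<Rightarrow> complex) \<Rightarrow> nat \<Rightarrow> real mat" where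
  "L1mat L \<alpha> e fd lam n0 = Matrix.mat 1 (2 * n0 + 2)
     (\<lambda>(i, j). if j = 0 then - tail_sum L e fd lam n0 (avec L \<alpha>)
               else Re (dx L (fst (e (int j - 1 - int n0))) 0))"

definition Amat ::
    "real \<Rightarrow> real \<Rightarrow> (real \<Rightarrow> real) \<Rightarrow> (real \<Rightarrow> real) \<Rightarrow> (int \<Rightarrow> state) \<Rightarrow> (int \<Rightarrow> state)
       \<Rightarrow> (int \<Rightarrow> complex) \<Rightarrow> nat \<Rightarrow> real mat" where
  "Amat L \<alpha> f ye e fd lam n0 =
     four_block_mat (A1mat L \<alpha> f ye e fd n0) (0\<^sub>m (2 * n0 + 2) 1) (L1mat L \<alpha> e fd lam n0) (0\<^sub>m 1 1)"

definition Bmat ::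
    "real \<Rightarrow> real \<Rightarrow> (int \<Rightarrow> state) \<Rightarrow> (int \<Rightarrow> state) \<Rightarrow> (int \<Rightarrow> complex) \<Rightarrow> nat \<Rightarrow> real mat" where
  "Bmat L \<alpha> e fd lam n0 =
     B1mat L \<alpha> fd n0 @\<^sub>r Matrix.mat 1 1 (\<lambda>_. - tail_sum L e fd lam n0 (bvec L \<alpha>))"

text \<open>Controllability of \<open>x' = A x + B u\<close> with scalar input \<open>u\<close>.\<close>

definition controllable :: "real mat \<Rightarrow> real mat \<Rightarrow> bool" where
  "controllable A B \<longleftrightarrow>
     (\<forall>x0 \<in> carrier_vec (dim_row A). \<forall>x1 \<in> carrier_vec (dim_row A). \<forall>T>0.
        \<exists>u x. continuous_on {0..T} u \<and> (\<forall>t\<in>{0..T}. x t \<in> carrier_vec (dim_row A)) \<and>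
          x 0 = x0 \<and> x T = x1 \<and>
          (\<forall>t\<in>{0..T}. \<forall>i<dim_row A.
             ((\<lambda>s. vec_index (x s) i) has_real_derivative
                vec_index (A *\<^sub>v x t) i + B $$ (i, 0) * u t) (at t within {0..T})))"

definition hurwitz :: "real mat \<Rightarrow> bool" where
  "hurwitz M \<longleftrightarrow> (\<forall>\<mu>. eigenvalue (map_mat complex_of_real M) \<mu> \<longrightarrow> Re \<mu> < 0)"


section \<open>The closed-loop system\<close>

definition xi ::
    "real \<Rightarrow> (int \<Rightarrow> state) \<Rightarrow> (int \<Rightarrow> state) \<Rightarrow> (int \<Rightarrow> complex) \<Rightarrow> nat \<Rightarrow> state \<Rightarrow> real \<Rightarrow> real" where
  "xi L e fd lam n0 w \<zeta> = \<zeta> - tail_sum L e fd lam n0 w"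

definition Xvec ::
    "real \<Rightarrow> (int \<Rightarrow> state) \<Rightarrow> (int \<Rightarrow> state) \<Rightarrow> (int \<Rightarrow> complex) \<Rightarrow> nat \<Rightarrow> state \<Rightarrow> real \<Rightarrow> real
       \<Rightarrow> real Matrix.vec" where
  "Xvec L e fd lam n0 w \<zeta> v = Matrix.vec (2 * n0 + 3)
     (\<lambda>i. if i = 0 then v
          else if i \<le> 2 * n0 + 1 then Re (hinner L w (fd (int i - 1 - int n0)))
          else xi L e fd lam n0 w \<zeta>)"

text \<open>The nonlinear residual, for real-valued \<open>w\<close>.\<close>

definition residual :: "(real \<Rightarrow> real) \<Rightarrow> (real \<Rightarrow> real) \<Rightarrow> (real \<Rightarrow> complex) \<Rightarrow> real \<Rightarrow> complex" where
  "residual f ye w x = of_real ((Re (w x))\<^sup>2 *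
     (\<integral>s. (1 - s) * deriv (deriv f) (ye x + s * Re (w x)) \<partial>lebesgue_on {0..1}))"

definition hcontinuous_on :: "real \<Rightarrow> real set \<Rightarrow> (real \<Rightarrow> state) \<Rightarrow> bool" where
  "hcontinuous_on L S W \<longleftrightarrow> (\<forall>t\<in>S. ((\<lambda>s. hnorm L (W s - W t)) \<longlongrightarrow> 0) (at t within S))"

definition has_hderiv_on :: "real \<Rightarrow> real set \<Rightarrow> (real \<Rightarrow> state) \<Rightarrow> (real \<Rightarrow> state) \<Rightarrow> bool" where
  "has_hderiv_on L S W W' \<longleftrightarrow>
     (\<forall>t\<in>S. ((\<lambda>s. hnorm L (hscale (of_real (1 / (s - t))) (W s - W t) - W' t)) \<longlongrightarrow> 0) (at t within S))"

text \<open>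
  Classical solution \<open>(W, \<zeta>, v)\<close> on \<open>[0,T)\<close>, where \<open>T\<close> may be \<open>\<infinity>\<close>.  The boundary conditions are part
  of \<open>W t \<in> domA L \<alpha>\<close>.  By continuity it makes no difference whether the equations are required for
  \<open>t > 0\<close> or for \<open>t \<ge> 0\<close>.
\<close>

definition classical_solution ::
    "real \<Rightarrow> real \<Rightarrow> (real \<Rightarrow> real) \<Rightarrow> (real \<Rightarrow> real) \<Rightarrow> (int \<Rightarrow> state) \<Rightarrow> (int \<Rightarrow> state)
       \<Rightarrow> (int \<Rightarrow> complex) \<Rightarrow> nat \<Rightarrow> real mat \<Rightarrow> (real \<Rightarrow> real)
       \<Rightarrow> ereal \<Rightarrow> (real \<Rightarrow> state) \<Rightarrow> (real \<Rightarrow> real) \<Rightarrow> (real \<Rightarrow> real) \<Rightarrow> bool" where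
  "classical_solution L \<alpha> f ye e fd lam n0 K zr T W \<zeta> v \<longleftrightarrow>
     0 < T \<and>
     (let J = {t. 0 \<le> t \<and> ereal t < T} in
       (\<forall>t\<in>J. W t \<in> domA L \<alpha> \<and> real_valued L (W t)) \<and>
       hcontinuous_on L J W \<and> hcontinuous_on L J (\<lambda>t. opA L f ye (W t)) \<and>
       (\<exists>W' \<zeta>' v'.
          (\<forall>t\<in>J. W' t \<in> hspace L) \<and> has_hderiv_on L J W W' \<and> hcontinuous_on L J W' \<and>
          (\<forall>t\<in>J. (\<zeta> has_real_derivative \<zeta>' t) (at t within J)) \<and> continuous_on J \<zeta>' \<and>
          (\<forall>t\<in>J. (v has_real_derivative v' t) (at t within J)) \<and> continuous_on J v' \<and>
          (\<forall>t\<in>J.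
             heq L (W' t)
               (opA L f ye (W t) + hscale (of_real (v t)) (avec L \<alpha>)
                  + hscale (of_real (v' t)) (bvec L \<alpha>) + (0, residual f ye (fst (W t)))) \<and>
             complex_of_real (\<zeta>' t) = dx L (fst (W t)) 0 - of_real (zr t) \<and>
             v' t = vec_index (K *\<^sub>v Xvec L e fd lam n0 (W t) (\<zeta> t) (v t)) 0)))"

definition maximal_solution ::
    "real \<Rightarrow> real \<Rightarrow> (real \<Rightarrow> real) \<Rightarrow> (real \<Rightarrow> real) \<Rightarrow> (int \<Rightarrow> state) \<Rightarrow> (int \<Rightarrow> state)
       \<Rightarrow> (int \<Rightarrow> complex) \<Rightarrow> nat \<Rightarrow> real mat \<Rightarrow> (real \<Rightarrow> real)
       \<Rightarrow> ereal \<Rightarrow> (real \<Rightarrow> state) \<Rightarrow> (real \<Rightarrow> real) \<Rightarrow> (real \<Rightarrow> real) \<Rightarrow> bool" where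
  "maximal_solution L \<alpha> f ye e fd lam n0 K zr T W \<zeta> v \<longleftrightarrow>
     classical_solution L \<alpha> f ye e fd lam n0 K zr T W \<zeta> v \<and>
     \<not> (\<exists>T'>T. \<exists>W' \<zeta>' v'. classical_solution L \<alpha> f ye e fd lam n0 K zr T' W' \<zeta>' v' \<and>
          (\<forall>t. 0 \<le> t \<and> ereal t < T \<longrightarrow> heq L (W' t) (W t) \<and> \<zeta>' t = \<zeta> t \<and> v' t = v t))"

definition has_initial_data ::
    "real \<Rightarrow> (int \<Rightarrow> state) \<Rightarrow> (int \<Rightarrow> state) \<Rightarrow> (int \<Rightarrow> complex) \<Rightarrow> nat \<Rightarrow> state \<Rightarrow> real \<Rightarrow> real
       \<Rightarrow> (real \<Rightarrow> state) \<Rightarrow> (real \<Rightarrow> real) \<Rightarrow> (real \<Rightarrow> real) \<Rightarrow> bool" where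
  "has_initial_data L e fd lam n0 W0 \<xi>0 v0 W \<zeta> v \<longleftrightarrow>
     heq L (W 0) W0 \<and> xi L e fd lam n0 (W 0) (\<zeta> 0) = \<xi>0 \<and> v 0 = v0"

text \<open>
  The maximal classical solution with the given data is defined on \<open>[0,\<infinity>)\<close> and satisfies
  \<open>P (W t) (\<zeta> t) (v t) t\<close> at all times \<open>t \<ge> 0\<close>.
\<close>

definition solution_satisfies ::
    "real \<Rightarrow> real \<Rightarrow> (real \<Rightarrow> real) \<Rightarrow> (real \<Rightarrow> real) \<Rightarrow> (int \<Rightarrow> state) \<Rightarrow> (int \<Rightarrow> state)
       \<Rightarrow> (int \<Rightarrow> complex) \<Rightarrow> nat \<Rightarrow> real mat \<Rightarrow> state \<Rightarrow> real \<Rightarrow> real \<Rightarrow> (real \<Rightarrow> real)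
       \<Rightarrow> (state \<Rightarrow> real \<Rightarrow> real \<Rightarrow> real \<Rightarrow> bool) \<Rightarrow> bool" where
  "solution_satisfies L \<alpha> f ye e fd lam n0 K W0 \<xi>0 v0 zr P \<longleftrightarrow>
     (\<exists>T W \<zeta> v. maximal_solution L \<alpha> f ye e fd lam n0 K zr T W \<zeta> v \<and>
        has_initial_data L e fd lam n0 W0 \<xi>0 v0 W \<zeta> v) \<and>
     (\<forall>T W \<zeta> v. maximal_solution L \<alpha> f ye e fd lam n0 K zr T W \<zeta> v \<and>
        has_initial_data L e fd lam n0 W0 \<xi>0 v0 W \<zeta> v \<longrightarrow>
        T = \<infinity> \<and> (\<forall>t\<ge>0. P (W t) (\<zeta> t) (v t) t))"

definition admissible_data ::
    "real \<Rightarrow> real \<Rightarrow> real \<Rightarrow> state \<Rightarrow> real \<Rightarrow> real \<Rightarrow> (real \<Rightarrow> real) \<Rightarrow> bool" where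
  "admissible_data L \<alpha> \<delta> W0 \<xi>0 v0 zr \<longleftrightarrow>
     W0 \<in> domA L \<alpha> \<and> real_valued L W0 \<and> (hnorm L W0)\<^sup>2 + \<bar>\<xi>0\<bar>\<^sup>2 + \<bar>v0\<bar>\<^sup>2 \<le> \<delta> \<and>
     C1_on {0..} zr \<and> (linf_norm {0..} zr)\<^sup>2 \<le> ereal \<delta>"

definition stability_property ::
    "real \<Rightarrow> real \<Rightarrow> (real \<Rightarrow> real) \<Rightarrow> (real \<Rightarrow> real) \<Rightarrow> (int \<Rightarrow> state) \<Rightarrow> (int \<Rightarrow> state)
       \<Rightarrow> (int \<Rightarrow> complex) \<Rightarrow> nat \<Rightarrow> real mat \<Rightarrow> real \<Rightarrow> real \<Rightarrow> bool" where
  "stability_property L \<alpha> f ye e fd lam n0 K \<kappa> \<delta> \<longleftrightarrow>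
     (\<exists>C1>0. \<forall>\<eta>. 0 \<le> \<eta> \<and> \<eta> < 1 \<longrightarrow> (\<exists>C2>0. \<forall>W0 \<xi>0 v0 zr.
        admissible_data L \<alpha> \<delta> W0 \<xi>0 v0 zr \<longrightarrow>
        solution_satisfies L \<alpha> f ye e fd lam n0 K W0 \<xi>0 v0 zr
          (\<lambda>w \<zeta> v t. linf_norm {0..L} (fst w) < 1 \<and>
             (hnorm L w)\<^sup>2 + \<bar>xi L e fd lam n0 w \<zeta>\<bar>\<^sup>2 + \<bar>v\<bar>\<^sup>2
               \<le> C1 * exp (- 2 * \<kappa> * t) * ((hnorm L W0)\<^sup>2 + \<bar>\<xi>0\<bar>\<^sup>2 + \<bar>v0\<bar>\<^sup>2)
                 + C2 * (SUP s\<in>{0..t}. exp (- 2 * \<eta> * \<kappa> * (t - s)) * \<bar>zr s\<bar>\<^sup>2))))"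

end

(*
  The time derivative of the state solves the linear equation driven by the time derivative of the
  forcing, so its high-frequency modes z_k = <W', f_k> = lambda_k <W, f_k> + <G, f_k>, with
  G = a v + b v' + (0, r), satisfy z_k' = lambda_k z_k + <G', f_k>.  Here G' is bounded by the size N of
  the state and by the reference.  The only term that could cost a derivative is v'' through xi', but
  the boundary trace in zeta' cancels against the tail series applied to A W, up to low modes.
  For r, use that w^1 stays below 1 in the sup norm, so that r and r' are bounded by N.
  As Re lambda_k < -1, the energy of finitely many z_k then decays at rate kappa < 1 up to the
  weighted supremum of the reference.  The Riesz basis property turns this, together with the low modes
  of A W (bounded by those of W through the adjoint), into a bound of A W, and the trace at 0 is
  bounded by the graph norm.
*)
theory Submission
  imports Defs
begin

section \<open>Square integrable functions and weak derivatives\<close>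

text \<open>Regularity is the obstacle: W' is only continuous in time, so the energy of the whole
  state cannot be differentiated. A single coefficient can, because lambda_k <W, f_k> + <G, f_k> is
  built from functions already known to be differentiable. Hence the energy runs over finite sets of
  high modes, with a constant independent of the set. In r' no derivative is lost: only the first
  component w^2 + x v / (\<alpha> L) of W' occurs, whose L2 norm is bounded by the state although
  the norm of W' is not. The reference reaches G' through \<zeta>' and therefore undifferentiated.

  All estimates are kept as squares until the end and measured by Q(t) = e^(-2 \<kappa> t) D^2 +
  S(t), where D contains the norm of A W(0) and S is the weighted supremum of z_r^2. The time
  dependence of S enters through the growth law S(s) \<le> e^(2 \<eta> \<kappa> (t - s)) S(t), which
  for a fixed final time t leaves a differential inequality with an explicit particular solution.
  Since the constants have to be uniform in the data, they are quantified before the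
  trajectories.\<close>

lemma finite_measure_lebesgue_on_Icc: "finite_measure (lebesgue_on {a..b::real})"
  by (intro finite_measure_lebesgue_on) simp

lemma L2_integrable_mult:
  assumes "g \<in> L2 L" "h \<in> L2 L"
  shows "integrable (lebesgue_on {0..L}) (\<lambda>x. g x * h x)"
proof (rule Bochner_Integration.integrable_bound)
  show "integrable (lebesgue_on {0..L}) (\<lambda>x. (cmod (g x))\<^sup>2 + (cmod (h x))\<^sup>2)"
    using assms by (auto simp: L2_def)
  show "(\<lambda>x. g x * h x) \<in> borel_measurable (lebesgue_on {0..L})"
    using assms by (auto simp: L2_def)
  have "cmod (u * v) \<le> (cmod u)\<^sup>2 + (cmod v)\<^sup>2" for u v
  proof -
    have "0 \<le> (cmod u - cmod v)\<^sup>2" "0 \<le> (cmod u)\<^sup>2" "0 \<le> (cmod v)\<^sup>2" by auto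
    moreover have "0 \<le> cmod u * cmod v" by simp
    ultimately have "cmod u * cmod v \<le> (cmod u)\<^sup>2 + (cmod v)\<^sup>2"
      unfolding power2_diff by linarith
    then show ?thesis by (simp add: norm_mult)
  qed
  then show "AE x in lebesgue_on {0..L}. norm (g x * h x) \<le> norm ((cmod (g x))\<^sup>2 + (cmod (h x))\<^sup>2)"
    by (auto simp: abs_of_nonneg)
qed

lemma L2_cnj: "g \<in> L2 L \<Longrightarrow> (\<lambda>x. cnj (g x)) \<in> L2 L"
proof -
  assume g: "g \<in> L2 L"
  have "(\<lambda>x. cnj (g x)) \<in> borel_measurable (lebesgue_on {0..L})"
    using g by (intro borel_measurable_continuous_on[where f=cnj]) (auto simp: L2_def intro!: continuous_intros)
  with g show ?thesis by (simp add: L2_def)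
qed

lemma L2_integrable_cnj:
  "g \<in> L2 L \<Longrightarrow> h \<in> L2 L \<Longrightarrow> integrable (lebesgue_on {0..L}) (\<lambda>x. g x * cnj (h x))"
  by (rule L2_integrable_mult) (auto intro: L2_cnj)

lemma L2_bounded:
  assumes "g \<in> borel_measurable (lebesgue_on {0..L})" "\<And>x. x \<in> {0..L} \<Longrightarrow> cmod (g x) \<le> B"
  shows "g \<in> L2 L"
proof -
  interpret finite_measure "lebesgue_on {0..L}" by (rule finite_measure_lebesgue_on_Icc)
  have "integrable (lebesgue_on {0..L}) (\<lambda>x. (cmod (g x))\<^sup>2)"
  proof (rule integrable_const_bound[where B="B\<^sup>2"])
    show "AE x in lebesgue_on {0..L}. norm ((cmod (g x))\<^sup>2) \<le> B\<^sup>2"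
      using assms(2) by (intro AE_I2) (auto intro!: power_mono)
  qed (use assms(1) in measurable)
  with assms(1) show ?thesis by (simp add: L2_def)
qed

lemma L2_continuous: "continuous_on {0..L} g \<Longrightarrow> g \<in> L2 L"
proof -
  assume g: "continuous_on {0..L} g"
  then have "compact (g ` {0..L})" by (intro compact_continuous_image) auto
  then obtain B where "\<And>x. x \<in> {0..L} \<Longrightarrow> cmod (g x) \<le> B"
    using compact_imp_bounded bounded_iff by (metis imageI)
  then show ?thesis
    by (intro L2_bounded continuous_imp_measurable_on_sets_lebesgue[OF g]) auto
qed

lemma L2_integrable: "g \<in> L2 L \<Longrightarrow> integrable (lebesgue_on {0..L}) g"
  using L2_integrable_mult[of g L "\<lambda>_. 1"] L2_continuous[of L "\<lambda>_. 1"] by simp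

lemma L2_scale: "g \<in> L2 L \<Longrightarrow> (\<lambda>x. c * g x) \<in> L2 L"
  by (auto simp: L2_def norm_mult power_mult_distrib)

lemma L2_add:
  assumes "g \<in> L2 L" "h \<in> L2 L" shows "(\<lambda>x. g x + h x) \<in> L2 L"
proof -
  have "integrable (lebesgue_on {0..L}) (\<lambda>x. (cmod (g x + h x))\<^sup>2)"
  proof (rule Bochner_Integration.integrable_bound)
    show "integrable (lebesgue_on {0..L}) (\<lambda>x. 2 * (cmod (g x))\<^sup>2 + 2 * (cmod (h x))\<^sup>2)"
      using assms by (auto simp: L2_def)
    show "(\<lambda>x. (cmod (g x + h x))\<^sup>2) \<in> borel_measurable (lebesgue_on {0..L})"
      using assms by (auto simp: L2_def)
    have "(cmod (u + v))\<^sup>2 \<le> 2 * (cmod u)\<^sup>2 + 2 * (cmod v)\<^sup>2" for u v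
    proof -
      have "(cmod (u + v))\<^sup>2 \<le> (cmod u + cmod v)\<^sup>2" by (intro power_mono norm_triangle_ineq) auto
      moreover have "0 \<le> (cmod u - cmod v)\<^sup>2" by simp
      ultimately show ?thesis by (simp add: power2_eq_square algebra_simps)
    qed
    then show "AE x in lebesgue_on {0..L}. norm ((cmod (g x + h x))\<^sup>2)
        \<le> norm (2 * (cmod (g x))\<^sup>2 + 2 * (cmod (h x))\<^sup>2)"
      by (auto simp: abs_of_nonneg)
  qed
  with assms show ?thesis by (auto simp: L2_def)
qed

lemma L2_mult_continuous:
  assumes "continuous_on {0..L} g" "h \<in> L2 L" shows "(\<lambda>x. g x * h x) \<in> L2 L"
proof -
  have "compact (g ` {0..L})" using assms by (intro compact_continuous_image) auto
  then obtain B where B: "\<And>x. x \<in> {0..L} \<Longrightarrow> cmod (g x) \<le> B"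
    using compact_imp_bounded bounded_iff by (metis imageI)
  have meas: "g \<in> borel_measurable (lebesgue_on {0..L})"
    by (intro continuous_imp_measurable_on_sets_lebesgue assms(1)) auto
  have "integrable (lebesgue_on {0..L}) (\<lambda>x. (cmod (g x * h x))\<^sup>2)"
  proof (rule Bochner_Integration.integrable_bound)
    show "integrable (lebesgue_on {0..L}) (\<lambda>x. B\<^sup>2 * (cmod (h x))\<^sup>2)"
      using assms by (auto simp: L2_def)
    show "(\<lambda>x. (cmod (g x * h x))\<^sup>2) \<in> borel_measurable (lebesgue_on {0..L})"
      using assms meas by (auto simp: L2_def)
    have "(cmod (g x))\<^sup>2 \<le> B\<^sup>2" if "x \<in> {0..L}" for x
      using B[OF that] by (intro power_mono) auto
    then show "AE x in lebesgue_on {0..L}. norm ((cmod (g x * h x))\<^sup>2) \<le> norm (B\<^sup>2 * (cmod (h x))\<^sup>2)"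
      by (intro AE_I2) (auto simp: norm_mult power_mult_distrib intro!: mult_right_mono)
  qed
  with assms meas show ?thesis by (auto simp: L2_def)
qed

section \<open>Uniqueness of weak derivatives\<close>

lemma integrable_lebesgue_on_Icc_subset:
  fixes g :: "real \<Rightarrow> 'a::euclidean_space"
  assumes "integrable (lebesgue_on {0..L}) g" "x \<le> L"
  shows "integrable (lebesgue_on {0..x}) g"
  using assms by (intro integrable_subinterval[OF assms(1)]) auto

text \<open>Lebesgue differentiation: at almost every point the averages over
  \<open>[x, x + h]\<close> tend to the value of the function, and here they vanish as differences
  of initial integrals. The extension \<open>D\<close> by zero is integrable on every interval of
  the line; the endpoint \<open>L\<close> is given up because \<open>[x, x + h]\<close> has to stay
  inside \<open>[0, L]\<close>.\<close>

lemma AE_eq_zero_of_integrals_zero: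
  fixes d :: "real \<Rightarrow> 'a::euclidean_space"
  assumes d: "integrable (lebesgue_on {0..L}) d"
    and zero: "\<And>x. 0 \<le> x \<Longrightarrow> x \<le> L \<Longrightarrow> (\<integral>y. d y \<partial>lebesgue_on {0..x}) = 0"
  shows "AE x in lebesgue_on {0..L}. d x = 0"
proof -
  define D where "D = (\<lambda>x. if x \<in> {0..L} then d x else 0)"
  have di: "d integrable_on {0..L}" using integrable_on_lebesgue_on[OF d] by simp
  have dz: "integral {0..x} d = 0" if "0 \<le> x" "x \<le> L" for x
    using zero[OF that] lebesgue_integral_eq_integral[OF integrable_lebesgue_on_Icc_subset[OF d that(2)]]
    by simp
  have Dint: "D integrable_on cbox a b" for a b
  proof -
    have "D integrable_on UNIV" unfolding D_def integrable_restrict_UNIV by (rule di)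
    then show ?thesis using integrable_on_subcbox by blast
  qed
  have zero2: "integral {x..y} D = 0" if "0 \<le> x" "x \<le> y" "y \<le> L" for x y
  proof -
    have "integral {0..x} d + integral {x..y} d = integral {0..y} d"
      using that by (intro Henstock_Kurzweil_Integration.integral_combine integrable_on_subinterval[OF di]) auto
    moreover have "integral {x..y} D = integral {x..y} d"
      using that by (intro integral_cong) (auto simp: D_def)
    ultimately show ?thesis using dz that by simp
  qed
  obtain N where N: "negligible N"
    "\<And>x e. \<lbrakk>x \<notin> N; 0 < e\<rbrakk> \<Longrightarrow> \<exists>d>0. \<forall>h. 0 < h \<and> h < d \<longrightarrow>
        norm (integral (cbox x (x + h *\<^sub>R One)) D /\<^sub>R h ^ DIM(real) - D x) < e"
    using integrable_ccontinuous_explicit[OF Dint] by metis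
  have "d x = 0" if x: "0 \<le> x" "x < L" "x \<notin> N" for x
  proof (rule ccontr)
    assume "d x \<noteq> 0"
    then obtain r where r: "r > 0" "\<And>h. 0 < h \<and> h < r \<Longrightarrow>
        norm (integral (cbox x (x + h *\<^sub>R One)) D /\<^sub>R h ^ DIM(real) - D x) < norm (d x)"
      using N(2)[OF x(3), of "norm (d x)"] by (auto simp: D_def)
    define h where "h = min (r/2) (L - x)"
    have h: "0 < h" "h < r" "x + h \<le> L" using r x by (auto simp: h_def)
    have "integral (cbox x (x + h *\<^sub>R One)) D = 0" using zero2[of x "x+h"] h x by (simp add: cbox_interval)
    with r(2)[of h] h x show False by (auto simp: D_def)
  qed
  then have sub: "{x \<in> {0..L}. d x \<noteq> 0} \<subseteq> N \<union> {L}" by force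
  have "negligible (N \<union> {L})" using N(1) by auto
  then have "negligible {x \<in> {0..L}. d x \<noteq> 0}" using sub negligible_subset by blast
  then have "{x \<in> {0..L}. d x \<noteq> 0} \<in> null_sets (lebesgue_on {0..L})"
    by (auto simp: negligible_iff_null_sets null_sets_restrict_space)
  then show ?thesis by (intro AE_I'[of "{x \<in> {0..L}. d x \<noteq> 0}"]) auto
qed

lemma has_weak_derivD:
  assumes "has_weak_deriv L w g"
  shows "g \<in> L2 L" "x \<in> {0..L} \<Longrightarrow> w x = w 0 + (\<integral>y. g y \<partial>lebesgue_on {0..x})"
  using assms unfolding has_weak_deriv_def by blast+

text \<open>Makes the arbitrary choice in \<open>wderiv\<close> harmless: integrals over it may be
  computed with any weak derivative at hand.\<close>

lemma has_weak_deriv_unique: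
  assumes "has_weak_deriv L w g" "has_weak_deriv L w h"
  shows "AE x in lebesgue_on {0..L}. g x = h x"
proof -
  have gi: "integrable (lebesgue_on {0..L}) g" "integrable (lebesgue_on {0..L}) h"
    using assms by (auto intro: L2_integrable dest: has_weak_derivD(1))
  have "AE x in lebesgue_on {0..L}. g x - h x = 0"
  proof (rule AE_eq_zero_of_integrals_zero)
    show "(\<integral>y. g y - h y \<partial>lebesgue_on {0..x}) = 0" if "0 \<le> x" "x \<le> L" for x
    proof -
      have "(\<integral>y. g y \<partial>lebesgue_on {0..x}) = (\<integral>y. h y \<partial>lebesgue_on {0..x})"
        using has_weak_derivD(2)[OF assms(1), of x] has_weak_derivD(2)[OF assms(2), of x] that
      by (metis add_left_cancel atLeastAtMost_iff)
      then show ?thesis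
        using integrable_lebesgue_on_Icc_subset[OF gi(1) that(2)] integrable_lebesgue_on_Icc_subset[OF gi(2) that(2)]
        by simp
    qed
  qed (use gi in auto)
  then show ?thesis by simp
qed

lemma has_weak_deriv_cong:
  assumes "L \<ge> 0" "\<And>x. x \<in> {0..L} \<Longrightarrow> w x = w' x"
  shows "has_weak_deriv L w g \<longleftrightarrow> has_weak_deriv L w' g"
proof -
  have "w 0 = w' 0" using assms by simp
  then show ?thesis
    unfolding has_weak_deriv_def by (intro conj_cong ball_cong refl) (simp add: assms(2))
qed

lemma has_weak_deriv_add:
  assumes "has_weak_deriv L w g" "has_weak_deriv L w' g'"
  shows "has_weak_deriv L (\<lambda>x. w x + w' x) (\<lambda>x. g x + g' x)"
proof -
  have gi: "integrable (lebesgue_on {0..L}) g" "integrable (lebesgue_on {0..L}) g'"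
    using assms by (auto intro: L2_integrable dest: has_weak_derivD(1))
  show ?thesis
    unfolding has_weak_deriv_def
  proof (intro conjI ballI)
    show "(\<lambda>x. g x + g' x) \<in> L2 L" using assms by (auto intro: L2_add dest: has_weak_derivD(1))
    fix x assume x: "x \<in> {0..L}"
    have "w x = w 0 + (\<integral>y. g y \<partial>lebesgue_on {0..x})" "w' x = w' 0 + (\<integral>y. g' y \<partial>lebesgue_on {0..x})"
      using has_weak_derivD(2)[OF assms(1) x] has_weak_derivD(2)[OF assms(2) x] by auto
    then show "w x + w' x = w 0 + w' 0 + (\<integral>y. g y + g' y \<partial>lebesgue_on {0..x})"
      using x integrable_lebesgue_on_Icc_subset[OF gi(1), of x] integrable_lebesgue_on_Icc_subset[OF gi(2), of x]
      by (simp only: Bochner_Integration.integral_add) simp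
  qed
qed

lemma has_weak_deriv_scale:
  assumes "has_weak_deriv L w g"
  shows "has_weak_deriv L (\<lambda>x. c * w x) (\<lambda>x. c * g x)"
  unfolding has_weak_deriv_def
proof (intro conjI ballI)
  show "(\<lambda>x. c * g x) \<in> L2 L" using assms by (auto intro: L2_scale dest: has_weak_derivD(1))
  fix x assume x: "x \<in> {0..L}"
  have "w x = w 0 + (\<integral>y. g y \<partial>lebesgue_on {0..x})"
    by (rule has_weak_derivD(2)[OF assms x])
  then show "c * w x = c * w 0 + (\<integral>y. c * g y \<partial>lebesgue_on {0..x})"
    by (metis distrib_left integral_mult_right_zero)
qed

lemma has_weak_deriv_const: "has_weak_deriv L (\<lambda>x. c) (\<lambda>x. 0)"
  using L2_continuous[of L "\<lambda>_. 0"] by (simp add: has_weak_deriv_def del: atLeastAtMost_iff)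

lemma has_weak_deriv_wderiv: "w \<in> H1 L \<Longrightarrow> has_weak_deriv L w (wderiv L w)"
  unfolding H1_def wderiv_def using someI_ex[of "has_weak_deriv L w"] by simp

text \<open>Equality holds everywhere and not just almost everywhere, because both sides choose from
  the same predicate.\<close>

lemma wderiv_cong:
  "L \<ge> 0 \<Longrightarrow> (\<And>x. x \<in> {0..L} \<Longrightarrow> w x = w' x) \<Longrightarrow> wderiv L w = wderiv L w'"
  unfolding wderiv_def by (intro arg_cong[where f=Eps] ext has_weak_deriv_cong)

lemma wderiv_AE: "has_weak_deriv L w g \<Longrightarrow> AE x in lebesgue_on {0..L}. wderiv L w x = g x"
  by (rule has_weak_deriv_unique[OF has_weak_deriv_wderiv]) (auto simp: H1_def)

lemma wderiv_L2: "w \<in> H1 L \<Longrightarrow> wderiv L w \<in> L2 L"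
  by (rule has_weak_derivD(1)[OF has_weak_deriv_wderiv])

lemma has_weak_deriv_continuous:
  assumes "has_weak_deriv L w g" "L \<ge> 0" shows "continuous_on {0..L} w"
proof -
  have gi: "integrable (lebesgue_on {0..L}) g"
    using assms by (auto intro: L2_integrable dest: has_weak_derivD(1))
  have "continuous_on {0..L} (\<lambda>x. w 0 + integral {0..x} g)"
    using integrable_on_lebesgue_on[OF gi]
    by (intro continuous_intros indefinite_integral_continuous_1) auto
  moreover have eq: "w 0 + integral {0..x} g = w x" if "x \<in> {0..L}" for x
    using has_weak_derivD(2)[OF assms(1) that] that
      lebesgue_integral_eq_integral[OF integrable_lebesgue_on_Icc_subset[OF gi, of x]]
    by (metis atLeastAtMost_iff fmeasurableD lmeasurable_cbox cbox_interval)
  ultimately show ?thesis by (rule continuous_on_eq)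
qed

lemma H1_continuous: "w \<in> H1 L \<Longrightarrow> L \<ge> 0 \<Longrightarrow> continuous_on {0..L} w"
  by (rule has_weak_deriv_continuous[OF has_weak_deriv_wderiv])

section \<open>The state space\<close>

lemma fst_hscale [simp]: "fst (hscale c w) = (\<lambda>x. c * fst w x)"
  and snd_hscale [simp]: "snd (hscale c w) = (\<lambda>x. c * snd w x)"
  by (simp_all add: hscale_def)

lemma H1_I: "has_weak_deriv L w g \<Longrightarrow> w \<in> H1 L"
  by (auto simp: H1_def)

lemma H1_add: "w \<in> H1 L \<Longrightarrow> z \<in> H1 L \<Longrightarrow> (\<lambda>x. w x + z x) \<in> H1 L"
  by (rule H1_I[OF has_weak_deriv_add]) (auto intro: has_weak_deriv_wderiv)

lemma H1_scale: "w \<in> H1 L \<Longrightarrow> (\<lambda>x. c * w x) \<in> H1 L"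
  by (rule H1_I[OF has_weak_deriv_scale]) (auto intro: has_weak_deriv_wderiv)

lemma wderiv_add_AE:
  "w \<in> H1 L \<Longrightarrow> z \<in> H1 L \<Longrightarrow>
    AE x in lebesgue_on {0..L}. wderiv L (\<lambda>x. w x + z x) x = wderiv L w x + wderiv L z x"
  by (intro wderiv_AE has_weak_deriv_add has_weak_deriv_wderiv)

lemma wderiv_scale_AE:
  "w \<in> H1 L \<Longrightarrow> AE x in lebesgue_on {0..L}. wderiv L (\<lambda>x. c * w x) x = c * wderiv L w x"
  by (intro wderiv_AE has_weak_deriv_scale has_weak_deriv_wderiv)

lemma hspaceD:
  assumes "w \<in> hspace L"
  shows "fst w \<in> H1 L" "snd w \<in> L2 L" "fst w 0 = 0" "wderiv L (fst w) \<in> L2 L"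
  using assms by (auto simp: hspace_def intro: wderiv_L2)

lemma hspace_add: "w \<in> hspace L \<Longrightarrow> z \<in> hspace L \<Longrightarrow> w + z \<in> hspace L"
  using H1_add[of "fst w" L "fst z"] L2_add[of "snd w" L "snd z"]
  by (auto simp: hspace_def plus_fun_def)

lemma hspace_scale: "w \<in> hspace L \<Longrightarrow> hscale c w \<in> hspace L"
  using H1_scale[of "fst w" L c] L2_scale[of "snd w" L c]
  by (auto simp: hspace_def)

lemma hspace_zero: "0 \<in> hspace L"
  using H1_I[OF has_weak_deriv_const[of L 0]] L2_continuous[of L "\<lambda>_. 0"]
  by (auto simp: hspace_def zero_fun_def)

lemma state_diff_eq: "w - z = w + hscale (-1) (z :: state)"
  by (auto simp: prod_eq_iff fun_eq_iff)

lemma hspace_diff: "w \<in> hspace L \<Longrightarrow> z \<in> hspace L \<Longrightarrow> w - z \<in> hspace L"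
  unfolding state_diff_eq by (intro hspace_add hspace_scale)

lemma hspace_sum: "(\<And>k. k \<in> I \<Longrightarrow> w k \<in> hspace L) \<Longrightarrow> (\<Sum>k\<in>I. w k) \<in> hspace L"
  by (induction I rule: infinite_finite_induct) (auto intro: hspace_add hspace_zero)

lemma hinner_integrable:
  "w \<in> hspace L \<Longrightarrow> z \<in> hspace L \<Longrightarrow> integrable (lebesgue_on {0..L})
     (\<lambda>x. wderiv L (fst w) x * cnj (wderiv L (fst z) x) + snd w x * cnj (snd z x))"
  by (intro Bochner_Integration.integrable_add L2_integrable_cnj hspaceD)

lemma hinner_add_left:
  assumes "w \<in> hspace L" "w' \<in> hspace L" "z \<in> hspace L"
  shows "hinner L (w + w') z = hinner L w z + hinner L w' z"
proof -
  have "hinner L (w + w') z = (\<integral>x. (wderiv L (fst w) x * cnj (wderiv L (fst z) x) + snd w x * cnj (snd z x))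
      + (wderiv L (fst w') x * cnj (wderiv L (fst z) x) + snd w' x * cnj (snd z x)) \<partial>lebesgue_on {0..L})"
    unfolding hinner_def
  proof (rule integral_cong_AE)
    show "AE x in lebesgue_on {0..L}. wderiv L (fst (w + w')) x * cnj (wderiv L (fst z) x) + snd (w + w') x * cnj (snd z x)
      = (wderiv L (fst w) x * cnj (wderiv L (fst z) x) + snd w x * cnj (snd z x))
      + (wderiv L (fst w') x * cnj (wderiv L (fst z) x) + snd w' x * cnj (snd z x))"
      using wderiv_add_AE[OF hspaceD(1)[OF assms(1)] hspaceD(1)[OF assms(2)]]
      by eventually_elim (simp add: plus_fun_def algebra_simps)
  qed (intro borel_measurable_integrable Bochner_Integration.integrable_add hinner_integrable hspace_add assms)+
  also have "\<dots> = hinner L w z + hinner L w' z"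
    unfolding hinner_def by (intro Bochner_Integration.integral_add hinner_integrable assms)
  finally show ?thesis .
qed

lemma hinner_scale_left:
  assumes "w \<in> hspace L" "z \<in> hspace L"
  shows "hinner L (hscale c w) z = c * hinner L w z"
proof -
  have "hinner L (hscale c w) z = (\<integral>x. c * (wderiv L (fst w) x * cnj (wderiv L (fst z) x) + snd w x * cnj (snd z x))
      \<partial>lebesgue_on {0..L})"
    unfolding hinner_def
  proof (rule integral_cong_AE)
    show "AE x in lebesgue_on {0..L}. wderiv L (fst (hscale c w)) x * cnj (wderiv L (fst z) x) + snd (hscale c w) x * cnj (snd z x)
      = c * (wderiv L (fst w) x * cnj (wderiv L (fst z) x) + snd w x * cnj (snd z x))"
      using wderiv_scale_AE[OF hspaceD(1)[OF assms(1)], of c]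
      by eventually_elim (simp add: algebra_simps)
  qed (intro borel_measurable_integrable integrable_mult_right hinner_integrable hspace_scale assms)+
  then show ?thesis unfolding hinner_def by simp
qed

lemma hinner_commute: "hinner L z w = cnj (hinner L w z)"
proof -
  have "hinner L z w = (\<integral>x. cnj (wderiv L (fst w) x * cnj (wderiv L (fst z) x) + snd w x * cnj (snd z x))
      \<partial>lebesgue_on {0..L})"
    unfolding hinner_def by (intro Bochner_Integration.integral_cong) (auto simp: algebra_simps)
  then show ?thesis unfolding hinner_def by (simp only: Bochner_Integration.integral_cnj)
qed

lemma hinner_diff_left:
  assumes "w \<in> hspace L" "w' \<in> hspace L" "z \<in> hspace L"
  shows "hinner L (w - w') z = hinner L w z - hinner L w' z"
  unfolding state_diff_eq using assms by (simp add: hinner_add_left hinner_scale_left hspace_scale)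

lemma hinner_zero_left: "z \<in> hspace L \<Longrightarrow> hinner L 0 z = 0"
  using hinner_diff_left[OF hspace_zero hspace_zero, of z] by simp

lemma hinner_sum_left:
  assumes "\<And>k. k \<in> I \<Longrightarrow> w k \<in> hspace L" "z \<in> hspace L"
  shows "hinner L (\<Sum>k\<in>I. w k) z = (\<Sum>k\<in>I. hinner L (w k) z)"
  using assms(1)
  by (induction I rule: infinite_finite_induct)
     (auto simp: hinner_zero_left hinner_add_left hspace_sum assms(2))

lemma hinner_sum_right:
  assumes "\<And>k. k \<in> I \<Longrightarrow> w k \<in> hspace L" "z \<in> hspace L"
  shows "hinner L z (\<Sum>k\<in>I. w k) = (\<Sum>k\<in>I. hinner L z (w k))"
  by (subst (1 2) hinner_commute) (simp add: hinner_sum_left assms)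

lemma hinner_scale_right:
  assumes "w \<in> hspace L" "z \<in> hspace L"
  shows "hinner L w (hscale c z) = cnj c * hinner L w z"
  by (subst (1 2) hinner_commute) (simp add: hinner_scale_left assms)

lemma hinner_diff_right:
  assumes "w \<in> hspace L" "w' \<in> hspace L" "z \<in> hspace L"
  shows "hinner L z (w - w') = hinner L z w - hinner L z w'"
  by (subst (1 2 3) hinner_commute) (simp add: hinner_diff_left assms)

lemma hinner_cong:
  assumes L: "L \<ge> 0" and w: "w \<in> hspace L" "w' \<in> hspace L" "heq L w w'" and z: "z \<in> hspace L"
  shows "hinner L w z = hinner L w' z"
  unfolding hinner_def
proof (rule integral_cong_AE)
  have d: "wderiv L (fst w) = wderiv L (fst w')"
    using w(3) L by (intro wderiv_cong) (auto simp: heq_def)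
  have "AE x in lebesgue_on {0..L}. snd w x = snd w' x"
    using w(3) by (auto simp: heq_def)
  then show "AE x in lebesgue_on {0..L}. wderiv L (fst w) x * cnj (wderiv L (fst z) x) + snd w x * cnj (snd z x)
      = wderiv L (fst w') x * cnj (wderiv L (fst z) x) + snd w' x * cnj (snd z x)"
    unfolding d by eventually_elim simp
qed (intro borel_measurable_integrable hinner_integrable w z)+

lemma hinner_cong_right:
  assumes L: "L \<ge> 0" and w: "w \<in> hspace L" "w' \<in> hspace L" "heq L w w'" and z: "z \<in> hspace L"
  shows "hinner L z w = hinner L z w'"
  by (subst (1 2) hinner_commute) (simp add: hinner_cong[OF assms])

lemma hnorm_cong:
  assumes "L \<ge> 0" "w \<in> hspace L" "w' \<in> hspace L" "heq L w w'"
  shows "hnorm L w = hnorm L w'"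
  unfolding hnorm_def using hinner_cong[OF assms(1-4,2)] hinner_cong_right[OF assms(1-4,3)] by simp

lemma hinner_self:
  assumes "w \<in> hspace L"
  shows "hinner L w w = of_real (\<integral>x. (cmod (wderiv L (fst w) x))\<^sup>2 + (cmod (snd w x))\<^sup>2 \<partial>lebesgue_on {0..L})"
proof -
  have "hinner L w w = (\<integral>x. complex_of_real ((cmod (wderiv L (fst w) x))\<^sup>2 + (cmod (snd w x))\<^sup>2) \<partial>lebesgue_on {0..L})"
    unfolding hinner_def by (intro Bochner_Integration.integral_cong) (simp_all add: complex_norm_square del: of_real_power)
  then show ?thesis by (simp only: integral_complex_of_real)
qed

text \<open>Stated for arbitrary pairs, so the default value has to be covered: the integral of a
  non-integrable function is 0. Otherwise the real part is the integral of a sum of squares.\<close>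

lemma hnorm_nonneg [simp]: "0 \<le> hnorm L w"
proof -
  let ?i = "\<lambda>x. wderiv L (fst w) x * cnj (wderiv L (fst w) x) + snd w x * cnj (snd w x)"
  have "Re (hinner L w w) = (\<integral>x. Re (?i x) \<partial>lebesgue_on {0..L}) \<or> Re (hinner L w w) = 0"
  proof (cases "integrable (lebesgue_on {0..L}) ?i")
    case True
    then show ?thesis unfolding hinner_def by (intro disjI1) (rule integral_Re[symmetric])
  next
    case False
    then show ?thesis unfolding hinner_def by (intro disjI2) (subst not_integrable_integral_eq, simp_all)
  qed
  moreover have "0 \<le> (\<integral>x. Re (wderiv L (fst w) x * cnj (wderiv L (fst w) x) + snd w x * cnj (snd w x)) \<partial>lebesgue_on {0..L})"
    by (intro Bochner_Integration.integral_nonneg_AE) simp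
  ultimately show ?thesis by (auto simp: hnorm_def)
qed

lemma hnorm_sq_integral:
  assumes "w \<in> hspace L"
  shows "(hnorm L w)\<^sup>2 = (\<integral>x. (cmod (wderiv L (fst w) x))\<^sup>2 + (cmod (snd w x))\<^sup>2 \<partial>lebesgue_on {0..L})"
  unfolding hnorm_def hinner_self[OF assms] by (simp add: Bochner_Integration.integral_nonneg)

lemma hinner_self_hnorm:
  assumes "w \<in> hspace L" shows "hinner L w w = of_real ((hnorm L w)\<^sup>2)"
  by (simp only: hinner_self[OF assms] hnorm_sq_integral[OF assms])

text \<open>The discriminant argument behind the Cauchy-Schwarz inequality: for
  \<open>c \<noteq> 0\<close> the quadratic is evaluated at its minimiser
  \<open>b / c\<^sup>2\<close>.\<close>

lemma le_sqrt_mult_of_quadratic_nonneg: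
  fixes a b c :: real
  assumes "\<And>r. 0 \<le> a\<^sup>2 - 2 * r * b + r\<^sup>2 * c\<^sup>2" "a \<ge> 0" "c \<ge> 0" shows "b \<le> a * c"
proof (cases "c = 0")
  case True
  show ?thesis
  proof (rule ccontr)
    assume "\<not> b \<le> a * c"
    then have "b > 0" using True by simp
    \<comment> \<open>For \<open>c = 0\<close> the expression is affine in \<open>r\<close>, and at
      this point its value is -1.\<close>
    with assms(1)[of "(a\<^sup>2 + 1) / (2 * b)"] True show False by simp
  qed
next
  case False
  then have "a * c * (a * c) \<ge> b * b"
    using assms(1)[of "b / c\<^sup>2"] assms(3) by (simp add: field_simps power2_eq_square)
  then show ?thesis using assms by (metis abs_le_square_iff abs_of_nonneg abs_le_D1 mult_nonneg_nonneg power2_eq_square)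
qed

lemma hnorm_diff_scale_sq:
  assumes w: "w \<in> hspace L" and z: "z \<in> hspace L"
  shows "(hnorm L (w - hscale c z))\<^sup>2 = (hnorm L w)\<^sup>2 - 2 * Re (cnj c * hinner L w z) + (cmod c)\<^sup>2 * (hnorm L z)\<^sup>2"
proof -
  have cz: "hscale c z \<in> hspace L" using z by (rule hspace_scale)
  have "complex_of_real ((hnorm L (w - hscale c z))\<^sup>2) = hinner L (w - hscale c z) (w - hscale c z)"
    using w cz by (simp add: hinner_self_hnorm hspace_diff)
  also have "\<dots> = of_real ((hnorm L w)\<^sup>2) - cnj c * hinner L w z - c * cnj (hinner L w z)
      + c * cnj c * of_real ((hnorm L z)\<^sup>2)"
    using w z cz
    by (simp add: hinner_diff_left hinner_diff_right hinner_scale_left hinner_scale_right hspace_diff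
        hinner_self_hnorm[symmetric] hinner_commute[of L w z, symmetric] algebra_simps hinner_commute[of L z w]
        del: of_real_power)
  finally have "Re (complex_of_real ((hnorm L (w - hscale c z))\<^sup>2)) = Re (of_real ((hnorm L w)\<^sup>2) - cnj c * hinner L w z - c * cnj (hinner L w z)
      + c * cnj c * of_real ((hnorm L z)\<^sup>2))" by (rule arg_cong)
  then show ?thesis
    by (simp only: complex_mult_cnj cmod_power2 flip: of_real_mult) (simp add: algebra_simps)
qed

lemma hinner_Cauchy_Schwarz:
  assumes w: "w \<in> hspace L" and z: "z \<in> hspace L"
  shows "cmod (hinner L w z) \<le> hnorm L w * hnorm L z"
proof (rule le_sqrt_mult_of_quadratic_nonneg)
  fix r :: real
  \<comment> \<open>The phase \<open>u\<close> turns the inner product into its modulus, so that a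
    real parameter \<open>r\<close> suffices. Since \<open>sgn 0 = 0\<close>, only
    \<open>cmod u \<le> 1\<close> holds in general.\<close>
  define u where "u = sgn (hinner L w z)"
  have u: "cnj u * hinner L w z = of_real (cmod (hinner L w z))" "cmod u \<le> 1"
  proof -
    show "cnj u * hinner L w z = of_real (cmod (hinner L w z))"
    proof (cases "hinner L w z = 0")
      case False
      have "cnj u * hinner L w z = of_real ((cmod (hinner L w z))\<^sup>2) / of_real (cmod (hinner L w z))"
        by (simp add: u_def sgn_eq complex_norm_square mult.commute del: of_real_power)
      with False show ?thesis by (simp add: power2_eq_square)
    qed simp
    show "cmod u \<le> 1" by (simp add: u_def norm_sgn)
  qed
  have "0 \<le> (hnorm L (w - hscale (of_real r * u) z))\<^sup>2" by simp
  also have "\<dots> = (hnorm L w)\<^sup>2 - 2 * r * cmod (hinner L w z) + r\<^sup>2 * ((cmod u)\<^sup>2 * (hnorm L z)\<^sup>2)"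
    using u(1) by (simp add: hnorm_diff_scale_sq[OF w z] norm_mult power_mult_distrib mult.assoc)
  also have "\<dots> \<le> (hnorm L w)\<^sup>2 - 2 * r * cmod (hinner L w z) + r\<^sup>2 * (hnorm L z)\<^sup>2"
    using u(2) by (intro add_left_mono mult_left_mono mult_left_le_one_le) (auto simp: power_le_one)
  finally show "0 \<le> (hnorm L w)\<^sup>2 - 2 * r * cmod (hinner L w z) + r\<^sup>2 * (hnorm L z)\<^sup>2" .
qed auto

lemma hnorm_scale:
  assumes w: "w \<in> hspace L" shows "hnorm L (hscale c w) = cmod c * hnorm L w"
proof -
  have "complex_of_real ((hnorm L (hscale c w))\<^sup>2) = c * cnj c * of_real ((hnorm L w)\<^sup>2)"
    using w by (simp add: hinner_self_hnorm[symmetric] hspace_scale hinner_scale_left hinner_scale_right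
        del: of_real_power)
  also have "\<dots> = of_real ((cmod c * hnorm L w)\<^sup>2)"
    by (simp add: complex_norm_square power_mult_distrib del: of_real_power)
  finally have "(hnorm L (hscale c w))\<^sup>2 = (cmod c * hnorm L w)\<^sup>2"
    by (simp only: of_real_eq_iff)
  then show ?thesis by simp
qed

lemma hnorm_triangle:
  assumes w: "w \<in> hspace L" and z: "z \<in> hspace L"
  shows "hnorm L (w + z) \<le> hnorm L w + hnorm L z"
proof -
  have eq: "w + z = w - hscale (-1) z" by (auto simp: prod_eq_iff fun_eq_iff)
  have "(hnorm L (w + z))\<^sup>2 = (hnorm L w)\<^sup>2 + 2 * Re (hinner L w z) + (hnorm L z)\<^sup>2"
    unfolding eq hnorm_diff_scale_sq[OF w z, of "-1"] by simp
  also have "\<dots> \<le> (hnorm L w)\<^sup>2 + 2 * (hnorm L w * hnorm L z) + (hnorm L z)\<^sup>2"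
    using order_trans[OF complex_Re_le_cmod hinner_Cauchy_Schwarz[OF w z]] by simp
  also have "\<dots> = (hnorm L w + hnorm L z)\<^sup>2" by (simp add: power2_sum)
  finally show ?thesis by (simp add: power2_le_iff_abs_le)
qed

lemma hnorm_diff_triangle:
  assumes "w \<in> hspace L" "z \<in> hspace L"
  shows "hnorm L (w - z) \<le> hnorm L w + hnorm L z"
  unfolding state_diff_eq using hnorm_triangle[OF assms(1) hspace_scale[OF assms(2)], of "-1"] assms
  by (simp add: hnorm_scale)

text \<open>The \<open>L\<^sup>2\<close> norm of \<open>g\<close> is \<open>hnorm L (0, g)\<close>.\<close>

lemma zero_pair_hspace: "g \<in> L2 L \<Longrightarrow> (0, g) \<in> hspace L"
  using hspace_zero[of L] by (simp add: hspace_def)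

lemma wderiv_zero_AE: "AE x in lebesgue_on {0..L}. wderiv L 0 x = 0"
  using wderiv_AE[OF has_weak_deriv_const[of L 0]] by (simp add: zero_fun_def)

lemma hnorm_zero_pair_sq:
  assumes "g \<in> L2 L"
  shows "(hnorm L (0, g))\<^sup>2 = (\<integral>x. (cmod (g x))\<^sup>2 \<partial>lebesgue_on {0..L})"
  unfolding hnorm_sq_integral[OF zero_pair_hspace[OF assms]]
proof (rule integral_cong_AE)
  show "AE x in lebesgue_on {0..L}. (cmod (wderiv L (fst (0, g)) x))\<^sup>2 + (cmod (snd (0, g) x))\<^sup>2 = (cmod (g x))\<^sup>2"
    using wderiv_zero_AE[of L] by eventually_elim simp
  have "0 \<in> H1 L" using hspace_zero[of L] by (simp add: hspace_def)
  then show "(\<lambda>x. (cmod (wderiv L (fst (0, g)) x))\<^sup>2 + (cmod (snd (0, g) x))\<^sup>2) \<in> borel_measurable (lebesgue_on {0..L})"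
    using wderiv_L2[of 0 L] assms by (auto simp: L2_def)
qed (use assms in \<open>auto simp: L2_def\<close>)

lemma hnorm_sq_split:
  assumes "w \<in> hspace L"
  shows "(hnorm L w)\<^sup>2 = (hnorm L (0, wderiv L (fst w)))\<^sup>2 + (hnorm L (0, snd w))\<^sup>2"
proof -
  note * = hspaceD(2)[OF assms] hspaceD(4)[OF assms]
  show ?thesis
    unfolding hnorm_zero_pair_sq[OF *(1)] hnorm_zero_pair_sq[OF *(2)] hnorm_sq_integral[OF assms]
    using * by (intro Bochner_Integration.integral_add) (auto simp: L2_def)
qed

lemma hnorm_components_le:
  assumes "w \<in> hspace L"
  shows "hnorm L (0, wderiv L (fst w)) \<le> hnorm L w" "hnorm L (0, snd w) \<le> hnorm L w"
  using hnorm_sq_split[OF assms] by (simp_all add: power2_le_imp_le)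

lemma hnorm_zero_pair_mono:
  assumes "g \<in> L2 L" "h \<in> L2 L" "c \<ge> 0" "AE x in lebesgue_on {0..L}. cmod (g x) \<le> c * cmod (h x)"
  shows "hnorm L (0, g) \<le> c * hnorm L (0, h)"
proof (rule power2_le_imp_le)
  have "(hnorm L (0, g))\<^sup>2 \<le> (\<integral>x. c\<^sup>2 * (cmod (h x))\<^sup>2 \<partial>lebesgue_on {0..L})"
    unfolding hnorm_zero_pair_sq[OF assms(1)]
  proof (rule integral_mono_AE)
    show "AE x in lebesgue_on {0..L}. (cmod (g x))\<^sup>2 \<le> c\<^sup>2 * (cmod (h x))\<^sup>2"
      using assms(4) by eventually_elim (metis norm_ge_zero power_mono power_mult_distrib)
  qed (use assms in \<open>auto simp: L2_def\<close>)
  then show "(hnorm L (0, g))\<^sup>2 \<le> (c * hnorm L (0, h))\<^sup>2"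
    by (simp add: power_mult_distrib hnorm_zero_pair_sq[OF assms(2)])
qed (use assms in auto)

lemma hnorm_zero_pair_cong:
  assumes "g \<in> L2 L" "h \<in> L2 L" "AE x in lebesgue_on {0..L}. g x = h x"
  shows "hnorm L (0, g) = hnorm L (0, h)"
proof -
  have "AE x in lebesgue_on {0..L}. cmod (g x) \<le> 1 * cmod (h x)" "AE x in lebesgue_on {0..L}. cmod (h x) \<le> 1 * cmod (g x)"
    using assms(3) by (eventually_elim, simp)+
  from hnorm_zero_pair_mono[OF assms(1,2) _ this(1)] hnorm_zero_pair_mono[OF assms(2,1) _ this(2)]
  show ?thesis by simp
qed

section \<open>Sup and L1 bounds from the L2 norm\<close>

lemma L2_const: "(\<lambda>_. c) \<in> L2 L"
  by (intro L2_continuous continuous_intros)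

lemma hnorm_zero_pair_one: "0 \<le> L \<Longrightarrow> hnorm L (0, \<lambda>_. 1) = sqrt L"
  using hnorm_zero_pair_sq[OF L2_const[of 1 L]]
  by (intro real_sqrt_unique[symmetric]) (simp_all add: measure_restrict_space)

lemma hnorm_zero_pair_le_bound:
  assumes "0 \<le> L" "g \<in> L2 L" "B \<ge> 0" "AE x in lebesgue_on {0..L}. cmod (g x) \<le> B"
  shows "hnorm L (0, g) \<le> sqrt L * B"
  using hnorm_zero_pair_mono[OF assms(2) L2_const[of 1 L] assms(3)] assms(4) hnorm_zero_pair_one[OF assms(1)]
  by (simp add: mult.commute)

text \<open>Cauchy-Schwarz in the state space, applied to the pairs with first component 0 and
  second components |g| and 1.\<close>

lemma L2_integral_norm_le:
  assumes L: "0 \<le> L" and g: "g \<in> L2 L"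
  shows "(\<integral>x. cmod (g x) \<partial>lebesgue_on {0..L}) \<le> sqrt L * hnorm L (0, g)"
proof -
  let ?g = "\<lambda>x. complex_of_real (cmod (g x))"
  have g': "?g \<in> L2 L" using g by (auto simp: L2_def)
  have "hinner L (0, ?g) (0, \<lambda>_. 1) = (\<integral>x. ?g x \<partial>lebesgue_on {0..L})"
    unfolding hinner_def
  proof (rule integral_cong_AE)
    show "AE x in lebesgue_on {0..L}. wderiv L (fst (0, ?g)) x * cnj (wderiv L (fst (0, \<lambda>_. 1)) x)
        + snd (0, ?g) x * cnj (snd (0, \<lambda>_. 1) x) = ?g x"
      using wderiv_zero_AE[of L] by eventually_elim simp
  qed (intro borel_measurable_integrable hinner_integrable zero_pair_hspace g' L2_const L2_integrable)+
  then have "(\<integral>x. cmod (g x) \<partial>lebesgue_on {0..L}) = Re (hinner L (0, ?g) (0, \<lambda>_. 1))"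
    by simp
  also have "\<dots> \<le> hnorm L (0, ?g) * hnorm L (0, \<lambda>_. 1)"
    by (rule order_trans[OF complex_Re_le_cmod])
       (intro hinner_Cauchy_Schwarz zero_pair_hspace g' L2_const)
  also have "hnorm L (0, ?g) = hnorm L (0, g)"
  proof (rule power2_eq_imp_eq)
    show "(hnorm L (0, ?g))\<^sup>2 = (hnorm L (0, g))\<^sup>2"
      unfolding hnorm_zero_pair_sq[OF g'] hnorm_zero_pair_sq[OF g] by simp
  qed simp_all
  finally show ?thesis unfolding hnorm_zero_pair_one[OF L] by (simp only: mult.commute)
qed

lemma L2_initial_integral_le:
  assumes L: "0 \<le> L" and g: "g \<in> L2 L" and x: "x \<in> {0..L}"
  shows "cmod (\<integral>y. g y \<partial>lebesgue_on {0..x}) \<le> sqrt L * hnorm L (0, g)"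
proof -
  have gi: "integrable (lebesgue_on {0..L}) g" using g by (rule L2_integrable)
  have gx: "integrable (lebesgue_on {0..x}) g"
    using integrable_lebesgue_on_Icc_subset[OF gi, of x] x by auto
  have "cmod (\<integral>y. g y \<partial>lebesgue_on {0..x}) \<le> (\<integral>y. cmod (g y) \<partial>lebesgue_on {0..x})"
    by (rule integral_norm_bound)
  also have "\<dots> = integral {0..x} (\<lambda>y. cmod (g y))"
    using gx by (intro lebesgue_integral_eq_integral) auto
  also have "\<dots> \<le> integral {0..L} (\<lambda>y. cmod (g y))"
    using x integrable_on_lebesgue_on[OF integrable_norm[OF gi]] integrable_on_lebesgue_on[OF integrable_norm[OF gx]]
    by (intro integral_subset_le) auto
  also have "\<dots> = (\<integral>y. cmod (g y) \<partial>lebesgue_on {0..L})"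
    using gi by (intro lebesgue_integral_eq_integral[symmetric]) auto
  also have "\<dots> \<le> sqrt L * hnorm L (0, g)" using L g by (rule L2_integral_norm_le)
  finally show ?thesis .
qed

text \<open>The condition \<open>fst w 0 = 0\<close> removes the constant of integration, so the L2
  norm of the derivative alone controls the sup norm.\<close>

lemma hspace_sup_le:
  assumes "0 \<le> L" "w \<in> hspace L" "x \<in> {0..L}"
  shows "cmod (fst w x) \<le> sqrt L * hnorm L w"
proof -
  have "fst w x = (\<integral>y. wderiv L (fst w) y \<partial>lebesgue_on {0..x})"
    using has_weak_derivD(2)[OF has_weak_deriv_wderiv[OF hspaceD(1)[OF assms(2)]] assms(3)] hspaceD(3)[OF assms(2)]
    by simp
  then have "cmod (fst w x) \<le> sqrt L * hnorm L (0, wderiv L (fst w))"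
    using L2_initial_integral_le[OF assms(1) hspaceD(4)[OF assms(2)] assms(3)] by simp
  also have "\<dots> \<le> sqrt L * hnorm L w"
    using assms(1) hnorm_components_le(1)[OF assms(2)] by (intro mult_left_mono) auto
  finally show ?thesis .
qed

section \<open>Pointwise derivatives of H2 functions and the trace at 0\<close>

lemma has_weak_deriv_has_vector_derivative:
  assumes "has_weak_deriv L w g" "continuous_on {0..L} g" "x \<in> {0..L}"
  shows "(w has_vector_derivative g x) (at x within {0..L})"
proof (rule has_vector_derivative_transform[OF assms(3)])
  have gi: "integrable (lebesgue_on {0..L}) g"
    using has_weak_derivD(1)[OF assms(1)] by (rule L2_integrable)
  show "w y = w 0 + integral {0..y} g" if "y \<in> {0..L}" for y
    using has_weak_derivD(2)[OF assms(1) that] that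
      lebesgue_integral_eq_integral[OF integrable_lebesgue_on_Icc_subset[OF gi, of y]]
    by (metis atLeastAtMost_iff fmeasurableD lmeasurable_cbox cbox_interval)
  show "((\<lambda>y. w 0 + integral {0..y} g) has_vector_derivative g x) (at x within {0..L})"
    using integral_has_vector_derivative[OF assms(2,3)]
    by (auto intro!: derivative_eq_intros)
qed

text \<open>The difference vanishes almost everywhere and hence is a weak derivative of the zero
  function; being continuous, it is also the pointwise derivative of that function.\<close>

lemma continuous_AE_eq_imp_eq:
  fixes g h :: "real \<Rightarrow> complex"
  assumes L: "0 < L" and c: "continuous_on {0..L} g" "continuous_on {0..L} h"
    and eq: "AE x in lebesgue_on {0..L}. g x = h x" and x: "x \<in> {0..L}"
  shows "g x = h x"
proof -
  have d: "(\<lambda>x. g x - h x) \<in> L2 L" using c by (intro L2_continuous continuous_intros)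
  have "has_weak_deriv L (\<lambda>_. 0) (\<lambda>x. g x - h x)"
    unfolding has_weak_deriv_def
  proof (intro conjI ballI)
    fix y assume y: "y \<in> {0..L}"
    have "(\<integral>z. g z - h z \<partial>lebesgue_on {0..y}) = (\<integral>z. 0 \<partial>lebesgue_on {0..y})"
    proof (rule integral_cong_AE)
      show "AE z in lebesgue_on {0..y}. g z - h z = 0"
        using eq y by (simp add: AE_restrict_space_iff) (auto elim!: eventually_mono)
      show "(\<lambda>z. g z - h z) \<in> borel_measurable (lebesgue_on {0..y})"
        using integrable_lebesgue_on_Icc_subset[OF L2_integrable[OF d], of y] y by auto
    qed auto
    then show "0 = 0 + (\<integral>z. g z - h z \<partial>lebesgue_on {0..y})" by simp
  qed (rule d)
  then have "((\<lambda>_. 0) has_vector_derivative g x - h x) (at x within {0..L})"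
    using c x by (intro has_weak_deriv_has_vector_derivative continuous_intros)
  moreover have "((\<lambda>_. 0 :: complex) has_vector_derivative 0) (at x within {0..L})" by simp
  ultimately have "g x - h x = 0"
    using vector_derivative_unique_within_closed_interval[of 0 L x "\<lambda>_. 0 :: complex"] L x
    by (metis atLeastAtMost_iff cbox_interval)
  then show ?thesis by simp
qed

lemma H2_imp_H1: "w \<in> H2 L \<Longrightarrow> w \<in> H1 L"
  by (auto simp: H1_def H2_def)

text \<open>Connects the two derivatives in use: \<open>H2\<close> speaks of a weak one,
  \<open>dx\<close> of the pointwise one. The weak derivative lies in \<open>H1\<close>, so it is
  continuous and agrees with \<open>dx\<close> on all of \<open>[0, L]\<close>.\<close>

lemma H2_dx:
  assumes L: "0 < L" and w: "w \<in> H2 L"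
  shows "has_weak_deriv L w (dx L w)" "dx L w \<in> H1 L"
proof -
  obtain g where g: "has_weak_deriv L w g" "g \<in> H1 L" using w by (auto simp: H2_def)
  have gc: "continuous_on {0..L} g" using g(2) L by (intro H1_continuous) auto
  have eq: "dx L w x = g x" if "x \<in> {0..L}" for x
    unfolding dx_def using has_weak_deriv_has_vector_derivative[OF g(1) gc that] L that
    by (intro vector_derivative_within_closed_interval) auto
  have dc: "continuous_on {0..L} (dx L w)"
    using gc by (rule continuous_on_eq) (simp add: eq)
  show "has_weak_deriv L w (dx L w)"
    unfolding has_weak_deriv_def
  proof (intro conjI ballI)
    show "dx L w \<in> L2 L" using dc by (rule L2_continuous)
    fix x assume x: "x \<in> {0..L}"
    have "(\<integral>y. g y \<partial>lebesgue_on {0..x}) = (\<integral>y. dx L w y \<partial>lebesgue_on {0..x})"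
      using x by (intro Bochner_Integration.integral_cong) (auto simp: eq)
    then show "w x = w 0 + (\<integral>y. dx L w y \<partial>lebesgue_on {0..x})"
      using has_weak_derivD(2)[OF g(1) x] by simp
  qed
  obtain h where "has_weak_deriv L g h" using g(2) by (auto simp: H1_def)
  then have "has_weak_deriv L (dx L w) h"
    using has_weak_deriv_cong[of L "dx L w" g h] eq L by simp
  then show "dx L w \<in> H1 L" by (rule H1_I)
qed

lemma dx_unique:
  assumes "0 < L" "has_weak_deriv L w g" "continuous_on {0..L} g" "x \<in> {0..L}"
  shows "dx L w x = g x"
  unfolding dx_def using has_weak_deriv_has_vector_derivative[OF assms(2-4)] assms
  by (intro vector_derivative_within_closed_interval) auto

lemma dx_continuous: "0 < L \<Longrightarrow> w \<in> H2 L \<Longrightarrow> continuous_on {0..L} (dx L w)"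
  by (rule H1_continuous[OF H2_dx(2)]) auto

lemma dx_add:
  assumes "0 < L" "w \<in> H2 L" "z \<in> H2 L" "x \<in> {0..L}"
  shows "dx L (\<lambda>x. w x + z x) x = dx L w x + dx L z x"
  using assms by (intro dx_unique[where g="\<lambda>x. dx L w x + dx L z x"] has_weak_deriv_add H2_dx(1)
      continuous_on_add dx_continuous) auto

lemma dx_scale:
  assumes "0 < L" "w \<in> H2 L" "x \<in> {0..L}"
  shows "dx L (\<lambda>x. c * w x) x = c * dx L w x"
  using assms by (intro dx_unique[where g="\<lambda>x. c * dx L w x"] has_weak_deriv_scale H2_dx(1)
      continuous_on_mult continuous_on_const dx_continuous) auto

lemma H2_add: "0 < L \<Longrightarrow> w \<in> H2 L \<Longrightarrow> z \<in> H2 L \<Longrightarrow> (\<lambda>x. w x + z x) \<in> H2 L"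
  unfolding H2_def[of L] mem_Collect_eq
  by (intro exI[of _ "\<lambda>x. dx L w x + dx L z x"] conjI has_weak_deriv_add H1_add H2_dx) (auto simp: H2_def)

lemma H2_scale: "0 < L \<Longrightarrow> w \<in> H2 L \<Longrightarrow> (\<lambda>x. c * w x) \<in> H2 L"
  unfolding H2_def[of L] mem_Collect_eq
  by (intro exI[of _ "\<lambda>x. c * dx L w x"] conjI has_weak_deriv_scale H1_scale H2_dx) (auto simp: H2_def)

text \<open>No boundary condition restricts w' at 0. Its value there is therefore compared with
  w'(x) for every x, at the cost of the integral of w'', and the comparison is averaged over the
  interval; this averaging produces the factor \<open>1 / sqrt L\<close>.\<close>

lemma dx_zero_le:
  assumes L: "0 < L" and w: "w \<in> H2 L"
  shows "cmod (dx L w 0) \<le> hnorm L (0, wderiv L w) / sqrt L + sqrt L * hnorm L (0, wderiv L (dx L w))"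
proof -
  let ?g = "dx L w" let ?H = "sqrt L * hnorm L (0, wderiv L (dx L w))"
  note g = H2_dx[OF L w]
  have gL2: "?g \<in> L2 L" using has_weak_derivD(1)[OF g(1)] .
  have le: "cmod (?g 0) \<le> cmod (?g x) + ?H" if x: "x \<in> {0..L}" for x
  proof -
    have "?g 0 = ?g x - (\<integral>y. wderiv L ?g y \<partial>lebesgue_on {0..x})"
      using has_weak_derivD(2)[OF has_weak_deriv_wderiv[OF g(2)] x] by (metis add_diff_cancel)
    then have "cmod (?g 0) \<le> cmod (?g x) + cmod (\<integral>y. wderiv L ?g y \<partial>lebesgue_on {0..x})"
      by (metis norm_triangle_ineq4)
    then show ?thesis using L2_initial_integral_le[OF _ wderiv_L2[OF g(2)] x] L by linarith
  qed
  have int: "integrable (lebesgue_on {0..L}) (\<lambda>x. cmod (?g x))" using L2_integrable[OF gL2] by simp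
  interpret finite_measure "lebesgue_on {0..L}" by (rule finite_measure_lebesgue_on_Icc)
  have "(\<integral>x. cmod (?g 0) \<partial>lebesgue_on {0..L}) \<le> (\<integral>x. cmod (?g x) + ?H \<partial>lebesgue_on {0..L})"
    using int le by (intro integral_mono) auto
  also have "\<dots> = (\<integral>x. cmod (?g x) \<partial>lebesgue_on {0..L}) + L * ?H"
    using int L by (simp add: measure_restrict_space)
  also have "(\<integral>x. cmod (?g x) \<partial>lebesgue_on {0..L}) \<le> sqrt L * hnorm L (0, ?g)"
    using L gL2 by (intro L2_integral_norm_le) auto
  also have "hnorm L (0, ?g) = hnorm L (0, wderiv L w)"
    using wderiv_AE[OF g(1)] gL2 wderiv_L2[OF H2_imp_H1[OF w]]
    by (intro hnorm_zero_pair_cong) auto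
  finally have "L * cmod (?g 0) \<le> sqrt L * hnorm L (0, wderiv L w) + L * ?H"
    using L by (simp add: measure_restrict_space zero_fun_def)
  then have "cmod (?g 0) \<le> (sqrt L * hnorm L (0, wderiv L w) + L * ?H) / L"
    using L by (simp add: field_simps)
  also have "\<dots> = sqrt L / L * hnorm L (0, wderiv L w) + ?H" using L by (simp add: add_divide_distrib)
  also have "sqrt L / L = 1 / sqrt L" using L by (simp add: field_simps)
  finally show ?thesis by (simp add: zero_fun_def)
qed

section \<open>The operator and its Riesz basis\<close>

lemma domAD:
  assumes "w \<in> domA L \<alpha>"
  shows "w \<in> hspace L" "fst w \<in> H2 L" "snd w \<in> H1 L" "snd w 0 = 0"
    "dx L (fst w) L + of_real \<alpha> * snd w L = 0"
  using assms by (auto simp: domA_def)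

lemma domA_add:
  assumes "0 < L" "w \<in> domA L \<alpha>" "z \<in> domA L \<alpha>" shows "w + z \<in> domA L \<alpha>"
proof -
  note w = domAD[OF assms(2)] and z = domAD[OF assms(3)]
  have "dx L (\<lambda>x. fst w x + fst z x) L = dx L (fst w) L + dx L (fst z) L"
    using assms(1) w z by (intro dx_add) auto
  moreover have "dx L (fst w) L + dx L (fst z) L + of_real \<alpha> * (snd w L + snd z L) = 0"
    using w(5) z(5) by (metis (no_types, opaque_lifting) add.assoc add.left_commute add_0 distrib_left)
  ultimately show ?thesis
    using w z H2_add[OF assms(1) w(2) z(2)] H1_add[OF w(3) z(3)] hspace_add[OF w(1) z(1)]
    by (simp add: domA_def plus_fun_def)
qed

lemma domA_scale:
  assumes "0 < L" "w \<in> domA L \<alpha>" shows "hscale c w \<in> domA L \<alpha>"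
proof -
  note w = domAD[OF assms(2)]
  have "dx L (\<lambda>x. c * fst w x) L = c * dx L (fst w) L"
    using assms(1) w by (intro dx_scale) auto
  moreover have "c * dx L (fst w) L + of_real \<alpha> * (c * snd w L) = c * (dx L (fst w) L + of_real \<alpha> * snd w L)"
    by (simp add: algebra_simps)
  ultimately show ?thesis
    using w H2_scale[OF assms(1) w(2)] H1_scale[OF w(3)] hspace_scale[OF w(1)]
    by (simp add: domA_def)
qed

text \<open>Membership and derivative go through one induction, because adding the next term under
  \<open>dx\<close> relies on both summands being \<open>H2\<close> functions.\<close>

lemma domA_diff_sum_dx:
  assumes L: "0 < L" and w: "w \<in> domA L \<alpha>" and z: "\<And>k. k \<in> I \<Longrightarrow> z k \<in> domA L \<alpha>"
    and x: "x \<in> {0..L}" and I: "finite I"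
  shows "w - (\<Sum>k\<in>I. hscale (c k) (z k)) \<in> domA L \<alpha> \<and>
    dx L (fst (w - (\<Sum>k\<in>I. hscale (c k) (z k)))) x = dx L (fst w) x - (\<Sum>k\<in>I. c k * dx L (fst (z k)) x)"
  using I z
proof (induction I rule: finite_induct)
  case empty
  then show ?case using w by simp
next
  case (insert i I)
  define u where "u = w - (\<Sum>k\<in>I. hscale (c k) (z k))"
  have u: "u \<in> domA L \<alpha>" "dx L (fst u) x = dx L (fst w) x - (\<Sum>k\<in>I. c k * dx L (fst (z k)) x)"
    using insert.IH insert.prems unfolding u_def by blast+
  have zi: "hscale (- c i) (z i) \<in> domA L \<alpha>" using insert L by (auto intro: domA_scale)
  have eq: "w - (\<Sum>k\<in>insert i I. hscale (c k) (z k)) = u + hscale (- c i) (z i)"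
    using insert(1,2) by (auto simp: u_def prod_eq_iff fun_eq_iff algebra_simps)
  have "dx L (fst (u + hscale (- c i) (z i))) x = dx L (fst u) x + dx L (fst (hscale (- c i) (z i))) x"
    using dx_add[OF L domAD(2)[OF u(1)] domAD(2)[OF zi] x] by (simp add: plus_fun_def)
  also have "dx L (fst (hscale (- c i) (z i))) x = - c i * dx L (fst (z i)) x"
    using dx_scale[OF L domAD(2) x, of "z i" \<alpha> "- c i"] insert by simp
  finally show ?case
    unfolding eq using insert(1,2) u domA_add[OF L u(1) zi] by simp
qed

section \<open>Sums over unordered index sets\<close>

lemma sum_le_bound_tail:
  fixes s :: "'i \<Rightarrow> real"
  assumes nonneg: "\<And>k. 0 \<le> s k" and bd: "\<And>I. finite I \<Longrightarrow> sum s I \<le> B" and \<epsilon>: "\<epsilon> > 0"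
  shows "\<exists>F. finite F \<and> (\<forall>I. finite I \<and> I \<inter> F = {} \<longrightarrow> sum s I \<le> \<epsilon>)"
proof -
  define X where "X = sum s ` {I. finite I}"
  have X: "X \<noteq> {}" "bdd_above X" using bd by (auto simp: X_def intro!: bdd_aboveI)
  \<comment> \<open>A finite set whose sum comes within \<epsilon> of the supremum of all finite
    sums; a disjoint finite set then cannot contribute more than \<epsilon>.\<close>
  obtain y where "y \<in> X" "Sup X - \<epsilon> < y"
    using less_cSup_iff[OF X, of "Sup X - \<epsilon>"] \<epsilon> by auto
  then obtain F where F: "finite F" "Sup X - \<epsilon> < sum s F" by (auto simp: X_def)
  show ?thesis
  proof (intro exI[of _ F] conjI allI impI)
    fix I assume I: "finite I \<and> I \<inter> F = {}"
    have "sum s (I \<union> F) \<in> X" using I F by (auto simp: X_def)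
    then have "sum s (I \<union> F) \<le> Sup X" using X by (intro cSup_upper)
    then show "sum s I \<le> \<epsilon>" using I F by (simp add: sum.union_disjoint)
  qed (rule F)
qed

text \<open>Comparison with the series over the naturals through \<open>nat \<bar>k\<bar>\<close>,
  which is injective on each half of the integers. The index 0 contributes \<open>1 / 0 = 0\<close>
  on both sides.\<close>

lemma sum_inverse_square_int_bounded:
  "\<exists>D\<ge>0. \<forall>I. finite I \<longrightarrow> (\<Sum>k\<in>I. 1 / (real_of_int k)\<^sup>2) \<le> D"
proof -
  define g :: "nat \<Rightarrow> real" where "g = (\<lambda>n. 1 / (real n)\<^sup>2)"
  have sg: "summable g"
    using inverse_power_summable[of 2, where 'a=real] by (simp add: g_def inverse_eq_divide power_divide)
  have g0: "g n \<ge> 0" for n by (simp add: g_def)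
  show ?thesis
  proof (intro exI[of _ "2 * suminf g"] conjI allI impI)
    show "0 \<le> 2 * suminf g" using sg g0 by (simp add: suminf_nonneg)
    fix I :: "int set" assume I: "finite I"
    have *: "(\<Sum>k\<in>J. 1 / (real_of_int k)\<^sup>2) \<le> suminf g" if J: "J \<subseteq> I" "inj_on (\<lambda>k. nat \<bar>k\<bar>) J" for J
    proof -
      have fin: "finite J" using I J finite_subset by auto
      have "(\<Sum>k\<in>J. 1 / (real_of_int k)\<^sup>2) = (\<Sum>k\<in>J. g (nat \<bar>k\<bar>))"
        by (intro sum.cong) (auto simp: g_def)
      also have "\<dots> = sum g ((\<lambda>k. nat \<bar>k\<bar>) ` J)" using J by (simp add: sum.reindex)
      also have "\<dots> \<le> suminf g" using fin sg g0 by (intro sum_le_suminf) auto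
      finally show ?thesis .
    qed
    have "(\<Sum>k\<in>I. 1 / (real_of_int k)\<^sup>2) = (\<Sum>k\<in>{k\<in>I. k \<ge> 0} \<union> {k\<in>I. k < 0}. 1 / (real_of_int k)\<^sup>2)"
      by (intro sum.cong) auto
    also have "\<dots> = (\<Sum>k\<in>{k\<in>I. k \<ge> 0}. 1 / (real_of_int k)\<^sup>2) + (\<Sum>k\<in>{k\<in>I. k < 0}. 1 / (real_of_int k)\<^sup>2)"
      using I by (intro sum.union_disjoint) auto
    also have "\<dots> \<le> suminf g + suminf g"
      by (intro add_mono *) (auto simp: inj_on_def)
    finally show "(\<Sum>k\<in>I. 1 / (real_of_int k)\<^sup>2) \<le> 2 * suminf g" by simp
  qed
qed

text \<open>The finitely many exceptional indices are collected in \<open>X\<close> and cost an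
  additive constant.\<close>

lemma sum_square_bounded_of_bigo:
  fixes c :: "int \<Rightarrow> complex"
  assumes "\<forall>\<^sub>F k in cofinite. cmod (c k) \<le> E / \<bar>real_of_int k\<bar>"
  shows "\<exists>D\<ge>0. \<forall>I. finite I \<longrightarrow> (\<Sum>k\<in>I. (cmod (c k))\<^sup>2) \<le> D"
proof -
  define X where "X = {k. \<not> cmod (c k) \<le> E / \<bar>real_of_int k\<bar>}"
  have X: "finite X" using assms by (simp add: eventually_cofinite X_def)
  obtain D where D: "D \<ge> 0" "\<And>I. finite I \<Longrightarrow> (\<Sum>k\<in>I. 1 / (real_of_int k)\<^sup>2) \<le> D"
    using sum_inverse_square_int_bounded by blast
  show ?thesis
  proof (intro exI[of _ "(\<Sum>k\<in>X. (cmod (c k))\<^sup>2) + E\<^sup>2 * D"] conjI allI impI)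
    show "0 \<le> (\<Sum>k\<in>X. (cmod (c k))\<^sup>2) + E\<^sup>2 * D" using D(1) by (intro add_nonneg_nonneg sum_nonneg) auto
    fix I :: "int set" assume I: "finite I"
    have "(\<Sum>k\<in>I. (cmod (c k))\<^sup>2) = (\<Sum>k\<in>I \<inter> X. (cmod (c k))\<^sup>2) + (\<Sum>k\<in>I - X. (cmod (c k))\<^sup>2)"
      using I by (rule sum.Int_Diff)
    also have "(\<Sum>k\<in>I \<inter> X. (cmod (c k))\<^sup>2) \<le> (\<Sum>k\<in>X. (cmod (c k))\<^sup>2)"
      using X by (intro sum_mono2) auto
    also have "(\<Sum>k\<in>I - X. (cmod (c k))\<^sup>2) \<le> (\<Sum>k\<in>I - X. E\<^sup>2 * (1 / (real_of_int k)\<^sup>2))"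
    proof (rule sum_mono)
      fix k assume "k \<in> I - X"
      then have "(cmod (c k))\<^sup>2 \<le> (E / \<bar>real_of_int k\<bar>)\<^sup>2" by (intro power_mono) (auto simp: X_def)
      then show "(cmod (c k))\<^sup>2 \<le> E\<^sup>2 * (1 / (real_of_int k)\<^sup>2)" by (simp add: power_divide)
    qed
    also have "\<dots> \<le> E\<^sup>2 * D"
      unfolding sum_distrib_left[symmetric] using I by (intro mult_left_mono D) auto
    finally show "(\<Sum>k\<in>I. (cmod (c k))\<^sup>2) \<le> (\<Sum>k\<in>X. (cmod (c k))\<^sup>2) + E\<^sup>2 * D" by simp
  qed
qed

lemma sum_mult_le_of_square_sums:
  fixes a b :: "'i \<Rightarrow> complex"
  assumes "(\<Sum>k\<in>I. (cmod (a k))\<^sup>2) \<le> A\<^sup>2" "(\<Sum>k\<in>I. (cmod (b k))\<^sup>2) \<le> B\<^sup>2" "A \<ge> 0" "B \<ge> 0"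
  shows "(\<Sum>k\<in>I. cmod (a k * b k)) \<le> A * B"
proof -
  have "(\<Sum>k\<in>I. cmod (a k * b k)) \<le> L2_set (\<lambda>k. cmod (a k)) I * L2_set (\<lambda>k. cmod (b k)) I"
    using L2_set_mult_ineq[of "\<lambda>k. cmod (a k)" "\<lambda>k. cmod (b k)" I] by (simp add: norm_mult)
  also have "\<dots> \<le> A * B"
    using assms by (intro mult_mono) (auto simp: L2_set_def sum_nonneg intro!: real_le_lsqrt)
  finally show ?thesis .
qed

section \<open>The operator on its domain\<close>

locale wave_operator =
  fixes L \<alpha> :: real and f ye :: "real \<Rightarrow> real"
  assumes L: "0 < L"
    and continuous_coeff: "continuous_on {0..L} (\<lambda>x. deriv f (ye x))"
begin

lemma L_nonneg: "0 \<le> L" using L by simp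

lemma coeff_bounded: "\<exists>Q\<ge>0. \<forall>x\<in>{0..L}. \<bar>deriv f (ye x)\<bar> \<le> Q"
proof -
  have "compact ((\<lambda>x. deriv f (ye x)) ` {0..L})"
    by (intro compact_continuous_image continuous_coeff) auto
  then obtain Q where "\<forall>y\<in>(\<lambda>x. deriv f (ye x)) ` {0..L}. norm y \<le> Q"
    using compact_imp_bounded bounded_iff by blast
  then show ?thesis by (intro exI[of _ "\<bar>Q\<bar>"]) force
qed

lemma L2_coeff_mult: "g \<in> L2 L \<Longrightarrow> (\<lambda>x. of_real (deriv f (ye x)) * g x) \<in> L2 L"
  by (intro L2_mult_continuous continuous_on_of_real continuous_coeff)

lemma opA_hspace: "w \<in> domA L \<alpha> \<Longrightarrow> opA L f ye w \<in> hspace L"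
proof -
  assume w: "w \<in> domA L \<alpha>"
  note d = domAD[OF w]
  have "wderiv L (dx L (fst w)) \<in> L2 L" using H2_dx(2)[OF L d(2)] by (rule wderiv_L2)
  moreover have "fst w \<in> L2 L"
    using H1_continuous[OF hspaceD(1)[OF d(1)] L_nonneg] by (rule L2_continuous)
  ultimately show ?thesis
    using d by (auto simp: hspace_def opA_def intro!: L2_add L2_coeff_mult)
qed

lemma fst_L2: "w \<in> hspace L \<Longrightarrow> fst w \<in> L2 L"
  using H1_continuous[OF hspaceD(1) L_nonneg] L2_continuous by blast

lemma hnorm_fst_le: "w \<in> hspace L \<Longrightarrow> hnorm L (0, fst w) \<le> L * hnorm L w"
proof -
  assume w: "w \<in> hspace L"
  have "hnorm L (0, fst w) \<le> sqrt L * (sqrt L * hnorm L w)"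
    using L hspace_sup_le[OF L_nonneg w]
    by (intro hnorm_zero_pair_le_bound fst_L2 w AE_I2) auto
  then show ?thesis using L by (simp add: mult.assoc[symmetric])
qed

text \<open>\<open>heq\<close> compares second components almost everywhere, but \<open>opA\<close>
  moves the second component into first place, where equality is pointwise. Continuity of
  \<open>H1\<close> functions bridges the gap. Needed because initial data are prescribed up to
  \<open>heq\<close> while the final bound contains A W(0).\<close>

lemma heq_opA:
  assumes w: "w \<in> domA L \<alpha>" and z: "z \<in> domA L \<alpha>" and eq: "heq L w z"
  shows "heq L (opA L f ye w) (opA L f ye z)"
proof -
  note dw = domAD[OF w] and dz = domAD[OF z]
  have fst_eq: "fst w x = fst z x" if "x \<in> {0..L}" for x using eq that by (auto simp: heq_def)
  have snd_eq: "snd w x = snd z x" if "x \<in> {0..L}" for x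
    using H1_continuous[OF dw(3) L_nonneg] H1_continuous[OF dz(3) L_nonneg] eq L that
    by (intro continuous_AE_eq_imp_eq[of L]) (auto simp: heq_def)
  have "has_weak_deriv L (fst w) (dx L (fst z))"
    using has_weak_deriv_cong[of L "fst w" "fst z"] L_nonneg fst_eq H2_dx(1)[OF L dz(2)] by blast
  then have "dx L (fst w) x = dx L (fst z) x" if "x \<in> {0..L}" for x
    using dx_unique[OF L _ dx_continuous[OF L dz(2)] that] by blast
  then have "wderiv L (dx L (fst w)) = wderiv L (dx L (fst z))"
    by (intro wderiv_cong L_nonneg)
  then show ?thesis using fst_eq snd_eq by (auto simp: heq_def opA_def)
qed

text \<open>The second derivative of w^1 is the second component of A w minus the potential term,
  which is bounded by the norm of w; \<open>dx_zero_le\<close> then gives the trace.\<close>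

lemma trace_bounded: "\<exists>C\<ge>0. \<forall>w\<in>domA L \<alpha>. cmod (dx L (fst w) 0) \<le> C * (hnorm L (opA L f ye w) + hnorm L w)"
proof -
  obtain Q where Q: "Q \<ge> 0" "\<And>x. x \<in> {0..L} \<Longrightarrow> \<bar>deriv f (ye x)\<bar> \<le> Q" using coeff_bounded by blast
  define C where "C = 1 / sqrt L + sqrt L * (1 + Q * L)"
  show ?thesis
  proof (intro exI[of _ C] conjI ballI)
    show "C \<ge> 0" using L Q(1) by (auto simp: C_def)
    fix w assume w: "w \<in> domA L \<alpha>"
    note d = domAD[OF w]
    note dw = wderiv_L2[OF H2_dx(2)[OF L d(2)]]
    let ?q = "\<lambda>x. complex_of_real (deriv f (ye x)) * fst w x"
    have q: "?q \<in> L2 L" by (intro L2_coeff_mult fst_L2 d)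
    have nq: "hnorm L (0, ?q) \<le> Q * (L * hnorm L w)"
    proof -
      have "hnorm L (0, ?q) \<le> Q * hnorm L (0, fst w)"
        using Q by (intro hnorm_zero_pair_mono q fst_L2 d AE_I2) (auto simp: norm_mult intro!: mult_right_mono)
      also have "\<dots> \<le> Q * (L * hnorm L w)" using Q by (intro mult_left_mono hnorm_fst_le d)
      finally show ?thesis .
    qed
    have s: "snd (opA L f ye w) \<in> L2 L" using hspaceD(2)[OF opA_hspace[OF w]] .
    have eq: "(0 :: real \<Rightarrow> complex, wderiv L (dx L (fst w))) = (0, snd (opA L f ye w)) - (0, ?q)"
      by (simp add: prod_eq_iff fun_eq_iff opA_def)
    have "hnorm L (0, wderiv L (dx L (fst w))) \<le> hnorm L (0, snd (opA L f ye w)) + hnorm L (0, ?q)"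
      unfolding eq by (intro hnorm_diff_triangle zero_pair_hspace s q)
    also have "\<dots> \<le> hnorm L (opA L f ye w) + Q * (L * hnorm L w)"
      using hnorm_components_le(2)[OF opA_hspace[OF w]] nq by (intro add_mono)
    finally have dd: "hnorm L (0, wderiv L (dx L (fst w))) \<le> hnorm L (opA L f ye w) + Q * L * hnorm L w"
      by (simp add: mult.assoc)
    have "cmod (dx L (fst w) 0) \<le> hnorm L (0, wderiv L (fst w)) / sqrt L + sqrt L * hnorm L (0, wderiv L (dx L (fst w)))"
      by (rule dx_zero_le[OF L d(2)])
    also have "\<dots> \<le> hnorm L w / sqrt L + sqrt L * (hnorm L (opA L f ye w) + Q * L * hnorm L w)"
      using L hnorm_components_le(1)[OF d(1)] dd by (intro add_mono divide_right_mono mult_left_mono) auto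
    also have "\<dots> \<le> C * (hnorm L (opA L f ye w) + hnorm L w)"
    proof -
      have "0 \<le> 1 / sqrt L * hnorm L (opA L f ye w)" "0 \<le> sqrt L * (Q * L) * hnorm L (opA L f ye w)"
        "0 \<le> sqrt L * hnorm L w"
        using L Q(1) by auto
      then show ?thesis by (simp add: C_def algebra_simps)
    qed
    finally show "cmod (dx L (fst w) 0) \<le> C * (hnorm L (opA L f ye w) + hnorm L w)" .
  qed
qed

end

section \<open>Coefficients with respect to the Riesz basis\<close>

lemma riesz_basis_upper:
  assumes "riesz_basis L b"
  shows "\<exists>M>0. \<forall>I c. finite I \<longrightarrow>
    (hnorm L (\<Sum>k\<in>I. hscale (c k) (b k)))\<^sup>2 \<le> M * (\<Sum>k\<in>I. (cmod (c k))\<^sup>2)"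
  using assms unfolding riesz_basis_def by meson

text \<open>The spectral relations are imposed on the adjoint and \<open>fd\<close>, since the
  quantities followed in time are the coefficients against \<open>fd k\<close>.\<close>

locale wave_basis = wave_operator +
  fixes e fd :: "int \<Rightarrow> state" and lam :: "int \<Rightarrow> complex" and n0 :: nat
  assumes riesz: "riesz_basis L e" and dual: "dual_riesz_basis L e fd"
    and e_domA: "\<And>k. e k \<in> domA L \<alpha>"
    and adj_high: "\<And>k. \<bar>k\<bar> \<ge> int n0 + 1 \<Longrightarrow> adjA L \<alpha> f ye (fd k) (hscale (cnj (lam k)) (fd k))"
    and lam_stable: "\<And>k. \<bar>k\<bar> \<ge> int n0 + 1 \<Longrightarrow> Re (lam k) < - 1"
    and lam_asymp: "(\<lambda>k. lam k - (of_real (1 / (2 * L) * ln ((\<alpha> - 1) / (\<alpha> + 1)))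
                     + \<i> * of_real (of_int k * pi / L))) \<in> O[cofinite](\<lambda>k. of_real (1 / \<bar>of_int k\<bar>))"
    and trace_asymp: "(\<lambda>k. dx L (fst (e k)) 0) \<in> O[cofinite](\<lambda>_. 1)"
    and adj_low: "\<And>k. \<bar>k\<bar> \<le> int n0 \<Longrightarrow>
         \<exists>h. adjA L \<alpha> f ye (fd k) h \<and> in_hspan L fd {p. \<bar>p\<bar> \<le> int n0} h"
begin

abbreviation "low \<equiv> {k. \<bar>k\<bar> \<le> int n0}"
abbreviation "high \<equiv> {k. \<bar>k\<bar> \<ge> int n0 + 1}"
abbreviation "cf w k \<equiv> hinner L w (fd k)"

lemma finite_low: "finite low"
  by (rule finite_subset[of _ "{- int n0..int n0}"]) auto

lemma e_hspace: "e k \<in> hspace L" using riesz by (auto simp: riesz_basis_def)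
lemma fd_hspace: "fd k \<in> hspace L" using dual by (auto simp: dual_riesz_basis_def riesz_basis_def)
lemma biorthogonal: "hinner L (e k) (fd l) = (if k = l then 1 else 0)"
  using dual by (auto simp: dual_riesz_basis_def)

lemma cf_sum:
  assumes "finite I" shows "cf (\<Sum>k\<in>I. hscale (c k) (e k)) l = (if l \<in> I then c l else 0)"
proof -
  have "cf (\<Sum>k\<in>I. hscale (c k) (e k)) l = (\<Sum>k\<in>I. c k * hinner L (e k) (fd l))"
    by (subst hinner_sum_left) (auto intro: hspace_scale e_hspace fd_hspace simp: hinner_scale_left e_hspace fd_hspace)
  also have "\<dots> = (\<Sum>k\<in>I. if k = l then c k else 0)" by (intro sum.cong) (auto simp: biorthogonal)
  finally show ?thesis using assms by (simp add: sum.delta)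
qed

text \<open>Duality: testing \<open>w\<close> against the combination of the \<open>fd k\<close>
  with coefficients \<open>cf w k\<close> yields exactly the square sum \<open>s\<close>, while the
  upper Riesz bound of \<open>fd\<close> makes the squared norm of that combination at most
  \<open>M * s\<close>. One factor \<open>s\<close> cancels.\<close>

lemma bessel: "\<exists>M>0. \<forall>w\<in>hspace L. \<forall>I. finite I \<longrightarrow> (\<Sum>k\<in>I. (cmod (cf w k))\<^sup>2) \<le> (M * hnorm L w)\<^sup>2"
proof -
  obtain M where M: "M > 0" "\<And>I c. finite I \<Longrightarrow>
      (hnorm L (\<Sum>k\<in>I. hscale (c k) (fd k)))\<^sup>2 \<le> M * (\<Sum>k\<in>I. (cmod (c k))\<^sup>2)"
    using riesz_basis_upper[of L fd] dual unfolding dual_riesz_basis_def by metis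
  show ?thesis
  proof (intro exI[of _ "sqrt M"] conjI ballI allI impI)
    show "sqrt M > 0" using M by simp
    fix w I assume w: "w \<in> hspace L" and I: "finite (I :: int set)"
    define s where "s = (\<Sum>k\<in>I. (cmod (cf w k))\<^sup>2)"
    have s0: "0 \<le> s" by (auto simp: s_def intro: sum_nonneg)
    let ?z = "\<Sum>k\<in>I. hscale (cf w k) (fd k)"
    have z: "?z \<in> hspace L" by (intro hspace_sum hspace_scale fd_hspace)
    have "hinner L w ?z = (\<Sum>k\<in>I. cnj (cf w k) * cf w k)"
      using w by (subst hinner_sum_right) (auto intro: hspace_scale fd_hspace simp: hinner_scale_right fd_hspace)
    also have "\<dots> = of_real s"
      by (simp add: s_def complex_norm_square mult.commute del: of_real_power)
    finally have "s \<le> hnorm L w * hnorm L ?z"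
      using hinner_Cauchy_Schwarz[OF w z] s0 by simp
    then have "s\<^sup>2 \<le> (hnorm L w)\<^sup>2 * (hnorm L ?z)\<^sup>2"
      using s0 by (metis power_mono power_mult_distrib)
    also have "\<dots> \<le> (hnorm L w)\<^sup>2 * (M * s)"
      unfolding s_def using M(2)[OF I] by (intro mult_left_mono) auto
    finally have "s * s \<le> ((hnorm L w)\<^sup>2 * M) * s" by (simp add: power2_eq_square)
    then have "s \<le> (hnorm L w)\<^sup>2 * M"
      using s0 M(1) by (cases "s = 0") (auto simp: mult_le_cancel_right)
    then show "(\<Sum>k\<in>I. (cmod (cf w k))\<^sup>2) \<le> (sqrt M * hnorm L w)\<^sup>2"
      using M(1) by (simp add: s_def power_mult_distrib mult.commute)
  qed
qed

text \<open>Phrased through finite partial sums because the energy estimate controls nothing else. A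
  finite combination \<open>p\<close> close to \<open>w\<close> has the coefficients of
  \<open>w\<close> up to those of \<open>w - p\<close>, which are small by \<open>bessel\<close>;
  the upper Riesz bound then applies to \<open>p\<close>.\<close>

lemma hnorm_le_coefficients:
  "\<exists>C>0. \<forall>w\<in>hspace L. \<forall>B\<ge>0. (\<forall>I. finite I \<longrightarrow> (\<Sum>k\<in>I. (cmod (cf w k))\<^sup>2) \<le> B\<^sup>2) \<longrightarrow> hnorm L w \<le> C * B"
proof -
  obtain M where M: "M > 0" "\<And>I c. finite I \<Longrightarrow>
      (hnorm L (\<Sum>k\<in>I. hscale (c k) (e k)))\<^sup>2 \<le> M * (\<Sum>k\<in>I. (cmod (c k))\<^sup>2)"
    using riesz_basis_upper[OF riesz] by metis
  have dense: "\<exists>I c. finite I \<and> hnorm L (w - (\<Sum>k\<in>I. hscale (c k) (e k))) < \<epsilon>"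
    if "w \<in> hspace L" "\<epsilon> > 0" for w \<epsilon>
    using riesz that unfolding riesz_basis_def by blast
  obtain N where N: "N > 0" "\<And>w I. w \<in> hspace L \<Longrightarrow> finite I \<Longrightarrow> (\<Sum>k\<in>I. (cmod (cf w k))\<^sup>2) \<le> (N * hnorm L w)\<^sup>2"
    using bessel by blast
  show ?thesis
  proof (intro exI[of _ "sqrt M"] conjI ballI allI impI)
    show "sqrt M > 0" using M by simp
    fix w B assume w: "w \<in> hspace L" and B: "(0::real) \<le> B" "\<forall>I. finite I \<longrightarrow> (\<Sum>k\<in>I. (cmod (cf w k))\<^sup>2) \<le> B\<^sup>2"
    show "hnorm L w \<le> sqrt M * B"
    proof (rule field_le_epsilon)
      fix \<epsilon> :: real assume \<epsilon>: "\<epsilon> > 0"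
      \<comment> \<open>The distance to \<open>p\<close> enters twice: directly, and through the
        perturbed coefficients with factor \<open>sqrt M * N\<close>.\<close>
      define \<epsilon>' where "\<epsilon>' = \<epsilon> / (1 + sqrt M * N)"
      have pos: "1 + sqrt M * N > 0" using M N by (simp add: add_pos_pos)
      then have \<epsilon>': "\<epsilon>' > 0" using \<epsilon> by (simp add: \<epsilon>'_def)
      obtain I c where I: "finite I" "hnorm L (w - (\<Sum>k\<in>I. hscale (c k) (e k))) < \<epsilon>'"
        using dense[OF w \<epsilon>'] by blast
      define p where "p = (\<Sum>k\<in>I. hscale (c k) (e k))"
      have p: "p \<in> hspace L" unfolding p_def by (intro hspace_sum hspace_scale e_hspace)
      have wp: "w - p \<in> hspace L" using w p by (rule hspace_diff)
      have ck: "c k = cf w k - cf (w - p) k" if "k \<in> I" for k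
        using cf_sum[OF I(1), of c k] that by (simp add: hinner_diff_left w p fd_hspace p_def[symmetric])
      have "L2_set (\<lambda>k. cmod (c k)) I \<le> L2_set (\<lambda>k. cmod (cf w k) + cmod (cf (w - p) k)) I"
        by (intro L2_set_mono) (auto simp: ck norm_triangle_ineq4)
      also have "\<dots> \<le> L2_set (\<lambda>k. cmod (cf w k)) I + L2_set (\<lambda>k. cmod (cf (w - p) k)) I"
        by (rule L2_set_triangle_ineq)
      also have "\<dots> \<le> B + N * hnorm L (w - p)"
      proof (rule add_mono)
        show "L2_set (\<lambda>k. cmod (cf w k)) I \<le> B"
          unfolding L2_set_def using B I(1) by (intro real_le_lsqrt) (auto intro: sum_nonneg)
        show "L2_set (\<lambda>k. cmod (cf (w - p) k)) I \<le> N * hnorm L (w - p)"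
          unfolding L2_set_def by (rule real_le_lsqrt)
            (use N(1) N(2)[OF wp I(1)] in \<open>simp_all add: sum_nonneg\<close>)
      qed
      also have "\<dots> \<le> B + N * \<epsilon>'" using I(2) N(1) by (simp add: p_def)
      finally have le: "L2_set (\<lambda>k. cmod (c k)) I \<le> B + N * \<epsilon>'" .
      have "hnorm L p \<le> sqrt (M * (\<Sum>k\<in>I. (cmod (c k))\<^sup>2))"
        using M(2)[OF I(1), of c] by (intro real_le_rsqrt) (simp add: p_def)
      also have "\<dots> = sqrt M * L2_set (\<lambda>k. cmod (c k)) I" by (simp add: L2_set_def real_sqrt_mult)
      also have "\<dots> \<le> sqrt M * (B + N * \<epsilon>')" using M(1) le by (intro mult_left_mono) auto
      finally have np: "hnorm L p \<le> sqrt M * (B + N * \<epsilon>')" .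
      have "w = (w - p) + p" by simp
      then have "hnorm L w \<le> hnorm L (w - p) + hnorm L p" using hnorm_triangle[OF wp p] by metis
      also have "\<dots> \<le> \<epsilon>' + sqrt M * (B + N * \<epsilon>')" using I(2) np by (simp add: p_def)
      also have "\<dots> = sqrt M * B + \<epsilon>' * (1 + sqrt M * N)" by (simp add: algebra_simps)
      also have "\<epsilon>' * (1 + sqrt M * N) = \<epsilon>" using pos by (simp add: \<epsilon>'_def)
      finally show "hnorm L w \<le> sqrt M * B + \<epsilon>" .
    qed
  qed
qed

lemma lam_nonzero: "k \<in> high \<Longrightarrow> lam k \<noteq> 0"
  using lam_stable[of k] by auto

lemma cf_opA_high:
  assumes "k \<in> high" "w \<in> domA L \<alpha>" shows "cf (opA L f ye w) k = lam k * cf w k"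
proof -
  have "cf (opA L f ye w) k = hinner L w (hscale (cnj (lam k)) (fd k))"
    using adj_high[of k] assms by (auto simp: adjA_def)
  then show ?thesis using hinner_scale_right[OF domAD(1)[OF assms(2)] fd_hspace, of "cnj (lam k)" k] by simp
qed

lemma cf_opA_low:
  assumes "k \<in> low"
  shows "\<exists>c. \<forall>w\<in>domA L \<alpha>. cf (opA L f ye w) k = (\<Sum>p\<in>low. c p * cf w p)"
proof -
  obtain h c where h: "adjA L \<alpha> f ye (fd k) h" "heq L h (\<Sum>p\<in>low. hscale (c p) (fd p))"
    using adj_low[of k] assms by (auto simp: in_hspan_def)
  have hh: "h \<in> hspace L" using h(1) by (simp add: adjA_def)
  show ?thesis
  proof (intro exI[of _ "\<lambda>p. cnj (c p)"] ballI)
    fix w assume w: "w \<in> domA L \<alpha>"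
    have wh: "w \<in> hspace L" using w by (rule domAD)
    have "cf (opA L f ye w) k = hinner L w h" using h(1) w by (simp add: adjA_def)
    also have "\<dots> = hinner L w (\<Sum>p\<in>low. hscale (c p) (fd p))"
      by (intro hinner_cong_right L_nonneg hh h(2) wh hspace_sum hspace_scale fd_hspace)
    also have "\<dots> = (\<Sum>p\<in>low. cnj (c p) * cf w p)"
      using wh by (subst hinner_sum_right) (auto intro: hspace_scale fd_hspace simp: hinner_scale_right fd_hspace)
    finally show "cf (opA L f ye w) k = (\<Sum>p\<in>low. cnj (c p) * cf w p)" .
  qed
qed

lemma cf_bounded: "\<exists>M>0. \<forall>w\<in>hspace L. \<forall>k. cmod (cf w k) \<le> M * hnorm L w"
proof -
  obtain M where M: "M > 0" "\<And>w I. w \<in> hspace L \<Longrightarrow> finite I \<Longrightarrow> (\<Sum>k\<in>I. (cmod (cf w k))\<^sup>2) \<le> (M * hnorm L w)\<^sup>2"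
    using bessel by blast
  show ?thesis
  proof (intro exI[of _ M] conjI ballI allI M)
    fix w k assume "w \<in> hspace L"
    from M(2)[OF this, of "{k}"] have "(cmod (cf w k))\<^sup>2 \<le> (M * hnorm L w)\<^sup>2" by simp
    then show "cmod (cf w k) \<le> M * hnorm L w"
      by (rule power2_le_imp_le) (use M(1) in simp)
  qed
qed

text \<open>No norm of A w is needed on the right, since every low coefficient of A w is a fixed
  finite combination of the low coefficients of w.\<close>

lemma cf_opA_low_bounded:
  "\<exists>C>0. \<forall>w\<in>domA L \<alpha>. \<forall>k\<in>low. cmod (cf (opA L f ye w) k) \<le> C * hnorm L w"
proof -
  obtain M where M: "M > 0" "\<And>w k. w \<in> hspace L \<Longrightarrow> cmod (cf w k) \<le> M * hnorm L w"
    using cf_bounded by blast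
  have "\<forall>k\<in>low. \<exists>c. \<forall>w\<in>domA L \<alpha>. cf (opA L f ye w) k = (\<Sum>p\<in>low. c p * cf w p)"
    using cf_opA_low by blast
  then obtain c where c: "\<And>k w. k \<in> low \<Longrightarrow> w \<in> domA L \<alpha> \<Longrightarrow> cf (opA L f ye w) k = (\<Sum>p\<in>low. c k p * cf w p)"
    by metis
  define C where "C = (\<Sum>k\<in>low. \<Sum>p\<in>low. cmod (c k p)) * M"
  have S0: "0 \<le> (\<Sum>k\<in>low. \<Sum>p\<in>low. cmod (c k p))" by (intro sum_nonneg) auto
  show ?thesis
  proof (intro exI[of _ "C + 1"] conjI ballI)
    show "C + 1 > 0" using S0 M(1) by (simp add: C_def add_nonneg_pos)
    fix w k assume w: "w \<in> domA L \<alpha>" and k: "k \<in> low"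
    have "cmod (cf (opA L f ye w) k) \<le> (\<Sum>p\<in>low. cmod (c k p) * (M * hnorm L w))"
      unfolding c[OF k w]
      by (rule sum_norm_le) (auto simp: norm_mult intro!: mult_left_mono M(2) domAD(1)[OF w])
    also have "\<dots> = (\<Sum>p\<in>low. cmod (c k p)) * (M * hnorm L w)" by (simp add: sum_distrib_right)
    also have "\<dots> \<le> (\<Sum>k\<in>low. \<Sum>p\<in>low. cmod (c k p)) * (M * hnorm L w)"
      using M(1) by (intro mult_right_mono member_le_sum[OF k _ finite_low, of "\<lambda>k. \<Sum>p\<in>low. cmod (c k p)"])
        (auto intro: sum_nonneg)
    also have "\<dots> \<le> (C + 1) * hnorm L w" by (simp add: C_def algebra_simps)
    finally show "cmod (cf (opA L f ye w) k) \<le> (C + 1) * hnorm L w" .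
  qed
qed

text \<open>The traces stay bounded while the imaginary part of \<open>lam k\<close> grows like k pi
  / L, so the quotients decay like 1 / |k|.\<close>

lemma trace_over_lam_square_summable:
  "\<exists>D\<ge>0. \<forall>I. finite I \<longrightarrow> (\<Sum>k\<in>I. (cmod (dx L (fst (e k)) 0 / lam k))\<^sup>2) \<le> D"
proof -
  obtain c where c: "\<forall>\<^sub>F k in cofinite. cmod (lam k - (of_real (1 / (2 * L) * ln ((\<alpha> - 1) / (\<alpha> + 1)))
                     + \<i> * of_real (of_int k * pi / L))) \<le> c * cmod (of_real (1 / \<bar>of_int k\<bar>))" "c > 0"
    using lam_asymp by (auto elim!: landau_o.bigE)
  obtain d where d: "\<forall>\<^sub>F k in cofinite. cmod (dx L (fst (e k)) 0) \<le> d * cmod 1" "d > 0"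
    using trace_asymp by (auto elim!: landau_o.bigE)
  \<comment> \<open>Beyond this threshold the error in the asymptotics of \<open>lam k\<close> is at
    most \<open>c\<close>, and \<open>c\<close> is at most half of |k| pi / L, so at least half of
    the growth survives.\<close>
  have large: "\<forall>\<^sub>F k :: int in cofinite. \<bar>real_of_int k\<bar> \<ge> 1 + 2 * L * c / pi"
  proof -
    have "{k :: int. \<not> \<bar>real_of_int k\<bar> \<ge> 1 + 2 * L * c / pi} \<subseteq> {- \<lceil>1 + 2 * L * c / pi\<rceil>..\<lceil>1 + 2 * L * c / pi\<rceil>}"
    proof
      fix k :: int assume "k \<in> {k. \<not> \<bar>real_of_int k\<bar> \<ge> 1 + 2 * L * c / pi}"
      then have "\<bar>real_of_int k\<bar> < 1 + 2 * L * c / pi" by simp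
      then have "real_of_int \<bar>k\<bar> \<le> real_of_int \<lceil>1 + 2 * L * c / pi\<rceil>" by linarith
      then show "k \<in> {- \<lceil>1 + 2 * L * c / pi\<rceil>..\<lceil>1 + 2 * L * c / pi\<rceil>}" by (simp only: of_int_le_iff) auto
    qed
    then show ?thesis unfolding eventually_cofinite using finite_subset by blast
  qed
  have "\<forall>\<^sub>F k in cofinite. cmod (dx L (fst (e k)) 0 / lam k) \<le> (2 * L * d / pi) / \<bar>real_of_int k\<bar>"
    using c(1) d(1) large
  proof eventually_elim
    case (elim k)
    define K where "K = \<bar>real_of_int k\<bar>"
    have K: "K \<ge> 1" "K \<ge> 2 * L * c / pi"
      using elim(3) L c(2) by (auto simp: K_def intro: order_trans[rotated])
    have "\<bar>Im (lam k) - of_int k * pi / L\<bar> \<le> c * (1 / K)"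
      using order_trans[OF abs_Im_le_cmod elim(1)] by (simp add: K_def norm_divide)
    also have "\<dots> \<le> c" using K(1) c(2) by (simp add: field_simps)
    finally have "\<bar>of_int k * pi / L\<bar> - c \<le> \<bar>Im (lam k)\<bar>" by linarith
    then have "K * pi / L - c \<le> cmod (lam k)"
      using abs_Im_le_cmod[of "lam k"] L by (simp add: K_def abs_mult)
    moreover have "K * pi / (2 * L) \<ge> c" using K(2) L by (simp add: field_simps)
    ultimately have lo: "K * pi / (2 * L) \<le> cmod (lam k)" by (simp add: field_simps)
    have pos: "K * pi / (2 * L) > 0" using K(1) L by simp
    have "cmod (dx L (fst (e k)) 0 / lam k) = cmod (dx L (fst (e k)) 0) / cmod (lam k)" by (rule norm_divide)
    also have "\<dots> \<le> d / (K * pi / (2 * L))" using elim(2) lo pos d(2) by (intro frac_le) auto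
    also have "\<dots> = (2 * L * d / pi) / K" by (simp add: field_simps)
    finally show ?case by (simp add: K_def)
  qed
  then show ?thesis by (rule sum_square_bounded_of_bigo)
qed

end

section \<open>The tail functional and the boundary trace\<close>

context wave_basis
begin

abbreviation "tail \<equiv> tail_sum L e fd lam n0"
abbreviation "ct k \<equiv> dx L (fst (e k)) 0 / lam k"

text \<open>Cauchy-Schwarz between the square-summable weights \<open>ct k\<close> and the Bessel
  bound. It ensures that the series in \<open>tail_sum\<close> converges, as \<open>infsum\<close>
  takes the value 0 on a divergent one. \<open>D + 1\<close> keeps the constant positive.\<close>

lemma tail_term_sums_bounded:
  "\<exists>C>0. \<forall>w\<in>hspace L. \<forall>I. finite I \<longrightarrow> (\<Sum>k\<in>I. cmod (ct k * cf w k)) \<le> C * hnorm L w"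
proof -
  obtain D where D: "D \<ge> 0" "\<And>I. finite I \<Longrightarrow> (\<Sum>k\<in>I. (cmod (ct k))\<^sup>2) \<le> D"
    using trace_over_lam_square_summable by blast
  obtain M where M: "M > 0" "\<And>w I. w \<in> hspace L \<Longrightarrow> finite I \<Longrightarrow> (\<Sum>k\<in>I. (cmod (cf w k))\<^sup>2) \<le> (M * hnorm L w)\<^sup>2"
    using bessel by blast
  show ?thesis
  proof (intro exI[of _ "sqrt (D + 1) * M"] conjI ballI allI impI)
    show "sqrt (D + 1) * M > 0" using D M by simp
    fix w and I :: "int set" assume w: "w \<in> hspace L" and I: "finite I"
    have "(\<Sum>k\<in>I. (cmod (ct k))\<^sup>2) \<le> (sqrt (D + 1))\<^sup>2" using D(1) D(2)[OF I] by simp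
    from sum_mult_le_of_square_sums[OF this M(2)[OF w I]]
    show "(\<Sum>k\<in>I. cmod (ct k * cf w k)) \<le> sqrt (D + 1) * M * hnorm L w"
      using D(1) M(1) by (simp add: mult.assoc)
  qed
qed

lemma tail_abs_summable:
  assumes "w \<in> hspace L" shows "(\<lambda>k. cmod (ct k * cf w k)) summable_on J"
proof -
  obtain C where "\<And>I. finite I \<Longrightarrow> (\<Sum>k\<in>I. cmod (ct k * cf w k)) \<le> C * hnorm L w"
    using tail_term_sums_bounded assms by blast
  then show ?thesis
    by (intro nonneg_bdd_above_summable_on bdd_aboveI[of _ "C * hnorm L w"]) auto
qed

lemma tail_summable: "w \<in> hspace L \<Longrightarrow> (\<lambda>k. ct k * cf w k) summable_on J"
  by (rule abs_summable_summable[OF tail_abs_summable])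

lemma tail_bounded: "\<exists>C>0. \<forall>w\<in>hspace L. \<bar>tail w\<bar> \<le> C * hnorm L w"
proof -
  obtain C where C: "C > 0" "\<And>w I. w \<in> hspace L \<Longrightarrow> finite I \<Longrightarrow> (\<Sum>k\<in>I. cmod (ct k * cf w k)) \<le> C * hnorm L w"
    using tail_term_sums_bounded by blast
  show ?thesis
  proof (intro exI[of _ C] conjI ballI C(1))
    fix w assume w: "w \<in> hspace L"
    have "\<bar>tail w\<bar> \<le> cmod (\<Sum>\<^sub>\<infinity>k\<in>high. ct k * cf w k)"
      unfolding tail_sum_def by (rule abs_Re_le_cmod)
    also have "\<dots> \<le> (\<Sum>\<^sub>\<infinity>k\<in>high. cmod (ct k * cf w k))"
      by (intro norm_infsum_bound tail_abs_summable w)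
    also have "\<dots> \<le> C * hnorm L w"
      by (intro infsum_le_finite_sums tail_abs_summable w C(2))
    finally show "\<bar>tail w\<bar> \<le> C * hnorm L w" .
  qed
qed

lemma tail_add: "w \<in> hspace L \<Longrightarrow> z \<in> hspace L \<Longrightarrow> tail (w + z) = tail w + tail z"
  unfolding tail_sum_def
  by (simp only: hinner_add_left fd_hspace distrib_left infsum_add[OF tail_summable tail_summable] plus_complex.sel)

text \<open>Restricted to real factors, because \<open>tail_sum\<close> takes a real part.\<close>

lemma tail_scale: "w \<in> hspace L \<Longrightarrow> tail (hscale (of_real r) w) = r * tail w"
proof -
  assume w: "w \<in> hspace L"
  have "(\<Sum>\<^sub>\<infinity>k\<in>high. ct k * cf (hscale (of_real r) w) k) = (\<Sum>\<^sub>\<infinity>k\<in>high. of_real r * (ct k * cf w k))"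
    by (intro infsum_cong) (simp add: hinner_scale_left w fd_hspace)
  also have "\<dots> = of_real r * (\<Sum>\<^sub>\<infinity>k\<in>high. ct k * cf w k)"
    by (intro infsum_cmult_right tail_summable w)
  finally show ?thesis unfolding tail_sum_def by simp
qed

lemma tail_diff: "w \<in> hspace L \<Longrightarrow> z \<in> hspace L \<Longrightarrow> tail (w - z) = tail w - tail z"
  unfolding state_diff_eq using tail_add[OF _ hspace_scale] tail_scale[of z "-1"] by simp

lemma tail_cong: "w \<in> hspace L \<Longrightarrow> z \<in> hspace L \<Longrightarrow> heq L w z \<Longrightarrow> tail w = tail z"
  unfolding tail_sum_def using hinner_cong[OF L_nonneg, of w z] fd_hspace by simp

text \<open>
  Subtracting from \<open>w\<close> its modes in a finite set \<open>F\<close> containing all low ones removes exactly the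
  coefficients in \<open>F\<close> of both \<open>w\<close> and \<open>\<A> w\<close>, so the remainder is small in the graph norm and
  so is its trace at \<open>0\<close>.
\<close>

lemma trace_has_sum:
  assumes w: "w \<in> domA L \<alpha>"
  shows "((\<lambda>k. dx L (fst (e k)) 0 * cf w k) has_sum
    (dx L (fst w) 0 - (\<Sum>k\<in>low. dx L (fst (e k)) 0 * cf w k))) high"
  unfolding has_sum_def tendsto_iff eventually_finite_subsets_at_top
proof (intro allI impI)
  let ?g = "\<lambda>k. dx L (fst (e k)) 0 * cf w k"
  fix \<epsilon> :: real assume \<epsilon>: "\<epsilon> > 0"
  note wh = domAD(1)[OF w] and Aw = opA_hspace[OF w]
  obtain C1 where C1: "C1 \<ge> 0" "\<And>w. w \<in> domA L \<alpha> \<Longrightarrow> cmod (dx L (fst w) 0) \<le> C1 * (hnorm L (opA L f ye w) + hnorm L w)"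
    using trace_bounded by blast
  obtain C2 where C2: "C2 > 0" "\<And>w B. w \<in> hspace L \<Longrightarrow> B \<ge> 0 \<Longrightarrow>
      (\<And>I. finite I \<Longrightarrow> (\<Sum>k\<in>I. (cmod (cf w k))\<^sup>2) \<le> B\<^sup>2) \<Longrightarrow> hnorm L w \<le> C2 * B"
    using hnorm_le_coefficients by blast
  obtain M where M: "\<And>w I. w \<in> hspace L \<Longrightarrow> finite I \<Longrightarrow> (\<Sum>k\<in>I. (cmod (cf w k))\<^sup>2) \<le> (M * hnorm L w)\<^sup>2"
    using bessel by blast
  \<comment> \<open>The trace of the remainder will be at most
    \<open>C1 * (C2 * \<delta> + C2 * \<delta>)\<close>. The summand 1 covers \<open>C1 = 0\<close>
    and makes the last comparison strict.\<close>
  define \<delta> where "\<delta> = \<epsilon> / (2 * C1 * C2 + 1)"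
  have den: "2 * C1 * C2 + 1 > 0" using C1(1) C2(1) by (simp add: add_nonneg_pos)
  have \<delta>: "\<delta> > 0" using \<epsilon> den by (simp add: \<delta>_def)
  \<comment> \<open>Adding the squares of both coefficient families lets one finite set
    \<open>F0\<close> cut off \<open>w\<close> and its image under the operator
    simultaneously.\<close>
  define s where "s k = (cmod (cf w k))\<^sup>2 + (cmod (cf (opA L f ye w) k))\<^sup>2" for k
  obtain F0 where F0: "finite F0" "\<And>I. finite I \<Longrightarrow> I \<inter> F0 = {} \<Longrightarrow> sum s I \<le> \<delta>\<^sup>2"
  proof -
    have "sum s I \<le> (M * hnorm L w)\<^sup>2 + (M * hnorm L (opA L f ye w))\<^sup>2" if "finite I" for I
      unfolding s_def sum.distrib using M[OF wh that] M[OF Aw that] by (rule add_mono)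
    from sum_le_bound_tail[OF _ this, of "\<delta>\<^sup>2"] \<delta> that show ?thesis by (auto simp: s_def)
  qed
  show "\<exists>X. finite X \<and> X \<subseteq> high \<and> (\<forall>Y. finite Y \<and> X \<subseteq> Y \<and> Y \<subseteq> high \<longrightarrow>
      dist (sum ?g Y) (dx L (fst w) 0 - sum ?g low) < \<epsilon>)"
  proof (intro exI[of _ "F0 \<inter> high"] conjI allI impI)
    fix Y assume Y: "finite Y \<and> F0 \<inter> high \<subseteq> Y \<and> Y \<subseteq> high"
    define F where "F = Y \<union> low"
    have F: "finite F" "F0 \<subseteq> F" "low \<subseteq> F" using Y finite_low by (auto simp: F_def)
    define u where "u = w - (\<Sum>k\<in>F. hscale (cf w k) (e k))"
    have u: "u \<in> domA L \<alpha>" "dx L (fst u) 0 = dx L (fst w) 0 - (\<Sum>k\<in>F. cf w k * dx L (fst (e k)) 0)"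
      using domA_diff_sum_dx[OF L w e_domA, of 0 F "cf w"] F(1) L by (auto simp: u_def)
    have P: "(\<Sum>k\<in>F. hscale (cf w k) (e k)) \<in> hspace L" by (intro hspace_sum hspace_scale e_hspace)
    have cu: "cf u k = (if k \<in> F then 0 else cf w k)" for k
      unfolding u_def using cf_sum[OF F(1), of "cf w" k] by (simp add: hinner_diff_left wh P fd_hspace)
    have cAu: "cf (opA L f ye u) k = (if k \<in> F then 0 else cf (opA L f ye w) k)" for k
    proof (cases "k \<in> high")
      case True
      then show ?thesis using cf_opA_high[OF True u(1)] cf_opA_high[OF True w] cu by simp
    next
      case False
      then have k: "k \<in> low" by auto
      then obtain c where "cf (opA L f ye u) k = (\<Sum>p\<in>low. c p * cf u p)"
        using cf_opA_low[OF k] u(1) by blast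
      also have "\<dots> = 0" using F(3) by (intro sum.neutral) (auto simp: cu)
      finally show ?thesis using k F(3) by auto
    qed
    have rest: "(\<Sum>k\<in>I - F. s k) \<le> \<delta>\<^sup>2" if "finite I" for I
      using that F(2) by (intro F0(2)) auto
    have "(\<Sum>k\<in>I. (cmod (cf u k))\<^sup>2) \<le> \<delta>\<^sup>2" if I: "finite I" for I
    proof -
      have "(\<Sum>k\<in>I. (cmod (cf u k))\<^sup>2) = (\<Sum>k\<in>I - F. (cmod (cf w k))\<^sup>2)"
        using I by (intro sum.mono_neutral_cong_right) (auto simp: cu)
      also have "\<dots> \<le> (\<Sum>k\<in>I - F. s k)" by (intro sum_mono) (simp add: s_def)
      finally show ?thesis using rest[OF I] by simp
    qed
    then have nu: "hnorm L u \<le> C2 * \<delta>" using \<delta> domAD(1)[OF u(1)] by (intro C2(2)) auto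
    have "(\<Sum>k\<in>I. (cmod (cf (opA L f ye u) k))\<^sup>2) \<le> \<delta>\<^sup>2" if I: "finite I" for I
    proof -
      have "(\<Sum>k\<in>I. (cmod (cf (opA L f ye u) k))\<^sup>2) = (\<Sum>k\<in>I - F. (cmod (cf (opA L f ye w) k))\<^sup>2)"
        using I by (intro sum.mono_neutral_cong_right) (auto simp: cAu)
      also have "\<dots> \<le> (\<Sum>k\<in>I - F. s k)" by (intro sum_mono) (simp add: s_def)
      finally show ?thesis using rest[OF I] by simp
    qed
    then have nAu: "hnorm L (opA L f ye u) \<le> C2 * \<delta>" using \<delta> opA_hspace[OF u(1)] by (intro C2(2)) auto
    have "sum ?g F = sum ?g Y + sum ?g low"
      unfolding F_def using Y finite_low by (intro sum.union_disjoint) auto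
    then have "dist (sum ?g Y) (dx L (fst w) 0 - sum ?g low) = cmod (dx L (fst u) 0)"
      unfolding u(2) dist_norm by (subst norm_minus_commute) (simp add: algebra_simps)
    also have "\<dots> \<le> C1 * (hnorm L (opA L f ye u) + hnorm L u)" by (rule C1(2)[OF u(1)])
    also have "\<dots> \<le> C1 * (C2 * \<delta> + C2 * \<delta>)" using C1(1) nu nAu by (intro mult_left_mono add_mono)
    also have "\<dots> < (2 * C1 * C2 + 1) * \<delta>" using \<delta> by (simp add: algebra_simps)
    also have "\<dots> = \<epsilon>" using den by (simp add: \<delta>_def)
    finally show "dist (sum ?g Y) (dx L (fst w) 0 - sum ?g low) < \<epsilon>" .
  qed (use F0 in auto)
qed

text \<open>On high modes the operator multiplies coefficients by \<open>lam k\<close>, which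
  cancels the division by \<open>lam k\<close> in the tail series; what remains is the expansion of
  the trace without its low modes.\<close>

lemma tail_opA:
  assumes w: "w \<in> domA L \<alpha>"
  shows "tail (opA L f ye w) = Re (dx L (fst w) 0) - Re (\<Sum>k\<in>low. dx L (fst (e k)) 0 * cf w k)"
proof -
  have "(\<Sum>\<^sub>\<infinity>k\<in>high. ct k * cf (opA L f ye w) k) = (\<Sum>\<^sub>\<infinity>k\<in>high. dx L (fst (e k)) 0 * cf w k)"
    by (intro infsum_cong) (use cf_opA_high[OF _ w] lam_nonzero in auto)
  also have "\<dots> = dx L (fst w) 0 - (\<Sum>k\<in>low. dx L (fst (e k)) 0 * cf w k)"
    using trace_has_sum[OF w] by (rule infsumI)
  finally show ?thesis unfolding tail_sum_def by simp
qed

lemma low_trace_bounded: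
  "\<exists>C>0. \<forall>w\<in>hspace L. cmod (\<Sum>k\<in>low. dx L (fst (e k)) 0 * cf w k) \<le> C * hnorm L w"
proof -
  obtain M where M: "M > 0" "\<And>w k. w \<in> hspace L \<Longrightarrow> cmod (cf w k) \<le> M * hnorm L w"
    using cf_bounded by blast
  define S where "S = (\<Sum>k\<in>low. cmod (dx L (fst (e k)) 0))"
  have S: "S \<ge> 0" by (auto simp: S_def intro: sum_nonneg)
  show ?thesis
  proof (intro exI[of _ "S * M + 1"] conjI ballI)
    show "S * M + 1 > 0" using S M by (simp add: add_nonneg_pos)
    fix w assume w: "w \<in> hspace L"
    have "cmod (\<Sum>k\<in>low. dx L (fst (e k)) 0 * cf w k) \<le> (\<Sum>k\<in>low. cmod (dx L (fst (e k)) 0) * (M * hnorm L w))"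
      by (rule sum_norm_le) (auto simp: norm_mult intro!: mult_left_mono M(2) w)
    also have "\<dots> = S * M * hnorm L w" by (simp add: S_def sum_distrib_right mult.assoc)
    also have "\<dots> \<le> (S * M + 1) * hnorm L w" by (simp add: algebra_simps)
    finally show "cmod (\<Sum>k\<in>low. dx L (fst (e k)) 0 * cf w k) \<le> (S * M + 1) * hnorm L w" .
  qed
qed

end

section \<open>The nonlinear residual\<close>

text \<open>States carry only \<open>hnorm\<close> and form no normed vector type, so time
  derivatives of a state are used through scalar functionals. Linearity over the reals is what is
  asked for, since \<open>tail_sum\<close> and the feedback take real parts.\<close>

lemma hderiv_functional:
  fixes \<Phi> :: "state \<Rightarrow> 'b::real_normed_vector"
  assumes hd: "has_hderiv_on L J W W'"
    and W: "\<And>t. t \<in> J \<Longrightarrow> W t \<in> hspace L" "\<And>t. t \<in> J \<Longrightarrow> W' t \<in> hspace L" and t: "t \<in> J"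
    and diff: "\<And>w z. w \<in> hspace L \<Longrightarrow> z \<in> hspace L \<Longrightarrow> \<Phi> (w - z) = \<Phi> w - \<Phi> z"
    and scale: "\<And>r w. w \<in> hspace L \<Longrightarrow> \<Phi> (hscale (of_real r) w) = r *\<^sub>R \<Phi> w"
    and bd: "\<And>w. w \<in> hspace L \<Longrightarrow> norm (\<Phi> w) \<le> C * hnorm L w"
  shows "((\<lambda>s. \<Phi> (W s)) has_vector_derivative \<Phi> (W' t)) (at t within J)"
  unfolding has_vector_derivative_def has_derivative_within
proof (intro conjI bounded_linear_scaleR_left)
  let ?D = "\<lambda>s. hscale (of_real (1 / (s - t))) (W s - W t) - W' t"
  have lim: "((\<lambda>s. C * hnorm L (?D s)) \<longlongrightarrow> 0) (at t within J)"
    using hd t unfolding has_hderiv_on_def by (intro tendsto_mult_right_zero) blast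
  have "norm ((1 / norm (s - t)) *\<^sub>R (\<Phi> (W s) - (\<Phi> (W t) + (s - t) *\<^sub>R \<Phi> (W' t)))) \<le> C * hnorm L (?D s)"
    if s: "s \<in> J" "s \<noteq> t" for s
  proof -
    have *: "W s - W t \<in> hspace L" "hscale (of_real (1 / (s - t))) (W s - W t) \<in> hspace L" "?D s \<in> hspace L"
      using W s t by (auto intro!: hspace_diff hspace_scale)
    have "\<Phi> (?D s) = (1 / (s - t)) *\<^sub>R (\<Phi> (W s) - \<Phi> (W t)) - \<Phi> (W' t)"
      unfolding diff[OF *(2) W(2)[OF t]] scale[OF *(1)] diff[OF W(1)[OF s(1)] W(1)[OF t]] ..
    also have "\<dots> = (1 / (s - t)) *\<^sub>R (\<Phi> (W s) - (\<Phi> (W t) + (s - t) *\<^sub>R \<Phi> (W' t)))"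
      using s(2) by (simp add: scaleR_diff_right scaleR_add_right)
    finally have "norm (\<Phi> (?D s)) = norm ((1 / norm (s - t)) *\<^sub>R (\<Phi> (W s) - (\<Phi> (W t) + (s - t) *\<^sub>R \<Phi> (W' t))))"
      by simp
    then show ?thesis using bd[OF *(3)] by simp
  qed
  then have "\<forall>\<^sub>F s in at t within J. norm ((1 / norm (s - t)) *\<^sub>R (\<Phi> (W s) - (\<Phi> (W t) + (s - t) *\<^sub>R \<Phi> (W' t)))) \<le> C * hnorm L (?D s)"
    by (simp add: eventually_at_filter)
  then show "((\<lambda>s. (1 / norm (s - t)) *\<^sub>R (\<Phi> (W s) - (\<Phi> (W t) + (s - t) *\<^sub>R \<Phi> (W' t)))) \<longlongrightarrow> 0) (at t within J)"
    using lim by (rule Lim_null_comparison)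
qed

text \<open>Mean value theorem with an intermediate point \<open>c\<close>; replacing
  \<open>f1 c\<close> by \<open>f1 a\<close> costs the Lipschitz bound.\<close>

lemma first_order_remainder_le:
  fixes f f1 :: "real \<Rightarrow> real"
  assumes f: "\<And>x. (f has_real_derivative f1 x) (at x)"
    and lip: "\<And>x y. \<lbrakk>\<bar>x\<bar> \<le> R; \<bar>y\<bar> \<le> R\<rbrakk> \<Longrightarrow> \<bar>f1 x - f1 y\<bar> \<le> B * \<bar>x - y\<bar>"
    and ab: "\<bar>a\<bar> \<le> R" "\<bar>b\<bar> \<le> R" and B: "B \<ge> 0"
  shows "\<bar>f b - f a - f1 a * (b - a)\<bar> \<le> B * (b - a)\<^sup>2"
proof -
  have "\<exists>c. \<bar>c\<bar> \<le> R \<and> \<bar>c - a\<bar> \<le> \<bar>b - a\<bar> \<and> f b - f a = f1 c * (b - a)"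
  proof (cases a b rule: linorder_cases)
    case less
    obtain c where "a < c" "c < b" "f b - f a = (b - a) * f1 c"
      using MVT2[OF less, of f f1] f by auto
    then show ?thesis using ab by (intro exI[of _ c]) (auto simp: mult.commute)
  next
    case equal
    then show ?thesis using ab by (intro exI[of _ a]) auto
  next
    case greater
    obtain c where "b < c" "c < a" "f a - f b = (a - b) * f1 c"
      using MVT2[OF greater, of f f1] f by auto
    then show ?thesis using ab by (intro exI[of _ c]) (auto simp: algebra_simps)
  qed
  then obtain c where c: "\<bar>c\<bar> \<le> R" "\<bar>c - a\<bar> \<le> \<bar>b - a\<bar>" "f b - f a = f1 c * (b - a)" by blast
  have "f b - f a - f1 a * (b - a) = (f1 c - f1 a) * (b - a)"
    unfolding c(3) by (simp add: algebra_simps)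
  then have "\<bar>f b - f a - f1 a * (b - a)\<bar> = \<bar>f1 c - f1 a\<bar> * \<bar>b - a\<bar>" by (simp add: abs_mult)
  also have "\<dots> \<le> (B * \<bar>b - a\<bar>) * \<bar>b - a\<bar>"
    using lip[OF c(1) ab(1)] c(2) B by (intro mult_right_mono) (auto intro: order_trans mult_left_mono)
  finally show ?thesis by (simp add: power2_eq_square mult.assoc)
qed

lemma C2_on_UNIV_deriv:
  assumes "C2_on UNIV f"
  shows "(f has_real_derivative deriv f x) (at x)" "(deriv f has_real_derivative deriv (deriv f) x) (at x)"
    "continuous_on UNIV (deriv (deriv f))"
proof -
  obtain g h where g: "\<And>x. (f has_real_derivative g x) (at x)" "\<And>x. (g has_real_derivative h x) (at x)"
    "continuous_on UNIV h"
    using assms unfolding C2_on_def C1_on_def by auto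
  have "deriv f = g" using g(1) by (auto intro!: DERIV_imp_deriv)
  moreover have "deriv g = h" using g(2) by (auto intro!: DERIV_imp_deriv)
  ultimately show "(f has_real_derivative deriv f x) (at x)" "(deriv f has_real_derivative deriv (deriv f) x) (at x)"
    "continuous_on UNIV (deriv (deriv f))" using g by auto
qed

text \<open>Taylor's formula with integral remainder: with y = \<open>ye x\<close> and v =
  \<open>Re (w x)\<close>, the integrand times v^2 has the antiderivative (1 - s) f'(y + s v) v +
  f(y + s v). In this form continuity, bounds and differentiability of the residual follow from
  those of f and f'.\<close>

lemma residual_closed_form:
  assumes "C2_on UNIV f"
  shows "residual f ye w x = of_real (f (ye x + Re (w x)) - f (ye x) - deriv f (ye x) * Re (w x))"
proof -
  define y v where "y = ye x" and "v = Re (w x)"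
  note d = C2_on_UNIV_deriv[OF assms]
  let ?h = "\<lambda>s. (1 - s) * deriv (deriv f) (y + s * v)"
  have c: "continuous_on {0..1} ?h"
    by (intro continuous_intros continuous_on_compose2[OF d(3)]) auto
  have "((\<lambda>s. v\<^sup>2 * ?h s) has_integral
      ((1 - 1) * deriv f (y + 1 * v) * v + f (y + 1 * v) - ((1 - 0) * deriv f (y + 0 * v) * v + f (y + 0 * v)))) {0..1}"
  proof (rule fundamental_theorem_of_calculus)
    fix s :: real
    have "((\<lambda>s. (1 - s) * deriv f (y + s * v) * v + f (y + s * v)) has_real_derivative v\<^sup>2 * ?h s) (at s)"
      by (rule derivative_eq_intros DERIV_chain2[OF d(1)] DERIV_chain2[OF d(2)] refl)+
         (simp add: power2_eq_square algebra_simps)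
    then show "((\<lambda>s. (1 - s) * deriv f (y + s * v) * v + f (y + s * v)) has_vector_derivative v\<^sup>2 * ?h s) (at s within {0..1})"
      by (simp add: has_real_derivative_iff_has_vector_derivative has_vector_derivative_at_within)
  qed simp
  from integral_unique[OF this]
  have "v\<^sup>2 * integral {0..1} ?h = f (y + v) - f y - deriv f y * v" by simp
  moreover have "(\<integral>s. ?h s \<partial>lebesgue_on {0..1}) = integral {0..1} ?h"
    by (intro lebesgue_integral_eq_integral continuous_imp_integrable_real c) auto
  ultimately show ?thesis by (simp add: residual_def y_def v_def)
qed

locale closed_loop = wave_basis +
  fixes K :: "real mat"
  assumes f_C2: "C2_on UNIV f" and ye_cont: "continuous_on {0..L} ye"
    and K_dim: "K \<in> carrier_mat 1 (2 * n0 + 3)"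
begin

abbreviation "res w \<equiv> (0 :: real \<Rightarrow> complex, residual f ye (fst w))"

text \<open>The directional derivative of \<open>res\<close> at \<open>w\<close> along
  \<open>w'\<close>, obtained from the closed form of the residual.\<close>

definition res_deriv :: "state \<Rightarrow> state \<Rightarrow> state" where
  "res_deriv w w' = (0, \<lambda>x. of_real ((deriv f (ye x + Re (fst w x)) - deriv f (ye x)) * Re (fst w' x)))"

lemma residual_continuous: "w \<in> hspace L \<Longrightarrow> continuous_on {0..L} (residual f ye (fst w))"
  and res_deriv_continuous: "w \<in> hspace L \<Longrightarrow> w' \<in> hspace L \<Longrightarrow> continuous_on {0..L} (snd (res_deriv w w'))"
proof -
  have f0: "continuous_on UNIV f" and f1: "continuous_on UNIV (deriv f)"
    using C2_on_UNIV_deriv[OF f_C2] by (meson DERIV_continuous_on UNIV_I has_field_derivative_at_within)+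
  assume w: "w \<in> hspace L"
  note wc = H1_continuous[OF hspaceD(1)[OF w] L_nonneg]
  show "continuous_on {0..L} (residual f ye (fst w))"
    unfolding residual_closed_form[OF f_C2]
    by (intro continuous_intros wc ye_cont continuous_on_compose2[OF f0] continuous_on_compose2[OF f1]) auto
  assume w': "w' \<in> hspace L"
  note wc' = H1_continuous[OF hspaceD(1)[OF w'] L_nonneg]
  show "continuous_on {0..L} (snd (res_deriv w w'))"
    unfolding res_deriv_def snd_conv
    by (intro continuous_intros wc wc' ye_cont continuous_on_compose2[OF f1]) auto
qed

lemma res_hspace: "w \<in> hspace L \<Longrightarrow> res w \<in> hspace L"
  by (intro zero_pair_hspace L2_continuous residual_continuous)

lemma res_deriv_hspace: "w \<in> hspace L \<Longrightarrow> w' \<in> hspace L \<Longrightarrow> res_deriv w w' \<in> hspace L"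
  using zero_pair_hspace[OF L2_continuous[OF res_deriv_continuous]] by (simp add: res_deriv_def)

text \<open>All arguments lie in \<open>[-R, R]\<close>, where \<open>R\<close> exceeds the bound of
  the steady state by 1. On this compact interval f'' is bounded, and one constant serves as
  Lipschitz constant of f' and in the remainder estimate.\<close>

lemma f_local_bounds:
  "\<exists>B\<ge>0. (\<forall>x\<in>{0..L}. \<forall>u v. \<bar>u\<bar> \<le> 1 \<longrightarrow> \<bar>v\<bar> \<le> 1 \<longrightarrow>
      \<bar>f (ye x + v) - f (ye x + u) - deriv f (ye x + u) * (v - u)\<bar> \<le> B * (v - u)\<^sup>2 \<and>
      \<bar>deriv f (ye x + u) - deriv f (ye x + v)\<bar> \<le> B * \<bar>u - v\<bar>)"
proof -
  note d = C2_on_UNIV_deriv[OF f_C2]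
  have "compact (ye ` {0..L})" by (intro compact_continuous_image ye_cont) auto
  then obtain Y where Y: "\<And>x. x \<in> {0..L} \<Longrightarrow> \<bar>ye x\<bar> \<le> Y"
    using compact_imp_bounded bounded_iff by (metis imageI real_norm_def)
  define R where "R = Y + 1"
  have "compact (deriv (deriv f) ` {-R..R})"
    using d(3) by (intro compact_continuous_image) (auto intro: continuous_on_subset)
  then obtain B where B: "\<And>x. x \<in> {-R..R} \<Longrightarrow> \<bar>deriv (deriv f) x\<bar> \<le> B"
    using compact_imp_bounded bounded_iff by (metis imageI real_norm_def)
  have lip: "\<bar>deriv f x - deriv f y\<bar> \<le> \<bar>B\<bar> * \<bar>x - y\<bar>" if "\<bar>x\<bar> \<le> R" "\<bar>y\<bar> \<le> R" for x y
  proof -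
    have "norm (deriv f x - deriv f y) \<le> \<bar>B\<bar> * norm (x - y)"
    proof (rule field_differentiable_bound[of "{-R..R}"])
      show "(deriv f has_field_derivative deriv (deriv f) z) (at z within {-R..R})" for z
        using d(2) by (rule has_field_derivative_at_within)
      show "norm (deriv (deriv f) z) \<le> \<bar>B\<bar>" if "z \<in> {-R..R}" for z using B[OF that] by simp
    qed (use that in auto)
    then show ?thesis by simp
  qed
  show ?thesis
  proof (intro exI[of _ "\<bar>B\<bar>"] conjI ballI allI impI)
    fix x u v :: real assume x: "x \<in> {0..L}" and uv: "\<bar>u\<bar> \<le> 1" "\<bar>v\<bar> \<le> 1"
    have R: "\<bar>ye x + u\<bar> \<le> R" "\<bar>ye x + v\<bar> \<le> R" using Y[OF x] uv by (auto simp: R_def)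
    show "\<bar>f (ye x + v) - f (ye x + u) - deriv f (ye x + u) * (v - u)\<bar> \<le> \<bar>B\<bar> * (v - u)\<^sup>2"
      using first_order_remainder_le[of f "deriv f", OF d(1) lip R] by simp
    show "\<bar>deriv f (ye x + u) - deriv f (ye x + v)\<bar> \<le> \<bar>B\<bar> * \<bar>u - v\<bar>"
      using lip[OF R] by simp
  qed simp
qed

text \<open>Almost everywhere and non-strict: this is what an essential supremum below 1 provides
  directly.\<close>

definition bounded_by_one :: "state \<Rightarrow> bool" where
  "bounded_by_one w \<longleftrightarrow> (AE x in lebesgue_on {0..L}. cmod (fst w x) \<le> 1)"

lemma AE_in_Icc: "AE x in lebesgue_on {0..L}. x \<in> {0..L}"
  by (rule AE_I2) simp

text \<open>The residual is quadratic in w^1; one of the two factors is estimated by 1, which leaves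
  a linear bound.\<close>

lemma hnorm_res_le: "\<exists>C\<ge>0. \<forall>w\<in>hspace L. bounded_by_one w \<longrightarrow> hnorm L (res w) \<le> C * hnorm L w"
proof -
  obtain B where B: "B \<ge> 0" "\<And>x u v. x \<in> {0..L} \<Longrightarrow> \<bar>u\<bar> \<le> 1 \<Longrightarrow> \<bar>v\<bar> \<le> 1 \<Longrightarrow>
      \<bar>f (ye x + v) - f (ye x + u) - deriv f (ye x + u) * (v - u)\<bar> \<le> B * (v - u)\<^sup>2"
    using f_local_bounds by blast
  show ?thesis
  proof (intro exI[of _ "B * L"] conjI ballI impI)
    show "0 \<le> B * L" using B(1) L by simp
    fix w assume w: "w \<in> hspace L" and one: "bounded_by_one w"
    have "AE x in lebesgue_on {0..L}. cmod (residual f ye (fst w) x) \<le> B * cmod (fst w x)"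
      using one[unfolded bounded_by_one_def] AE_in_Icc
    proof eventually_elim
      case (elim x)
      define v where "v = Re (fst w x)"
      have v: "\<bar>v\<bar> \<le> cmod (fst w x)" "\<bar>v\<bar> \<le> 1"
        using abs_Re_le_cmod[of "fst w x"] elim(1) by (auto simp: v_def)
      have "cmod (residual f ye (fst w) x) \<le> B * v\<^sup>2"
        using B(2)[OF elim(2), of 0 v] v(2) unfolding residual_closed_form[OF f_C2] norm_of_real
        by (simp add: v_def)
      also have "v\<^sup>2 = \<bar>v\<bar> * \<bar>v\<bar>" by (simp add: power2_eq_square)
      also have "B * (\<bar>v\<bar> * \<bar>v\<bar>) \<le> B * (1 * cmod (fst w x))"
        using B(1) v by (intro mult_left_mono mult_mono) auto
      finally show ?case by simp
    qed
    then have "hnorm L (res w) \<le> B * hnorm L (0, fst w)"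
      by (intro hnorm_zero_pair_mono L2_continuous residual_continuous w fst_L2 B(1))
    also have "\<dots> \<le> B * (L * hnorm L w)" using B(1) w by (intro mult_left_mono hnorm_fst_le)
    finally show "hnorm L (res w) \<le> B * L * hnorm L w" by (simp add: mult.assoc)
  qed
qed

text \<open>The right-hand side is the L2 norm of the first component of \<open>w'\<close> and not
  \<open>hnorm L w'\<close>: along a trajectory the former is bounded by the state, whereas the
  latter involves A W.\<close>

lemma hnorm_res_deriv_le:
  "\<exists>C\<ge>0. \<forall>w\<in>hspace L. \<forall>w'\<in>hspace L. bounded_by_one w \<longrightarrow> hnorm L (res_deriv w w') \<le> C * hnorm L (0, fst w')"
proof -
  obtain B where B: "B \<ge> 0" "\<And>x u v. x \<in> {0..L} \<Longrightarrow> \<bar>u\<bar> \<le> 1 \<Longrightarrow> \<bar>v\<bar> \<le> 1 \<Longrightarrow>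
      \<bar>deriv f (ye x + u) - deriv f (ye x + v)\<bar> \<le> B * \<bar>u - v\<bar>"
    using f_local_bounds by blast
  show ?thesis
  proof (intro exI[of _ B] conjI ballI impI B(1))
    fix w w' assume w: "w \<in> hspace L" and w': "w' \<in> hspace L" and one: "bounded_by_one w"
    have "AE x in lebesgue_on {0..L}. cmod (snd (res_deriv w w') x) \<le> B * cmod (fst w' x)"
      using one[unfolded bounded_by_one_def] AE_in_Icc
    proof eventually_elim
      case (elim x)
      define v where "v = Re (fst w x)"
      have v: "\<bar>v\<bar> \<le> 1"
        using abs_Re_le_cmod[of "fst w x"] elim(1) by (auto simp: v_def)
      have "\<bar>deriv f (ye x + v) - deriv f (ye x)\<bar> \<le> B * \<bar>v\<bar>"
        using B(2)[OF elim(2), of v 0] v by simp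
      also have "\<dots> \<le> B" using v B(1) by (simp add: mult_left_le)
      finally have "cmod (snd (res_deriv w w') x) \<le> B * \<bar>Re (fst w' x)\<bar>"
        unfolding res_deriv_def snd_conv norm_of_real abs_mult v_def by (rule mult_right_mono) simp
      also have "\<dots> \<le> B * cmod (fst w' x)" using B(1) by (intro mult_left_mono abs_Re_le_cmod)
      finally show ?case .
    qed
    then have "hnorm L (0, snd (res_deriv w w')) \<le> B * hnorm L (0, fst w')"
      by (intro hnorm_zero_pair_mono L2_continuous res_deriv_continuous w w' fst_L2 B(1))
    then show "hnorm L (res_deriv w w') \<le> B * hnorm L (0, fst w')" by (simp add: res_deriv_def)
  qed
qed

text \<open>Pointwise, the error of the difference quotient splits into a Taylor remainder divided
  by s - t, which is of order |s - t|, and a bounded factor times the error of the difference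
  quotient of w^1. Convergence in the state norm makes the second part uniformly small in x, so the
  L2 norm of the whole tends to 0.\<close>

lemma res_has_hderiv:
  assumes hd: "has_hderiv_on L J W W'"
    and W: "\<And>t. t \<in> J \<Longrightarrow> W t \<in> hspace L" "\<And>t. t \<in> J \<Longrightarrow> W' t \<in> hspace L"
    and one: "\<And>t. t \<in> J \<Longrightarrow> bounded_by_one (W t)"
  shows "has_hderiv_on L J (\<lambda>t. res (W t)) (\<lambda>t. res_deriv (W t) (W' t))"
  unfolding has_hderiv_on_def
proof
  fix t assume t: "t \<in> J"
  obtain B where B: "B \<ge> 0" "\<And>x u v. x \<in> {0..L} \<Longrightarrow> \<bar>u\<bar> \<le> 1 \<Longrightarrow> \<bar>v\<bar> \<le> 1 \<Longrightarrow>
      \<bar>f (ye x + v) - f (ye x + u) - deriv f (ye x + u) * (v - u)\<bar> \<le> B * (v - u)\<^sup>2 \<and>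
      \<bar>deriv f (ye x + u) - deriv f (ye x + v)\<bar> \<le> B * \<bar>u - v\<bar>"
    using f_local_bounds by blast
  let ?D = "\<lambda>s. hscale (of_real (1 / (s - t))) (W s - W t) - W' t"
  let ?R = "\<lambda>s. hscale (of_real (1 / (s - t))) (res (W s) - res (W t)) - res_deriv (W t) (W' t)"
  \<comment> \<open>Sup norm bounds from the embedding: \<open>d s\<close> for the error of the
    difference quotient of w^1, and \<open>m\<close> for its time derivative at
    \<open>t\<close>.\<close>
  define d where "d s = sqrt L * hnorm L (?D s)" for s
  define m where "m = sqrt L * hnorm L (W' t)"
  have m0: "m \<ge> 0" using L by (simp add: m_def)
  have d0: "(d \<longlongrightarrow> 0) (at t within J)"
    using hd t unfolding has_hderiv_on_def d_def by (intro tendsto_mult_right_zero) blast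
  define b where "b s = sqrt L * (B * \<bar>s - t\<bar> * (d s + m)\<^sup>2 + B * d s)" for s
  have "(b \<longlongrightarrow> sqrt L * (B * \<bar>t - t\<bar> * (0 + m)\<^sup>2 + B * 0)) (at t within J)"
    unfolding b_def by (intro tendsto_intros d0)
  then have b0: "(b \<longlongrightarrow> 0) (at t within J)" by simp
  have "hnorm L (?R s) \<le> b s" if s: "s \<in> J" "s \<noteq> t" for s
  proof -
    have Dh: "?D s \<in> hspace L" using W s t by (auto intro!: hspace_diff hspace_scale)
    have Rh: "?R s \<in> hspace L"
      by (intro hspace_diff hspace_scale res_hspace res_deriv_hspace W s t)
    have ds: "d s \<ge> 0" using L by (simp add: d_def)
    have fR: "?R s = (0, snd (?R s))" by (simp add: prod_eq_iff fun_eq_iff res_deriv_def)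
    have "AE x in lebesgue_on {0..L}. cmod (snd (?R s) x) \<le> B * \<bar>s - t\<bar> * (d s + m)\<^sup>2 + B * d s"
      using one[OF s(1), unfolded bounded_by_one_def] one[OF t, unfolded bounded_by_one_def] AE_in_Icc
    proof eventually_elim
      case (elim x)
      define u v q where "u = Re (fst (W t) x)" and "v = Re (fst (W s) x)" and "q = Re (fst (W' t) x)"
      have uv: "\<bar>u\<bar> \<le> 1" "\<bar>v\<bar> \<le> 1"
        using abs_Re_le_cmod[of "fst (W t) x"] abs_Re_le_cmod[of "fst (W s) x"] elim by (auto simp: u_def v_def)
      define f1 where "f1 = deriv f (ye x + u)" define f10 where "f10 = deriv f (ye x)"
      have q: "\<bar>q\<bar> \<le> m"
        using order_trans[OF abs_Re_le_cmod hspace_sup_le[OF L_nonneg W(2)[OF t] elim(3)]] by (simp add: q_def m_def)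
      have Dx: "\<bar>(v - u) / (s - t) - q\<bar> \<le> d s"
        using order_trans[OF abs_Re_le_cmod hspace_sup_le[OF L_nonneg Dh elim(3)]]
        by (simp add: d_def u_def v_def q_def)
      then have "\<bar>(v - u) / (s - t)\<bar> \<le> d s + m" using q by linarith
      then have vu: "\<bar>v - u\<bar> \<le> \<bar>s - t\<bar> * (d s + m)"
        using s(2) by (simp add: abs_divide divide_le_eq mult.commute)
      define r where "r = f (ye x + v) - f (ye x + u) - f1 * (v - u)"
      have r: "\<bar>r\<bar> \<le> B * (v - u)\<^sup>2" using B(2)[OF elim(3) uv] by (simp add: r_def f1_def)
      have "\<bar>r / (s - t)\<bar> \<le> B * \<bar>s - t\<bar> * (d s + m)\<^sup>2"
      proof -
        have "\<bar>r\<bar> \<le> B * (\<bar>s - t\<bar> * (d s + m))\<^sup>2"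
          using r B(1) power_mono[OF vu, of 2] by (auto intro: order_trans mult_left_mono)
        also have "\<dots> = (B * \<bar>s - t\<bar> * (d s + m)\<^sup>2) * \<bar>s - t\<bar>"
          by (simp add: power2_eq_square algebra_simps)
        finally show ?thesis using s(2) by (simp add: abs_divide divide_le_eq)
      qed
      moreover have "\<bar>(f1 - f10) * ((v - u) / (s - t) - q)\<bar> \<le> B * d s"
      proof -
        have "\<bar>f1 - f10\<bar> \<le> B * \<bar>u\<bar>" using B(2)[OF elim(3) uv(1), of 0] by (simp add: f1_def f10_def)
        also have "\<dots> \<le> B" using uv B(1) by (simp add: mult_left_le)
        finally show ?thesis unfolding abs_mult using Dx B(1) by (intro mult_mono) auto
      qed
      moreover have "snd (?R s) x = of_real (r / (s - t) + (f1 - f10) * ((v - u) / (s - t) - q))"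
      proof -
        have "snd (?R s) x = of_real (1 / (s - t) * ((f (ye x + v) - f (ye x) - f10 * v) - (f (ye x + u) - f (ye x) - f10 * u)) - (f1 - f10) * q)"
          unfolding snd_diff snd_hscale minus_apply residual_closed_form[OF f_C2] res_deriv_def snd_conv
            u_def v_def q_def f1_def f10_def by simp
        also have "1 / (s - t) * ((f (ye x + v) - f (ye x) - f10 * v) - (f (ye x + u) - f (ye x) - f10 * u)) - (f1 - f10) * q
            = r / (s - t) + (f1 - f10) * ((v - u) / (s - t) - q)"
          using s(2) by (simp add: r_def divide_simps) (simp add: algebra_simps)
        finally show ?thesis .
      qed
      ultimately show ?case by (simp only: norm_of_real)
    qed
    then have "hnorm L (0, snd (?R s)) \<le> sqrt L * (B * \<bar>s - t\<bar> * (d s + m)\<^sup>2 + B * d s)"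
      using B(1) ds m0 by (intro hnorm_zero_pair_le_bound L_nonneg hspaceD(2)[OF Rh]) auto
    then show ?thesis using fR by (simp add: b_def)
  qed
  then have "\<forall>\<^sub>F s in at t within J. norm (hnorm L (?R s)) \<le> b s"
    by (simp add: eventually_at_filter)
  then show "((\<lambda>s. hnorm L (?R s)) \<longlongrightarrow> 0) (at t within J)"
    using b0 by (rule Lim_null_comparison)
qed

end

section \<open>Trajectories of the closed loop\<close>

lemma avec_hspace: "0 \<le> L \<Longrightarrow> avec L \<alpha> \<in> hspace L"
proof -
  assume L: "0 \<le> L"
  have "has_weak_deriv L (\<lambda>x. of_real (x / (\<alpha> * L))) (\<lambda>_. of_real (1 / (\<alpha> * L)))"
    unfolding has_weak_deriv_def
  proof (intro conjI ballI)
    fix x assume "x \<in> {0..L}"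
    then show "complex_of_real (x / (\<alpha> * L)) = of_real (0 / (\<alpha> * L)) + (\<integral>y. of_real (1 / (\<alpha> * L)) \<partial>lebesgue_on {0..x})"
      by (simp add: measure_restrict_space scaleR_conv_of_real)
  qed (rule L2_const)
  then show "avec L \<alpha> \<in> hspace L"
    using L2_const[of 0 L] by (auto simp: hspace_def avec_def intro: H1_I)
qed

lemma bvec_hspace: "0 \<le> L \<Longrightarrow> bvec L \<alpha> \<in> hspace L"
proof -
  have "continuous_on {0..L} (\<lambda>x. complex_of_real (- x / (\<alpha> * L)))"
    by (simp only: divide_inverse) (intro continuous_intros)
  then show "bvec L \<alpha> \<in> hspace L"
    using zero_pair_hspace[OF L2_continuous] by (simp add: bvec_def zero_fun_def)
qed

section \<open>The feedback law and the derivative of the forcing\<close>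

context closed_loop
begin

definition feedback_low :: "state \<Rightarrow> real" where
  "feedback_low w = (\<Sum>i\<in>{1..2 * n0 + 1}. K $$ (0, i) * Re (cf w (int i - 1 - int n0)))"

abbreviation "K_first \<equiv> K $$ (0, 0)"
abbreviation "K_last \<equiv> K $$ (0, 2 * n0 + 2)"

text \<open>Separates the parts of K X whose time derivatives are estimated by different means: v,
  the low modes, and \<xi>.\<close>

lemma feedback_eq:
  "vec_index (K *\<^sub>v Xvec L e fd lam n0 w \<zeta> v) 0 = K_first * v + feedback_low w + K_last * (\<zeta> - tail w)"
proof -
  have "vec_index (K *\<^sub>v Xvec L e fd lam n0 w \<zeta> v) 0
      = (\<Sum>i\<in>{0..<2 * n0 + 3}. K $$ (0, i) * vec_index (Xvec L e fd lam n0 w \<zeta> v) i)"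
    using K_dim by (simp add: scalar_prod_def Xvec_def)
  also have "{0..<2 * n0 + 3} = insert 0 (insert (2 * n0 + 2) {1..2 * n0 + 1})" by auto
  also have "(\<Sum>i\<in>\<dots>. K $$ (0, i) * vec_index (Xvec L e fd lam n0 w \<zeta> v) i)
      = K_first * v + (K_last * (\<zeta> - tail w) + feedback_low w)"
    by (simp add: Xvec_def xi_def feedback_low_def)
  finally show ?thesis by simp
qed

lemma feedback_low_add: "w \<in> hspace L \<Longrightarrow> z \<in> hspace L \<Longrightarrow> feedback_low (w + z) = feedback_low w + feedback_low z"
  unfolding feedback_low_def by (simp add: hinner_add_left fd_hspace distrib_left sum.distrib)

lemma feedback_low_diff: "w \<in> hspace L \<Longrightarrow> z \<in> hspace L \<Longrightarrow> feedback_low (w - z) = feedback_low w - feedback_low z"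
  unfolding feedback_low_def by (simp add: hinner_diff_left fd_hspace right_diff_distrib sum_subtractf)

lemma feedback_low_scale: "w \<in> hspace L \<Longrightarrow> feedback_low (hscale (of_real r) w) = r * feedback_low w"
  unfolding feedback_low_def sum_distrib_left
  by (intro sum.cong refl) (simp add: hinner_scale_left fd_hspace mult.left_commute)

lemma feedback_low_cong: "w \<in> hspace L \<Longrightarrow> z \<in> hspace L \<Longrightarrow> heq L w z \<Longrightarrow> feedback_low w = feedback_low z"
  unfolding feedback_low_def using hinner_cong[OF L_nonneg, of w z] fd_hspace by simp

text \<open>The second bound is for the derivative of v': differentiating the low modes produces
  those of A W, which cost no graph norm.\<close>

lemma feedback_low_bounded:
  "\<exists>C>0. (\<forall>w\<in>hspace L. \<bar>feedback_low w\<bar> \<le> C * hnorm L w) \<and>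
    (\<forall>w\<in>domA L \<alpha>. \<bar>feedback_low (opA L f ye w)\<bar> \<le> C * hnorm L w)"
proof -
  obtain M where M: "M > 0" "\<And>w k. w \<in> hspace L \<Longrightarrow> cmod (cf w k) \<le> M * hnorm L w"
    using cf_bounded by blast
  obtain N where N: "N > 0" "\<And>w k. w \<in> domA L \<alpha> \<Longrightarrow> k \<in> low \<Longrightarrow> cmod (cf (opA L f ye w) k) \<le> N * hnorm L w"
    using cf_opA_low_bounded by blast
  define S where "S = (\<Sum>i\<in>{1..2 * n0 + 1}. \<bar>K $$ (0, i)\<bar>)"
  have S: "S \<ge> 0" by (auto simp: S_def intro: sum_nonneg)
  have *: "\<bar>feedback_low z\<bar> \<le> S * b" if z: "\<And>k. k \<in> low \<Longrightarrow> cmod (cf z k) \<le> b" for z b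
  proof -
    have "norm (feedback_low z) \<le> (\<Sum>i\<in>{1..2 * n0 + 1}. \<bar>K $$ (0, i)\<bar> * b)"
      unfolding feedback_low_def
    proof (rule sum_norm_le)
      fix i assume i: "i \<in> {1..2 * n0 + 1}"
      have "\<bar>Re (cf z (int i - 1 - int n0))\<bar> \<le> b"
        using i by (intro order_trans[OF abs_Re_le_cmod z]) auto
      then show "norm (K $$ (0, i) * Re (cf z (int i - 1 - int n0))) \<le> \<bar>K $$ (0, i)\<bar> * b"
        by (simp add: abs_mult mult_left_mono)
    qed
    then show ?thesis by (simp only: S_def sum_distrib_right real_norm_def)
  qed
  show ?thesis
  proof (intro exI[of _ "S * M + S * N + 1"] conjI ballI)
    show "S * M + S * N + 1 > 0" using S M N by (simp add: add_nonneg_pos)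
    show "\<bar>feedback_low w\<bar> \<le> (S * M + S * N + 1) * hnorm L w" if w: "w \<in> hspace L" for w
    proof -
      have "\<bar>feedback_low w\<bar> \<le> S * (M * hnorm L w)" using M(2)[OF w] by (rule *)
      also have "\<dots> \<le> S * (M * hnorm L w) + (S * N + 1) * hnorm L w" using S N by simp
      finally show ?thesis by (simp add: algebra_simps)
    qed
    show "\<bar>feedback_low (opA L f ye w)\<bar> \<le> (S * M + S * N + 1) * hnorm L w" if w: "w \<in> domA L \<alpha>" for w
    proof -
      have "\<bar>feedback_low (opA L f ye w)\<bar> \<le> S * (N * hnorm L w)" using N(2)[OF w] by (rule *)
      also have "\<dots> \<le> S * (N * hnorm L w) + (S * M + 1) * hnorm L w" using S M by simp
      finally show ?thesis by (simp add: algebra_simps)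
    qed
  qed
qed

text \<open>Contains \<xi> = \<zeta> - tail in place of \<zeta>, since \<xi> is the variable that
  the stability property bounds.\<close>

definition state_size :: "state \<Rightarrow> real \<Rightarrow> real \<Rightarrow> real" where
  "state_size w \<zeta> v = hnorm L w + \<bar>\<zeta> - tail w\<bar> + \<bar>v\<bar>"

lemma state_size_ge: "hnorm L w \<le> state_size w \<zeta> v" "\<bar>\<zeta> - tail w\<bar> \<le> state_size w \<zeta> v" "\<bar>v\<bar> \<le> state_size w \<zeta> v"
  "0 \<le> state_size w \<zeta> v"
  by (simp_all add: state_size_def)

text \<open>A global classical solution with its time derivatives as explicit arguments and the
  bound on w^1 built in, so that the estimates can quantify over all of them at once.\<close>

definition trajectory where
  "trajectory zr W \<zeta> v W' \<zeta>' v' \<longleftrightarrow>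
     has_hderiv_on L {0..} W W' \<and>
     (\<forall>t\<in>{0..}. W t \<in> domA L \<alpha> \<and> W' t \<in> hspace L \<and> bounded_by_one (W t) \<and>
       (\<zeta> has_real_derivative \<zeta>' t) (at t within {0..}) \<and>
       (v has_real_derivative v' t) (at t within {0..}) \<and>
       heq L (W' t) (opA L f ye (W t) + hscale (of_real (v t)) (avec L \<alpha>)
          + hscale (of_real (v' t)) (bvec L \<alpha>) + (0, residual f ye (fst (W t)))) \<and>
       complex_of_real (\<zeta>' t) = dx L (fst (W t)) 0 - of_real (zr t) \<and>
       v' t = vec_index (K *\<^sub>v Xvec L e fd lam n0 (W t) (\<zeta> t) (v t)) 0)"

text \<open>\<open>G\<close> collects everything besides A W in the evolution equation, and
  \<open>Gd\<close> is its time derivative in the weak sense of coefficients. The reference appears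
  in \<zeta>', hence in v'' but not in v'; since \<open>G\<close> contains v' and \<open>Gd\<close>
  contains v'', no derivative of \<open>zr\<close> arises.\<close>

lemma trajectory_forcing:
  "\<exists>C>0. \<forall>zr W \<zeta> v W' \<zeta>' v'. trajectory zr W \<zeta> v W' \<zeta>' v' \<longrightarrow>
    (\<exists>G Gd. \<forall>t\<in>{0..}. G t \<in> hspace L \<and> Gd t \<in> hspace L \<and> heq L (W' t) (opA L f ye (W t) + G t) \<and>
      hnorm L (G t) \<le> C * state_size (W t) (\<zeta> t) (v t) \<and>
      hnorm L (Gd t) \<le> C * (state_size (W t) (\<zeta> t) (v t) + \<bar>zr t\<bar>) \<and>
      (\<forall>k. ((\<lambda>s. cf (G s) k) has_vector_derivative cf (Gd t) k) (at t within {0..})))"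
proof -
  obtain P where P: "P > 0" "\<And>w. w \<in> hspace L \<Longrightarrow> \<bar>feedback_low w\<bar> \<le> P * hnorm L w"
    "\<And>w. w \<in> domA L \<alpha> \<Longrightarrow> \<bar>feedback_low (opA L f ye w)\<bar> \<le> P * hnorm L w"
    using feedback_low_bounded by blast
  obtain R1 where R1: "R1 \<ge> 0" "\<And>w. w \<in> hspace L \<Longrightarrow> bounded_by_one w \<Longrightarrow> hnorm L (res w) \<le> R1 * hnorm L w"
    using hnorm_res_le by blast
  obtain R2 where R2: "R2 \<ge> 0" "\<And>w w'. w \<in> hspace L \<Longrightarrow> w' \<in> hspace L \<Longrightarrow> bounded_by_one w \<Longrightarrow>
      hnorm L (res_deriv w w') \<le> R2 * hnorm L (0, fst w')"
    using hnorm_res_deriv_le by blast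
  obtain T where T: "T > 0" "\<And>w. w \<in> hspace L \<Longrightarrow> \<bar>tail w\<bar> \<le> T * hnorm L w"
    using tail_bounded by blast
  obtain S where S: "S > 0" "\<And>w. w \<in> hspace L \<Longrightarrow> cmod (\<Sum>k\<in>low. dx L (fst (e k)) 0 * cf w k) \<le> S * hnorm L w"
    using low_trace_bounded by blast
  obtain M where M: "M > 0" "\<And>w k. w \<in> hspace L \<Longrightarrow> cmod (cf w k) \<le> M * hnorm L w"
    using cf_bounded by blast
  define a b where "a = avec L \<alpha>" and "b = bvec L \<alpha>"
  have ab: "a \<in> hspace L" "b \<in> hspace L" unfolding a_def b_def using L_nonneg by (auto intro: avec_hspace bvec_hspace)
  define ca cb a2 where "ca = hnorm L a" and "cb = hnorm L b" and "a2 = hnorm L (0, fst a)"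
  have pos1: "ca \<ge> 0" "cb \<ge> 0" "a2 \<ge> 0" by (auto simp: ca_def cb_def a2_def)
  \<comment> \<open>\<open>k1\<close>, \<open>g\<close>, \<open>k2\<close>, \<open>g2\<close> will
    bound v', G, v'' and G', each built from earlier ones. The 1 inside \<open>k2\<close> pays for
    the reference contained in \<zeta>'.\<close>
  define k1 where "k1 = \<bar>K_first\<bar> + P + \<bar>K_last\<bar>"
  define g where "g = ca + cb * k1 + R1"
  define k2 where "k2 = \<bar>K_first\<bar> * k1 + (P + P * g) + \<bar>K_last\<bar> * (S + 1 + T * g)"
  define g2 where "g2 = ca * k1 + cb * k2 + R2 * (1 + a2)"
  have pos2: "k1 \<ge> 0" "g \<ge> 0" using P(1) R1(1) pos1 by (auto simp: k1_def g_def)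
  have pos3: "k2 \<ge> 0" using P(1) S(1) T(1) pos2 by (auto simp: k2_def)
  have pos4: "g2 \<ge> 0" using R2(1) pos1 pos2 pos3 by (auto simp: g2_def)
  show ?thesis
  proof (intro exI[of _ "g + g2 + 1"] conjI allI impI)
    show "g + g2 + 1 > 0" using pos2 pos4 by linarith
    fix zr W \<zeta> v W' \<zeta>' v' assume tr: "trajectory zr W \<zeta> v W' \<zeta>' v'"
    define N where "N t = state_size (W t) (\<zeta> t) (v t)" for t
    have N: "hnorm L (W t) \<le> N t" "\<bar>\<zeta> t - tail (W t)\<bar> \<le> N t" "\<bar>v t\<bar> \<le> N t" "0 \<le> N t" for t
      unfolding N_def by (rule state_size_ge)+
    have hd: "has_hderiv_on L {0..} W W'" using tr by (simp add: trajectory_def)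
    have D: "W t \<in> domA L \<alpha>" and W': "W' t \<in> hspace L" and one: "bounded_by_one (W t)"
      and d\<zeta>: "(\<zeta> has_real_derivative \<zeta>' t) (at t within {0..})"
      and dv: "(v has_real_derivative v' t) (at t within {0..})"
      and eq: "heq L (W' t) (opA L f ye (W t) + hscale (of_real (v t)) a + hscale (of_real (v' t)) b + res (W t))"
      and z': "complex_of_real (\<zeta>' t) = dx L (fst (W t)) 0 - of_real (zr t)"
      and v'_eq: "v' t = K_first * v t + feedback_low (W t) + K_last * (\<zeta> t - tail (W t))"
      if "t \<in> {0..}" for t
      using tr that unfolding trajectory_def a_def b_def feedback_eq by blast+
    have Wh: "W t \<in> hspace L" if "t \<in> {0..}" for t using D[OF that] by (rule domAD)
    \<comment> \<open>A classical solution only has v' continuous. The feedback law expresses v'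
      through differentiable quantities and so supplies this derivative.\<close>
    define v'' where "v'' t = K_first * v' t + feedback_low (W' t) + K_last * (\<zeta>' t - tail (W' t))" for t
    define G where "G t = hscale (of_real (v t)) a + hscale (of_real (v' t)) b + res (W t)" for t
    define Gd where "Gd t = hscale (of_real (v' t)) a + hscale (of_real (v'' t)) b + res_deriv (W t) (W' t)" for t
    show "\<exists>G Gd. \<forall>t\<in>{0..}. G t \<in> hspace L \<and> Gd t \<in> hspace L \<and> heq L (W' t) (opA L f ye (W t) + G t) \<and>
      hnorm L (G t) \<le> (g + g2 + 1) * state_size (W t) (\<zeta> t) (v t) \<and>
      hnorm L (Gd t) \<le> (g + g2 + 1) * (state_size (W t) (\<zeta> t) (v t) + \<bar>zr t\<bar>) \<and>
      (\<forall>k. ((\<lambda>s. cf (G s) k) has_vector_derivative cf (Gd t) k) (at t within {0..}))"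
    proof (rule exI[of _ G], rule exI[of _ Gd], intro ballI conjI allI)
      fix t :: real assume t: "t \<in> {0..}"
      note Wt = Wh[OF t] and W't = W'[OF t]
      note Rt = res_hspace[OF Wt] and Rdt = res_deriv_hspace[OF Wt W't] and At = opA_hspace[OF D[OF t]]
      show Gh: "G t \<in> hspace L" unfolding G_def by (intro hspace_add hspace_scale ab Rt)
      show Gdh: "Gd t \<in> hspace L" unfolding Gd_def by (intro hspace_add hspace_scale ab Rdt)
      show heqG: "heq L (W' t) (opA L f ye (W t) + G t)"
        using eq[OF t] unfolding G_def by (simp only: add.assoc)
      have v'_le: "\<bar>v' t\<bar> \<le> k1 * N t"
      proof -
        have "\<bar>feedback_low (W t)\<bar> \<le> P * N t"
          using P(2)[OF Wt] N(1)[of t] P(1) by (meson mult_left_mono less_imp_le order_trans)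
        moreover have "\<bar>K_first * v t\<bar> \<le> \<bar>K_first\<bar> * N t" "\<bar>K_last * (\<zeta> t - tail (W t))\<bar> \<le> \<bar>K_last\<bar> * N t"
          using N(2,3)[of t] by (simp_all add: abs_mult mult_left_mono)
        ultimately show ?thesis unfolding v'_eq[OF t] k1_def distrib_right by linarith
      qed
      define \<rho> where "\<rho> = hnorm L (res (W t))"
      have Rle: "\<rho> \<le> R1 * N t"
        unfolding \<rho>_def using R1(2)[OF Wt one[OF t]] N(1)[of t] R1(1) by (meson mult_left_mono order_trans)
      have G_le: "hnorm L (G t) \<le> g * N t"
      proof -
        have "hnorm L (G t) \<le> hnorm L (hscale (of_real (v t)) a + hscale (of_real (v' t)) b) + \<rho>"
          unfolding G_def \<rho>_def by (intro hnorm_triangle hspace_add hspace_scale ab Rt)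
        also have "hnorm L (hscale (of_real (v t)) a + hscale (of_real (v' t)) b)
            \<le> hnorm L (hscale (of_real (v t)) a) + hnorm L (hscale (of_real (v' t)) b)"
          by (intro hnorm_triangle hspace_scale ab)
        also have "\<dots> = \<bar>v t\<bar> * ca + \<bar>v' t\<bar> * cb" by (simp add: hnorm_scale ab ca_def cb_def)
        also have "\<dots> \<le> N t * ca + (k1 * N t) * cb"
          using N(3)[of t] v'_le pos1 by (intro add_mono mult_right_mono) auto
        finally show ?thesis using Rle by (simp add: g_def algebra_simps)
      qed
      \<comment> \<open>In the first component of the evolution equation neither \<open>b\<close>
        nor the residual contributes, which leaves the second component of W plus v times the first
        component of \<open>a\<close>.\<close>
      have fst_le: "hnorm L (0, fst (W' t)) \<le> (1 + a2) * N t"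
      proof -
        have fa: "fst a \<in> L2 L" by (rule fst_L2[OF ab(1)])
        have sW: "snd (W t) \<in> L2 L" by (rule hspaceD(2)[OF Wt])
        have "AE x in lebesgue_on {0..L}. fst (W' t) x = snd (W t) x + of_real (v t) * fst a x"
          using AE_in_Icc
        proof eventually_elim
          case (elim x)
          then show ?case using eq[OF t] by (simp add: heq_def opA_def b_def bvec_def)
        qed
        then have "hnorm L (0, fst (W' t)) = hnorm L (0, \<lambda>x. snd (W t) x + of_real (v t) * fst a x)"
          by (intro hnorm_zero_pair_cong fst_L2[OF W't] L2_add L2_scale fa sW)
        also have "(0 :: real \<Rightarrow> complex, \<lambda>x. snd (W t) x + of_real (v t) * fst a x)
            = (0, snd (W t)) + hscale (of_real (v t)) (0, fst a)"
          by (simp add: prod_eq_iff fun_eq_iff)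
        also have "hnorm L \<dots> \<le> hnorm L (0, snd (W t)) + hnorm L (hscale (of_real (v t)) (0, fst a))"
          by (intro hnorm_triangle hspace_scale zero_pair_hspace fa sW)
        also have "\<dots> = hnorm L (0, snd (W t)) + \<bar>v t\<bar> * a2"
          by (simp add: hnorm_scale zero_pair_hspace fa a2_def)
        also have "\<dots> \<le> N t + N t * a2"
          using hnorm_components_le(2)[OF Wt] N(1,3)[of t] pos1 by (intro add_mono mult_right_mono) auto
        finally show ?thesis by (simp add: zero_fun_def algebra_simps)
      qed
      have Rd_le: "hnorm L (res_deriv (W t) (W' t)) \<le> R2 * ((1 + a2) * N t)"
        using R2(2)[OF Wt W't one[OF t]] fst_le R2(1) by (meson mult_left_mono order_trans)
      have v''_le: "\<bar>v'' t\<bar> \<le> k2 * (N t + \<bar>zr t\<bar>)"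
      proof -
        have 1: "\<bar>feedback_low (W' t)\<bar> \<le> P * N t + P * (g * N t)"
        proof -
          have "feedback_low (W' t) = feedback_low (opA L f ye (W t)) + feedback_low (G t)"
            using feedback_low_cong[OF W't hspace_add[OF At Gh] heqG] feedback_low_add[OF At Gh] by simp
          moreover have "\<bar>feedback_low (opA L f ye (W t))\<bar> \<le> P * N t"
            using P(3)[OF D[OF t]] N(1)[of t] P(1) by (meson mult_left_mono less_imp_le order_trans)
          moreover have "\<bar>feedback_low (G t)\<bar> \<le> P * (g * N t)"
            using P(2)[OF Gh] G_le P(1) by (meson mult_left_mono less_imp_le order_trans)
          ultimately show ?thesis by linarith
        qed
        \<comment> \<open>the trace in \<open>\<zeta>'\<close> is not bounded by the state, but \<open>tail (\<A> W)\<close> cancels it up to low modes\<close>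
        have 2: "\<bar>\<zeta>' t - tail (W' t)\<bar> \<le> S * N t + \<bar>zr t\<bar> + T * (g * N t)"
        proof -
          let ?s = "\<Sum>k\<in>low. dx L (fst (e k)) 0 * cf (W t) k"
          have "tail (W' t) = tail (opA L f ye (W t)) + tail (G t)"
            using tail_cong[OF W't hspace_add[OF At Gh] heqG] tail_add[OF At Gh] by simp
          then have "\<zeta>' t - tail (W' t) = Re ?s - zr t - tail (G t)"
            using arg_cong[OF z'[OF t], of Re] tail_opA[OF D[OF t]] by simp
          moreover have "\<bar>Re ?s\<bar> \<le> S * N t"
            using order_trans[OF abs_Re_le_cmod S(2)[OF Wt]] N(1)[of t] S(1)
            by (meson mult_left_mono less_imp_le order_trans)
          moreover have "\<bar>tail (G t)\<bar> \<le> T * (g * N t)"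
            using T(2)[OF Gh] G_le T(1) by (meson mult_left_mono less_imp_le order_trans)
          ultimately show ?thesis by linarith
        qed
        have 3: "\<bar>K_first * v' t\<bar> \<le> \<bar>K_first\<bar> * (k1 * N t)"
          using v'_le by (simp add: abs_mult mult_left_mono)
        have 4: "\<bar>K_last * (\<zeta>' t - tail (W' t))\<bar> \<le> \<bar>K_last\<bar> * (S * N t + \<bar>zr t\<bar> + T * (g * N t))"
          using 2 by (simp add: abs_mult mult_left_mono)
        have "\<bar>v'' t\<bar> \<le> \<bar>K_first\<bar> * (k1 * N t) + (P * N t + P * (g * N t)) + \<bar>K_last\<bar> * (S * N t + \<bar>zr t\<bar> + T * (g * N t))"
          unfolding v''_def using 1 3 4 by linarith
        also have "\<dots> = k2 * N t - \<bar>K_last\<bar> * N t + \<bar>K_last\<bar> * \<bar>zr t\<bar>"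
          by (simp add: k2_def algebra_simps)
        also have "\<dots> \<le> k2 * N t + k2 * \<bar>zr t\<bar>"
        proof -
          have "k2 = \<bar>K_last\<bar> + (\<bar>K_first\<bar> * k1 + (P + P * g) + \<bar>K_last\<bar> * (S + T * g))"
            by (simp add: k2_def algebra_simps)
          moreover have "0 \<le> \<bar>K_first\<bar> * k1 + (P + P * g) + \<bar>K_last\<bar> * (S + T * g)"
            using P(1) S(1) T(1) pos2 by auto
          ultimately have "\<bar>K_last\<bar> \<le> k2" by linarith
          then have "\<bar>K_last\<bar> * \<bar>zr t\<bar> \<le> k2 * \<bar>zr t\<bar>" by (intro mult_right_mono) auto
          moreover have "0 \<le> \<bar>K_last\<bar> * N t" using N(4)[of t] by simp
          ultimately show ?thesis by linarith
        qed
        finally show ?thesis by (simp add: distrib_left)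
      qed
      have Gd_le: "hnorm L (Gd t) \<le> g2 * (N t + \<bar>zr t\<bar>)"
      proof -
        have "hnorm L (Gd t) \<le> hnorm L (hscale (of_real (v' t)) a + hscale (of_real (v'' t)) b) + hnorm L (res_deriv (W t) (W' t))"
          unfolding Gd_def by (intro hnorm_triangle hspace_add hspace_scale ab Rdt)
        also have "hnorm L (hscale (of_real (v' t)) a + hscale (of_real (v'' t)) b)
            \<le> hnorm L (hscale (of_real (v' t)) a) + hnorm L (hscale (of_real (v'' t)) b)"
          by (intro hnorm_triangle hspace_scale ab)
        also have "\<dots> = \<bar>v' t\<bar> * ca + \<bar>v'' t\<bar> * cb" by (simp add: hnorm_scale ab ca_def cb_def)
        also have "\<dots> \<le> (k1 * (N t + \<bar>zr t\<bar>)) * ca + (k2 * (N t + \<bar>zr t\<bar>)) * cb"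
        proof (intro add_mono mult_right_mono pos1 v''_le)
          have "k1 * N t \<le> k1 * (N t + \<bar>zr t\<bar>)" using pos2 by (intro mult_left_mono) auto
          then show "\<bar>v' t\<bar> \<le> k1 * (N t + \<bar>zr t\<bar>)" using v'_le by linarith
        qed
        finally have "hnorm L (Gd t) \<le> (k1 * (N t + \<bar>zr t\<bar>)) * ca + (k2 * (N t + \<bar>zr t\<bar>)) * cb + hnorm L (res_deriv (W t) (W' t))"
          by simp
        moreover have "R2 * ((1 + a2) * N t) \<le> R2 * ((1 + a2) * (N t + \<bar>zr t\<bar>))"
          using R2(1) pos1 by (intro mult_left_mono) auto
        ultimately have "hnorm L (Gd t) \<le> (k1 * (N t + \<bar>zr t\<bar>)) * ca + (k2 * (N t + \<bar>zr t\<bar>)) * cb + R2 * ((1 + a2) * (N t + \<bar>zr t\<bar>))"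
          using Rd_le by linarith
        then show ?thesis by (simp add: g2_def algebra_simps)
      qed
      show "hnorm L (G t) \<le> (g + g2 + 1) * state_size (W t) (\<zeta> t) (v t)"
        using order_trans[OF G_le mult_right_mono[of g "g + g2 + 1" "N t"]] N(4)[of t] pos4 by (simp add: N_def)
      show "hnorm L (Gd t) \<le> (g + g2 + 1) * (state_size (W t) (\<zeta> t) (v t) + \<bar>zr t\<bar>)"
        using order_trans[OF Gd_le mult_right_mono[of g2 "g + g2 + 1" "N t + \<bar>zr t\<bar>"]] N(4)[of t] pos2 by (simp add: N_def)
      fix k
      have dtail: "((\<lambda>s. tail (W s)) has_vector_derivative tail (W' t)) (at t within {0..})"
        by (rule hderiv_functional[OF hd, where C=T]) (auto simp: Wh W' t tail_diff tail_scale T(2) simp del: atLeast_iff)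
      have dlow: "((\<lambda>s. feedback_low (W s)) has_vector_derivative feedback_low (W' t)) (at t within {0..})"
        by (rule hderiv_functional[OF hd, where C=P]) (auto simp: Wh W' t feedback_low_diff feedback_low_scale P(2) simp del: atLeast_iff)
      have dres: "((\<lambda>s. cf (res (W s)) k) has_vector_derivative cf (res_deriv (W t) (W' t)) k) (at t within {0..})"
      proof (rule hderiv_functional[where \<Phi>="\<lambda>w. cf w k" and C=M])
        show "has_hderiv_on L {0..} (\<lambda>s. res (W s)) (\<lambda>s. res_deriv (W s) (W' s))"
          by (rule res_has_hderiv[OF hd Wh W' one])
      qed (use t in \<open>simp_all add: Wh W' res_hspace res_deriv_hspace hinner_diff_left hinner_scale_left fd_hspace M(2) scaleR_conv_of_real del: atLeast_iff\<close>)
      note dv_vec = dv[OF t, unfolded has_real_derivative_iff_has_vector_derivative]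
      note dz_vec = d\<zeta>[OF t, unfolded has_real_derivative_iff_has_vector_derivative]
      have dv': "(v' has_vector_derivative v'' t) (at t within {0..})"
      proof (rule has_vector_derivative_transform[OF t v'_eq])
        show "((\<lambda>s. K_first * v s + feedback_low (W s) + K_last * (\<zeta> s - tail (W s))) has_vector_derivative v'' t) (at t within {0..})"
          unfolding v''_def
          by (intro has_vector_derivative_add has_vector_derivative_diff has_vector_derivative_mult_right dv_vec dz_vec dlow dtail)
      qed
      have cf_G: "cf (G s) k = of_real (v s) * cf a k + of_real (v' s) * cf b k + cf (res (W s)) k" if "s \<in> {0..}" for s
        unfolding G_def using ab res_hspace[OF Wh[OF that]]
        by (simp add: hinner_add_left hinner_scale_left fd_hspace hspace_add hspace_scale)
      have cf_Gd: "cf (Gd t) k = of_real (v' t) * cf a k + of_real (v'' t) * cf b k + cf (res_deriv (W t) (W' t)) k"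
        unfolding Gd_def using ab Rdt
        by (simp add: hinner_add_left hinner_scale_left fd_hspace hspace_add hspace_scale)
      show "((\<lambda>s. cf (G s) k) has_vector_derivative cf (Gd t) k) (at t within {0..})"
        unfolding cf_Gd
      proof (rule has_vector_derivative_transform[OF t cf_G])
        show "((\<lambda>s. of_real (v s) * cf a k + of_real (v' s) * cf b k + cf (res (W s)) k) has_vector_derivative
            of_real (v' t) * cf a k + of_real (v'' t) * cf b k + cf (res_deriv (W t) (W' t)) k) (at t within {0..})"
          by (intro has_vector_derivative_add has_vector_derivative_mult_left has_vector_derivative_of_real dres dv[OF t]
              dv'[unfolded has_real_derivative_iff_has_vector_derivative[symmetric]])
      qed
    qed
  qed
qed

end

section \<open>Exponential estimates\<close>

text \<open>The final time \<open>t\<close> is fixed, so the forcing weight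
  \<open>exp (2 * \<nu> * (t - s))\<close> equals 1 at \<open>s = t\<close>. Subtracting a
  particular solution and multiplying by the integrating factor leaves a decreasing function
  \<open>h\<close>. Both rates lie strictly below \<mu>, which excludes resonance and makes the
  coefficients of the particular solution nonnegative.\<close>

lemma exponential_comparison:
  fixes E E' :: "real \<Rightarrow> real"
  assumes dE: "\<And>s. 0 \<le> s \<Longrightarrow> (E has_real_derivative E' s) (at s within {0..})"
    and t: "0 \<le> t" and ab: "a \<ge> 0" "b \<ge> 0" and rates: "\<kappa> < \<mu>" "\<nu> < \<mu>"
    and le: "\<And>s. 0 \<le> s \<Longrightarrow> s \<le> t \<Longrightarrow> E' s \<le> - 2 * \<mu> * E s + a * exp (- 2 * \<kappa> * s) + b * exp (2 * \<nu> * (t - s))"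
  shows "E t \<le> exp (- 2 * \<mu> * t) * E 0 + a / (2 * (\<mu> - \<kappa>)) * exp (- 2 * \<kappa> * t) + b / (2 * (\<mu> - \<nu>))"
proof -
  \<comment> \<open>\<open>p exp (- 2 \<kappa> s) + q exp (2 \<nu> (t - s))\<close> solves the equation with equality\<close>
  define p where "p = a / (2 * (\<mu> - \<kappa>))"
  define q where "q = b / (2 * (\<mu> - \<nu>))"
  have pq: "p \<ge> 0" "q \<ge> 0" "2 * (\<mu> - \<kappa>) * p = a" "2 * (\<mu> - \<nu>) * q = b"
    using ab rates by (auto simp: p_def q_def)
  define h where "h s = exp (2 * \<mu> * s) * (E s - p * exp (- 2 * \<kappa> * s) - q * exp (2 * \<nu> * (t - s)))" for s
  define h' where "h' s = exp (2 * \<mu> * s) * (E' s + 2 * \<mu> * E s - a * exp (- 2 * \<kappa> * s) - b * exp (2 * \<nu> * (t - s)))" for s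
  have dh: "(h has_real_derivative h' s) (at s within {0..})" if "0 \<le> s" for s
    unfolding h_def
    by (rule derivative_eq_intros dE that refl)+
       (simp add: h'_def pq(3)[symmetric] pq(4)[symmetric] algebra_simps)
  have "h t \<le> h 0"
  proof (rule DERIV_nonpos_imp_decreasing_open[OF t])
    fix s assume s: "0 < s" "s < t"
    have "(h has_real_derivative h' s) (at s)"
      using dh[of s] s by (simp add: at_within_interior[of s "{0..}"] interior_real_atLeast)
    moreover have "h' s \<le> 0"
      using le[of s] s unfolding h'_def by (intro mult_nonneg_nonpos) auto
    ultimately show "\<exists>y. DERIV h s :> y \<and> y \<le> 0" by blast
  next
    have "continuous_on {0..} h" using dh by (intro DERIV_continuous_on) auto
    then show "continuous_on {0..t} h" by (rule continuous_on_subset) auto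
  qed
  also have "h 0 \<le> E 0"
  proof -
    have "0 \<le> p + q * exp (2 * \<nu> * t)" using pq(1,2) by simp
    then show ?thesis by (simp add: h_def)
  qed
  finally have "exp (- 2 * \<mu> * t) * h t \<le> exp (- 2 * \<mu> * t) * E 0" by (intro mult_left_mono) auto
  also have "exp (- 2 * \<mu> * t) * h t = E t - p * exp (- 2 * \<kappa> * t) - q"
    by (simp add: h_def mult.assoc[symmetric] exp_add[symmetric])
  finally show ?thesis by (simp add: p_def q_def)
qed

text \<open>Young's inequality with weight 1 - \<mu>: the gap between the rate 1 guaranteed by the
  eigenvalue and the rate \<mu> to be kept absorbs the mixed term.\<close>

lemma mode_energy_rate:
  assumes "Re l < - 1" "\<mu> < 1"
  shows "2 * (Re z * Re (l * z + h) + Im z * Im (l * z + h)) \<le> - 2 * \<mu> * (cmod z)\<^sup>2 + 1 / (2 * (1 - \<mu>)) * (cmod h)\<^sup>2"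
proof -
  define d where "d = 1 - \<mu>"
  have d: "d > 0" using assms by (simp add: d_def)
  have "2 * (Re z * Re (l * z + h) + Im z * Im (l * z + h)) = 2 * Re l * (cmod z)\<^sup>2 + 2 * Re (cnj z * h)"
    unfolding cmod_power2 by (simp add: power2_eq_square algebra_simps)
  also have "\<dots> \<le> - 2 * (cmod z)\<^sup>2 + 2 * (cmod z * cmod h)"
  proof (intro add_mono)
    show "2 * Re l * (cmod z)\<^sup>2 \<le> - 2 * (cmod z)\<^sup>2" using assms(1) by (intro mult_right_mono) auto
    show "2 * Re (cnj z * h) \<le> 2 * (cmod z * cmod h)"
      using complex_Re_le_cmod[of "cnj z * h"] by (simp add: norm_mult)
  qed
  also have "2 * (cmod z * cmod h) \<le> 2 * d * (cmod z)\<^sup>2 + 1 / (2 * d) * (cmod h)\<^sup>2"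
  proof -
    have "0 \<le> (2 * d * cmod z - cmod h)\<^sup>2 / (2 * d)" using d by simp
    also have "\<dots> = 2 * d * (cmod z)\<^sup>2 - 2 * (cmod z * cmod h) + 1 / (2 * d) * (cmod h)\<^sup>2"
      using d by (simp add: power2_diff field_simps power2_eq_square)
    finally show ?thesis by simp
  qed
  finally show ?thesis by (simp add: d_def algebra_simps)
qed

lemma power2_sum_le: "(x + y :: real)\<^sup>2 \<le> 2 * x\<^sup>2 + 2 * y\<^sup>2"
proof -
  have "0 \<le> (x - y)\<^sup>2" by simp
  then show ?thesis by (simp add: power2_eq_square algebra_simps)
qed

section \<open>Decay of the time derivative and the trace bound\<close>

context closed_loop
begin

text \<open>Termwise differentiation needs a finite \<open>I\<close>, while the Bessel bounds on
  \<open>Gd\<close> and on W'(0) make the constant independent of \<open>I\<close>. The reference is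
  represented by an abstract \<open>S\<close>, so that the argument rests on its growth law and not
  on the supremum formula.\<close>

lemma modal_energy_estimate:
  assumes \<kappa>: "0 < \<kappa>" "\<kappa> < 1" and \<eta>: "0 \<le> \<eta>" "\<eta> < 1" and c: "c \<ge> 0"
  shows "\<exists>C>0. \<forall>W W' G Gd D S.
    has_hderiv_on L {0..} W W' \<and> S 0 \<ge> 0 \<and>
    (\<forall>t\<in>{0..}. W t \<in> domA L \<alpha> \<and> W' t \<in> hspace L \<and> G t \<in> hspace L \<and> Gd t \<in> hspace L \<and>
      heq L (W' t) (opA L f ye (W t) + G t) \<and>
      (\<forall>k. ((\<lambda>s. cf (G s) k) has_vector_derivative cf (Gd t) k) (at t within {0..})) \<and>
      (hnorm L (Gd t))\<^sup>2 \<le> c * (exp (- 2 * \<kappa> * t) * D\<^sup>2 + S t)) \<and>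
    (\<forall>s t. 0 \<le> s \<longrightarrow> s \<le> t \<longrightarrow> S s \<le> exp (2 * (\<eta> * \<kappa>) * (t - s)) * S t) \<and>
    (hnorm L (W' 0))\<^sup>2 \<le> c * (D\<^sup>2 + S 0) \<longrightarrow>
    (\<forall>t\<ge>0. \<forall>I. finite I \<longrightarrow> I \<subseteq> high \<longrightarrow>
      (\<Sum>k\<in>I. (cmod (cf (W' t) k))\<^sup>2) \<le> C * (exp (- 2 * \<kappa> * t) * D\<^sup>2 + S t))"
proof -
  obtain M where M: "M > 0" "\<And>w I. w \<in> hspace L \<Longrightarrow> finite I \<Longrightarrow> (\<Sum>k\<in>I. (cmod (cf w k))\<^sup>2) \<le> (M * hnorm L w)\<^sup>2"
    using bessel by blast
  \<comment> \<open>Midway between \<kappa> and 1: above \<kappa>, so that forcing decaying at rate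
    \<kappa> is not resonant, and below 1, so that Young's inequality has room.\<close>
  define \<mu> where "\<mu> = (1 + \<kappa>) / 2"
  define \<nu> where "\<nu> = \<eta> * \<kappa>"
  have \<nu>: "0 \<le> \<nu>" "\<nu> \<le> \<kappa>" using \<kappa> \<eta> by (auto simp: \<nu>_def mult_left_le_one_le)
  have \<mu>: "\<kappa> < \<mu>" "\<nu> < \<mu>" "\<mu> < 1" "\<mu> > 0" using \<kappa> \<nu> by (auto simp: \<mu>_def)
  define c3 where "c3 = 1 / (2 * (1 - \<mu>)) * (M\<^sup>2 * c)"
  have c3: "c3 \<ge> 0" using \<mu> c by (simp add: c3_def)
  define c4 where "c4 = c3 / (2 * (\<mu> - \<kappa>))"
  have c4: "c4 \<ge> 0" using \<mu> c3 by (simp add: c4_def)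
  have c4': "c3 / (2 * (\<mu> - \<nu>)) \<le> c4"
    unfolding c4_def using \<mu> \<nu> c3 by (intro divide_left_mono) auto
  define c5 where "c5 = M\<^sup>2 * c"
  have c5: "c5 \<ge> 0" using c by (simp add: c5_def)
  show ?thesis
  proof (intro exI[of _ "c4 + c5 + 1"] conjI allI impI; (elim conjE)?)
    show "c4 + c5 + 1 > 0" using c4 c5 by linarith
    fix W W' G Gd D and S :: "real \<Rightarrow> real" and t :: real and I :: "int set"
    assume hd: "has_hderiv_on L {0..} W W'" and S0: "S 0 \<ge> 0"
      and tr: "\<forall>t\<in>{0..}. W t \<in> domA L \<alpha> \<and> W' t \<in> hspace L \<and> G t \<in> hspace L \<and> Gd t \<in> hspace L \<and>
        heq L (W' t) (opA L f ye (W t) + G t) \<and>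
        (\<forall>k. ((\<lambda>s. cf (G s) k) has_vector_derivative cf (Gd t) k) (at t within {0..})) \<and>
        (hnorm L (Gd t))\<^sup>2 \<le> c * (exp (- 2 * \<kappa> * t) * D\<^sup>2 + S t)"
      and S: "\<forall>s t. 0 \<le> s \<longrightarrow> s \<le> t \<longrightarrow> S s \<le> exp (2 * (\<eta> * \<kappa>) * (t - s)) * S t"
      and init: "(hnorm L (W' 0))\<^sup>2 \<le> c * (D\<^sup>2 + S 0)"
      and t: "0 \<le> t" and I: "finite I" "I \<subseteq> high"
    have D: "W s \<in> domA L \<alpha>" and W': "W' s \<in> hspace L" and G: "G s \<in> hspace L" and Gd: "Gd s \<in> hspace L"
      and eq: "heq L (W' s) (opA L f ye (W s) + G s)"
      and dG: "((\<lambda>s. cf (G s) k) has_vector_derivative cf (Gd s) k) (at s within {0..})"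
      and Gd_le: "(hnorm L (Gd s))\<^sup>2 \<le> c * (exp (- 2 * \<kappa> * s) * D\<^sup>2 + S s)"
      if "s \<in> {0..}" for s k
      using tr that by blast+
    have Wh: "W s \<in> hspace L" if "s \<in> {0..}" for s using D[OF that] by (rule domAD)
    \<comment> \<open>The coefficients of W' are differentiable because \<open>z_eq\<close> rewrites
      them as \<open>lam k\<close> times those of W plus those of G.\<close>
    define z where "z k s = cf (W' s) k" for k s
    have z_eq: "z k s = lam k * cf (W s) k + cf (G s) k" if s: "s \<in> {0..}" and k: "k \<in> high" for s k
    proof -
      have "z k s = cf (opA L f ye (W s) + G s) k"
        unfolding z_def using D[OF s] by (intro hinner_cong L_nonneg W'[OF s] eq[OF s] fd_hspace hspace_add G[OF s] opA_hspace)
      then show ?thesis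
        using cf_opA_high[OF k D[OF s]] opA_hspace[OF D[OF s]] G[OF s] by (simp add: hinner_add_left fd_hspace)
    qed
    have dz: "(z k has_vector_derivative (lam k * z k s + cf (Gd s) k)) (at s within {0..})"
      if s: "s \<in> {0..}" and k: "k \<in> high" for s k
    proof (rule has_vector_derivative_transform[OF s z_eq[OF _ k]])
      obtain B where B: "\<And>w. w \<in> hspace L \<Longrightarrow> cmod (cf w k) \<le> B * hnorm L w"
        using cf_bounded by blast
      have "((\<lambda>s. cf (W s) k) has_vector_derivative cf (W' s) k) (at s within {0..})"
      proof (rule hderiv_functional[where \<Phi>="\<lambda>w. cf w k" and C=B, OF hd])
      qed (use s in \<open>simp_all add: Wh W' hinner_diff_left hinner_scale_left fd_hspace B scaleR_conv_of_real del: atLeast_iff\<close>)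
      then show "((\<lambda>s. lam k * cf (W s) k + cf (G s) k) has_vector_derivative lam k * z k s + cf (Gd s) k) (at s within {0..})"
        unfolding z_def by (intro has_vector_derivative_add has_vector_derivative_mult_right dG[OF s])
    qed
    define E where "E s = (\<Sum>k\<in>I. (cmod (z k s))\<^sup>2)" for s
    define E' where "E' s = (\<Sum>k\<in>I. 2 * (Re (z k s) * Re (lam k * z k s + cf (Gd s) k)
        + Im (z k s) * Im (lam k * z k s + cf (Gd s) k)))" for s
    have dE: "(E has_real_derivative E' s) (at s within {0..})" if "0 \<le> s" for s
    proof -
      have "((\<lambda>s. \<Sum>k\<in>I. (Re (z k s))\<^sup>2 + (Im (z k s))\<^sup>2) has_real_derivative E' s) (at s within {0..})"
        unfolding E'_def
      proof (rule DERIV_sum)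
        fix k assume "k \<in> I"
        then have "(z k has_vector_derivative (lam k * z k s + cf (Gd s) k)) (at s within {0..})"
          using dz that I(2) by auto
        from bounded_linear.has_vector_derivative[OF bounded_linear_Re this]
          bounded_linear.has_vector_derivative[OF bounded_linear_Im this]
        have *: "((\<lambda>s. Re (z k s)) has_real_derivative Re (lam k * z k s + cf (Gd s) k)) (at s within {0..})"
          "((\<lambda>s. Im (z k s)) has_real_derivative Im (lam k * z k s + cf (Gd s) k)) (at s within {0..})"
          unfolding has_real_derivative_iff_has_vector_derivative .
        show "((\<lambda>s. (Re (z k s))\<^sup>2 + (Im (z k s))\<^sup>2) has_real_derivative
            2 * (Re (z k s) * Re (lam k * z k s + cf (Gd s) k) + Im (z k s) * Im (lam k * z k s + cf (Gd s) k))) (at s within {0..})"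
          by (rule derivative_eq_intros * refl)+ (simp add: algebra_simps)
      qed
      moreover have "E = (\<lambda>s. \<Sum>k\<in>I. (Re (z k s))\<^sup>2 + (Im (z k s))\<^sup>2)"
        by (simp add: fun_eq_iff E_def cmod_power2)
      ultimately show ?thesis by simp
    qed
    have E'_le: "E' s \<le> - 2 * \<mu> * E s + (c3 * D\<^sup>2) * exp (- 2 * \<kappa> * s) + (c3 * S t) * exp (2 * \<nu> * (t - s))"
      if s: "0 \<le> s" "s \<le> t" for s
    proof -
      have "E' s \<le> (\<Sum>k\<in>I. - 2 * \<mu> * (cmod (z k s))\<^sup>2 + 1 / (2 * (1 - \<mu>)) * (cmod (cf (Gd s) k))\<^sup>2)"
        unfolding E'_def using I(2) \<mu>(3) lam_stable by (intro sum_mono mode_energy_rate) auto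
      also have "\<dots> = - 2 * \<mu> * E s + 1 / (2 * (1 - \<mu>)) * (\<Sum>k\<in>I. (cmod (cf (Gd s) k))\<^sup>2)"
        by (simp only: sum.distrib E_def sum_distrib_left)
      also have "\<dots> \<le> - 2 * \<mu> * E s + 1 / (2 * (1 - \<mu>)) * (M\<^sup>2 * (c * (exp (- 2 * \<kappa> * s) * D\<^sup>2 + S s)))"
      proof (intro add_left_mono mult_left_mono)
        have "(\<Sum>k\<in>I. (cmod (cf (Gd s) k))\<^sup>2) \<le> M\<^sup>2 * (hnorm L (Gd s))\<^sup>2"
          using M(2)[OF Gd I(1), of s] s by (simp add: power_mult_distrib)
        also have "\<dots> \<le> M\<^sup>2 * (c * (exp (- 2 * \<kappa> * s) * D\<^sup>2 + S s))"
          using Gd_le[of s] s by (intro mult_left_mono) auto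
        finally show "(\<Sum>k\<in>I. (cmod (cf (Gd s) k))\<^sup>2) \<le> M\<^sup>2 * (c * (exp (- 2 * \<kappa> * s) * D\<^sup>2 + S s))" .
      qed (use \<mu> in auto)
      also have "\<dots> = - 2 * \<mu> * E s + (c3 * D\<^sup>2) * exp (- 2 * \<kappa> * s) + c3 * S s"
        by (simp add: c3_def algebra_simps)
      \<comment> \<open>The growth law replaces \<open>S s\<close> by the constant
        \<open>S t\<close> with an explicit weight, as the comparison with fixed final time
        requires.\<close>
      also have "c3 * S s \<le> c3 * (exp (2 * \<nu> * (t - s)) * S t)"
        using S s c3 by (intro mult_left_mono) (auto simp: \<nu>_def)
      finally show ?thesis by (simp add: algebra_simps)
    qed
    have St: "S 0 \<le> exp (2 * \<nu> * t) * S t" using S[rule_format, of 0 t] t by (simp add: \<nu>_def)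
    \<comment> \<open>\<open>S 0\<close> is nonnegative by assumption, and the growth law carries
      the sign over to time \<open>t\<close>.\<close>
    have St0: "S t \<ge> 0"
    proof -
      have "0 \<le> exp (2 * \<nu> * t) * S t" using S0 St by linarith
      then show ?thesis by (simp add: zero_le_mult_iff)
    qed
    have "E t \<le> exp (- 2 * \<mu> * t) * E 0 + (c3 * D\<^sup>2) / (2 * (\<mu> - \<kappa>)) * exp (- 2 * \<kappa> * t) + (c3 * S t) / (2 * (\<mu> - \<nu>))"
      using E'_le t c3 St0 \<mu> by (intro exponential_comparison[OF dE]) auto
    also have "(c3 * D\<^sup>2) / (2 * (\<mu> - \<kappa>)) * exp (- 2 * \<kappa> * t) = c4 * (exp (- 2 * \<kappa> * t) * D\<^sup>2)"
      by (simp add: c4_def)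
    also have "(c3 * S t) / (2 * (\<mu> - \<nu>)) \<le> c4 * S t"
      using mult_right_mono[OF c4' St0] by simp
    \<comment> \<open>Trading \<open>S 0\<close> for \<open>S t\<close> costs the factor exp(2 \<nu>
      t), which the decay exp(-2 \<mu> t) of the initial energy compensates since \<nu> <
      \<mu>.\<close>
    also have "exp (- 2 * \<mu> * t) * E 0 \<le> c5 * (exp (- 2 * \<kappa> * t) * D\<^sup>2 + S t)"
    proof -
      have "E 0 \<le> M\<^sup>2 * (hnorm L (W' 0))\<^sup>2"
        using M(2)[OF W' I(1), of 0] by (simp add: E_def z_def power_mult_distrib)
      also have "\<dots> \<le> M\<^sup>2 * (c * (D\<^sup>2 + S 0))" using init by (intro mult_left_mono) auto
      finally have "E 0 \<le> c5 * (D\<^sup>2 + S 0)" by (simp add: c5_def)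
      then have "exp (- 2 * \<mu> * t) * E 0 \<le> exp (- 2 * \<mu> * t) * (c5 * (D\<^sup>2 + S 0))"
        by (intro mult_left_mono) auto
      also have "\<dots> = c5 * (exp (- 2 * \<mu> * t) * D\<^sup>2 + exp (- 2 * \<mu> * t) * S 0)" by (simp add: algebra_simps)
      also have "\<dots> \<le> c5 * (exp (- 2 * \<kappa> * t) * D\<^sup>2 + S t)"
      proof (intro mult_left_mono add_mono c5 mult_right_mono)
        show "exp (- 2 * \<mu> * t) \<le> exp (- 2 * \<kappa> * t)" using \<mu> t by (simp add: mult_right_mono)
        have "exp (- 2 * \<mu> * t) * S 0 \<le> exp (- 2 * \<mu> * t) * (exp (2 * \<nu> * t) * S t)"
          using St by (intro mult_left_mono) auto
        also have "\<dots> = exp (- 2 * \<mu> * t + 2 * \<nu> * t) * S t" by (simp only: exp_add mult.assoc)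
        also have "\<dots> \<le> 1 * S t"
        proof (rule mult_right_mono[OF _ St0])
          have "\<nu> * t \<le> \<mu> * t" using \<mu>(2) t by (intro mult_right_mono) auto
          then show "exp (- 2 * \<mu> * t + 2 * \<nu> * t) \<le> 1" by simp
        qed
        finally show "exp (- 2 * \<mu> * t) * S 0 \<le> S t" by simp
      qed simp
      finally show ?thesis .
    qed
    finally have "E t \<le> (c4 + c5) * (exp (- 2 * \<kappa> * t) * D\<^sup>2 + S t)" by (simp add: algebra_simps)
    also have "\<dots> \<le> (c4 + c5 + 1) * (exp (- 2 * \<kappa> * t) * D\<^sup>2 + S t)"
      using St0 by (intro mult_right_mono) auto
    finally show "(\<Sum>k\<in>I. (cmod (cf (W' t) k))\<^sup>2) \<le> (c4 + c5 + 1) * (exp (- 2 * \<kappa> * t) * D\<^sup>2 + S t)"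
      by (simp add: E_def z_def)
  qed
qed

text \<open>\<open>D\<close> is required to dominate A W at time 0 because W'(0) equals A W(0) +
  G(0). The low coefficients of A W are bounded by the state, the high ones are those of W' minus
  those of G; together they give the norm of A W, and the graph norm gives the trace.\<close>

lemma trace_estimate:
  assumes \<kappa>: "0 < \<kappa>" "\<kappa> < 1" and \<eta>: "0 \<le> \<eta>" "\<eta> < 1" and c: "c \<ge> 0"
  shows "\<exists>C>0. \<forall>zr W \<zeta> v W' \<zeta>' v' D S.
    trajectory zr W \<zeta> v W' \<zeta>' v' \<and> 0 \<le> D \<and> hnorm L (opA L f ye (W 0)) \<le> D \<and>
    (\<forall>t\<ge>0. (state_size (W t) (\<zeta> t) (v t))\<^sup>2 \<le> c * (exp (- 2 * \<kappa> * t) * D\<^sup>2 + S t) \<and> \<bar>zr t\<bar>\<^sup>2 \<le> S t) \<and>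
    (\<forall>s t. 0 \<le> s \<longrightarrow> s \<le> t \<longrightarrow> S s \<le> exp (2 * (\<eta> * \<kappa>) * (t - s)) * S t) \<longrightarrow>
    (\<forall>t\<ge>0. (cmod (dx L (fst (W t)) 0))\<^sup>2 \<le> C * (exp (- 2 * \<kappa> * t) * D\<^sup>2 + S t))"
proof -
  obtain F where F: "F > 0" "\<And>zr W \<zeta> v W' \<zeta>' v'. trajectory zr W \<zeta> v W' \<zeta>' v' \<Longrightarrow>
    (\<exists>G Gd. \<forall>t\<in>{0..}. G t \<in> hspace L \<and> Gd t \<in> hspace L \<and> heq L (W' t) (opA L f ye (W t) + G t) \<and>
      hnorm L (G t) \<le> F * state_size (W t) (\<zeta> t) (v t) \<and>
      hnorm L (Gd t) \<le> F * (state_size (W t) (\<zeta> t) (v t) + \<bar>zr t\<bar>) \<and>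
      (\<forall>k. ((\<lambda>s. cf (G s) k) has_vector_derivative cf (Gd t) k) (at t within {0..})))"
    using trajectory_forcing by blast
  \<comment> \<open>Large enough for two bounds: G' costs F^2 (2 c + 2), and the squared norm of
    W'(0) costs 2 for A W(0) plus 2 F^2 c for G(0).\<close>
  define c' where "c' = 2 + F\<^sup>2 * (2 * c + 2)"
  have c': "c' \<ge> 0" using c by (simp add: c'_def)
  obtain A where A: "A > 0" and A': "\<And>W W' G Gd D S.
    has_hderiv_on L {0..} W W' \<and> S 0 \<ge> 0 \<and>
    (\<forall>t\<in>{0..}. W t \<in> domA L \<alpha> \<and> W' t \<in> hspace L \<and> G t \<in> hspace L \<and> Gd t \<in> hspace L \<and>
      heq L (W' t) (opA L f ye (W t) + G t) \<and>
      (\<forall>k. ((\<lambda>s. cf (G s) k) has_vector_derivative cf (Gd t) k) (at t within {0..})) \<and>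
      (hnorm L (Gd t))\<^sup>2 \<le> c' * (exp (- 2 * \<kappa> * t) * D\<^sup>2 + S t)) \<and>
    (\<forall>s t. 0 \<le> s \<longrightarrow> s \<le> t \<longrightarrow> S s \<le> exp (2 * (\<eta> * \<kappa>) * (t - s)) * S t) \<and>
    (hnorm L (W' 0))\<^sup>2 \<le> c' * (D\<^sup>2 + S 0) \<Longrightarrow>
    (\<forall>t\<ge>0. \<forall>I. finite I \<longrightarrow> I \<subseteq> high \<longrightarrow>
      (\<Sum>k\<in>I. (cmod (cf (W' t) k))\<^sup>2) \<le> A * (exp (- 2 * \<kappa> * t) * D\<^sup>2 + S t))"
    using modal_energy_estimate[OF \<kappa> \<eta> c'] by blast
  obtain M where M: "M > 0" "\<And>w I. w \<in> hspace L \<Longrightarrow> finite I \<Longrightarrow> (\<Sum>k\<in>I. (cmod (cf w k))\<^sup>2) \<le> (M * hnorm L w)\<^sup>2"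
    using bessel by blast
  obtain Cl where Cl: "Cl > 0" "\<And>w k. w \<in> domA L \<alpha> \<Longrightarrow> k \<in> low \<Longrightarrow> cmod (cf (opA L f ye w) k) \<le> Cl * hnorm L w"
    using cf_opA_low_bounded by blast
  obtain Cr where Cr: "Cr > 0" "\<And>w B. w \<in> hspace L \<Longrightarrow> B \<ge> 0 \<Longrightarrow>
      (\<And>I. finite I \<Longrightarrow> (\<Sum>k\<in>I. (cmod (cf w k))\<^sup>2) \<le> B\<^sup>2) \<Longrightarrow> hnorm L w \<le> Cr * B"
    using hnorm_le_coefficients by blast
  obtain Ct where Ct: "Ct \<ge> 0" "\<And>w. w \<in> domA L \<alpha> \<Longrightarrow> cmod (dx L (fst w) 0) \<le> Ct * (hnorm L (opA L f ye w) + hnorm L w)"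
    using trace_bounded by blast
  \<comment> \<open>The summands stem from the low modes of A W, the high modes of W' and the high
    modes of G; the factors 2 come from squaring a sum of two terms.\<close>
  define c7 where "c7 = real (card low) * (Cl\<^sup>2 * c) + 2 * A + 2 * (M\<^sup>2 * (F\<^sup>2 * c))"
  have c7: "c7 \<ge> 0" using c A by (auto simp: c7_def)
  define c8 where "c8 = (Ct * (Cr * sqrt c7 + sqrt c))\<^sup>2"
  have c8: "c8 \<ge> 0" by (simp add: c8_def)
  show ?thesis
  proof (intro exI[of _ "c8 + 1"] conjI allI impI; (elim conjE)?)
    show "c8 + 1 > 0" using c8 by linarith
    fix zr W \<zeta> v W' \<zeta>' v' and D :: real and S :: "real \<Rightarrow> real" and t :: real
    assume tr: "trajectory zr W \<zeta> v W' \<zeta>' v'" and D: "0 \<le> D" "hnorm L (opA L f ye (W 0)) \<le> D"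
      and b: "\<forall>t\<ge>0. (state_size (W t) (\<zeta> t) (v t))\<^sup>2 \<le> c * (exp (- 2 * \<kappa> * t) * D\<^sup>2 + S t) \<and> \<bar>zr t\<bar>\<^sup>2 \<le> S t"
      and S: "\<forall>s t. 0 \<le> s \<longrightarrow> s \<le> t \<longrightarrow> S s \<le> exp (2 * (\<eta> * \<kappa>) * (t - s)) * S t"
      and t: "0 \<le> t"
    define N where "N t = state_size (W t) (\<zeta> t) (v t)" for t
    define Q where "Q t = exp (- 2 * \<kappa> * t) * D\<^sup>2 + S t" for t
    have S0: "S s \<ge> 0" if "s \<ge> 0" for s using b that by (meson order_trans zero_le_power2)
    have N: "0 \<le> N s" "(N s)\<^sup>2 \<le> c * Q s" "\<bar>zr s\<bar>\<^sup>2 \<le> S s" if "s \<ge> 0" for s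
      using b that state_size_ge(4) by (auto simp: N_def Q_def)
    have Q0: "Q s \<ge> 0" and QS: "S s \<le> Q s" if "s \<ge> 0" for s using S0[OF that] by (auto simp: Q_def)
    obtain G Gd where GG: "\<forall>t\<in>{0..}. G t \<in> hspace L \<and> Gd t \<in> hspace L \<and> heq L (W' t) (opA L f ye (W t) + G t) \<and>
      hnorm L (G t) \<le> F * N t \<and> hnorm L (Gd t) \<le> F * (N t + \<bar>zr t\<bar>) \<and>
      (\<forall>k. ((\<lambda>s. cf (G s) k) has_vector_derivative cf (Gd t) k) (at t within {0..}))"
      using F(2)[OF tr] unfolding N_def by blast
    have hd: "has_hderiv_on L {0..} W W'" using tr by (simp add: trajectory_def)
    have WD: "W s \<in> domA L \<alpha>" "W' s \<in> hspace L" if "s \<in> {0..}" for s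
      using tr that unfolding trajectory_def by blast+
    have G_le: "(hnorm L (G s))\<^sup>2 \<le> F\<^sup>2 * (c * Q s)" if s: "s \<ge> 0" for s
    proof -
      have "(hnorm L (G s))\<^sup>2 \<le> (F * N s)\<^sup>2" using GG s by (intro power_mono) auto
      also have "\<dots> \<le> F\<^sup>2 * (c * Q s)" using N(2)[OF s] by (simp add: power_mult_distrib mult_left_mono)
      finally show ?thesis .
    qed
    have Gd_le: "(hnorm L (Gd s))\<^sup>2 \<le> c' * Q s" if s: "s \<ge> 0" for s
    proof -
      have "(hnorm L (Gd s))\<^sup>2 \<le> (F * (N s + \<bar>zr s\<bar>))\<^sup>2" using GG s by (intro power_mono) auto
      also have "\<dots> = F\<^sup>2 * (N s + \<bar>zr s\<bar>)\<^sup>2" by (simp add: power_mult_distrib)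
      also have "\<dots> \<le> F\<^sup>2 * ((2 * c + 2) * Q s)"
        using power2_sum_le[of "N s" "\<bar>zr s\<bar>"] N(2,3)[OF s] QS[OF s] by (intro mult_left_mono) (auto simp: algebra_simps)
      also have "\<dots> \<le> c' * Q s" using Q0[OF s] by (simp add: c'_def algebra_simps)
      finally show ?thesis .
    qed
    have init: "(hnorm L (W' 0))\<^sup>2 \<le> c' * (D\<^sup>2 + S 0)"
    proof -
      have A0: "opA L f ye (W 0) \<in> hspace L" using opA_hspace WD by simp
      have "hnorm L (W' 0) = hnorm L (opA L f ye (W 0) + G 0)"
        using GG WD by (intro hnorm_cong L_nonneg hspace_add A0) auto
      also have "\<dots> \<le> hnorm L (opA L f ye (W 0)) + hnorm L (G 0)" using GG by (intro hnorm_triangle A0) auto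
      finally have "(hnorm L (W' 0))\<^sup>2 \<le> (hnorm L (opA L f ye (W 0)) + hnorm L (G 0))\<^sup>2"
        by (intro power_mono) auto
      also have "\<dots> \<le> 2 * (hnorm L (opA L f ye (W 0)))\<^sup>2 + 2 * (hnorm L (G 0))\<^sup>2" by (rule power2_sum_le)
      also have "\<dots> \<le> 2 * D\<^sup>2 + 2 * (F\<^sup>2 * (c * Q 0))"
        using D G_le[of 0] by (intro add_mono mult_left_mono power_mono) auto
      also have "\<dots> \<le> c' * (D\<^sup>2 + S 0)"
      proof -
        have "0 \<le> F\<^sup>2 * D\<^sup>2" "0 \<le> F\<^sup>2 * S 0" "0 \<le> S 0" using S0[of 0] by auto
        then show ?thesis by (simp add: c'_def Q_def algebra_simps)
      qed
      finally show ?thesis .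
    qed
    have energy: "(\<Sum>k\<in>I. (cmod (cf (W' t) k))\<^sup>2) \<le> A * Q t" if "finite I" "I \<subseteq> high" for I
    proof -
      have "has_hderiv_on L {0..} W W' \<and> S 0 \<ge> 0 \<and>
        (\<forall>t\<in>{0..}. W t \<in> domA L \<alpha> \<and> W' t \<in> hspace L \<and> G t \<in> hspace L \<and> Gd t \<in> hspace L \<and>
          heq L (W' t) (opA L f ye (W t) + G t) \<and>
          (\<forall>k. ((\<lambda>s. cf (G s) k) has_vector_derivative cf (Gd t) k) (at t within {0..})) \<and>
          (hnorm L (Gd t))\<^sup>2 \<le> c' * (exp (- 2 * \<kappa> * t) * D\<^sup>2 + S t)) \<and>
        (\<forall>s t. 0 \<le> s \<longrightarrow> s \<le> t \<longrightarrow> S s \<le> exp (2 * (\<eta> * \<kappa>) * (t - s)) * S t) \<and>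
        (hnorm L (W' 0))\<^sup>2 \<le> c' * (D\<^sup>2 + S 0)"
      proof (intro conjI ballI hd S init)
        fix s :: real assume s: "s \<in> {0..}"
        show "(hnorm L (Gd s))\<^sup>2 \<le> c' * (exp (- 2 * \<kappa> * s) * D\<^sup>2 + S s)"
          using Gd_le[of s] s by (simp add: Q_def)
      qed (use S0[of 0] GG WD in blast)+
      note A'[OF this]
      then show ?thesis using t that by (simp add: Q_def)
    qed
    define w where "w = W t"
    have w: "w \<in> domA L \<alpha>" "w \<in> hspace L" "opA L f ye w \<in> hspace L"
      using WD[of t] t domAD(1) opA_hspace by (auto simp: w_def)
    have G: "G t \<in> hspace L" "heq L (W' t) (opA L f ye w + G t)" using GG t by (auto simp: w_def)
    have wN: "(hnorm L w)\<^sup>2 \<le> c * Q t"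
      using N(2)[OF t] state_size_ge(1)[of "W t" "\<zeta> t" "v t"]
      by (metis N_def hnorm_nonneg order_trans power_mono w_def)
    have coeff: "(\<Sum>k\<in>I. (cmod (cf (opA L f ye w) k))\<^sup>2) \<le> c7 * Q t" if I: "finite I" for I
    proof -
      have "I = (I \<inter> low) \<union> (I \<inter> high)" "(I \<inter> low) \<inter> (I \<inter> high) = {}" by auto
      then have "(\<Sum>k\<in>I. (cmod (cf (opA L f ye w) k))\<^sup>2)
          = (\<Sum>k\<in>I \<inter> low. (cmod (cf (opA L f ye w) k))\<^sup>2) + (\<Sum>k\<in>I \<inter> high. (cmod (cf (opA L f ye w) k))\<^sup>2)"
        using I by (metis finite_Int sum.union_disjoint)
      also have "(\<Sum>k\<in>I \<inter> low. (cmod (cf (opA L f ye w) k))\<^sup>2) \<le> real (card low) * (Cl\<^sup>2 * (c * Q t))"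
      proof -
        have "(\<Sum>k\<in>I \<inter> low. (cmod (cf (opA L f ye w) k))\<^sup>2) \<le> (\<Sum>k\<in>low. (cmod (cf (opA L f ye w) k))\<^sup>2)"
          using finite_low by (intro sum_mono2) auto
        also have "\<dots> \<le> (\<Sum>k\<in>low. Cl\<^sup>2 * (c * Q t))"
        proof (rule sum_mono)
          fix k assume "k \<in> low"
          then have "(cmod (cf (opA L f ye w) k))\<^sup>2 \<le> (Cl * hnorm L w)\<^sup>2" using Cl(2)[OF w(1)] by (intro power_mono) auto
          also have "\<dots> \<le> Cl\<^sup>2 * (c * Q t)" using wN by (simp add: power_mult_distrib mult_left_mono)
          finally show "(cmod (cf (opA L f ye w) k))\<^sup>2 \<le> Cl\<^sup>2 * (c * Q t)" .
        qed
        finally show ?thesis by simp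
      qed
      also have "(\<Sum>k\<in>I \<inter> high. (cmod (cf (opA L f ye w) k))\<^sup>2) \<le> 2 * (A * Q t) + 2 * (M\<^sup>2 * (F\<^sup>2 * (c * Q t)))"
      proof -
        have "(cmod (cf (opA L f ye w) k))\<^sup>2 \<le> 2 * (cmod (cf (W' t) k))\<^sup>2 + 2 * (cmod (cf (G t) k))\<^sup>2" for k
        proof -
          have "cf (W' t) k = cf (opA L f ye w + G t) k"
            using G w WD[of t] t by (intro hinner_cong L_nonneg fd_hspace hspace_add) auto
          then have "cf (opA L f ye w) k = cf (W' t) k - cf (G t) k"
            using w G by (simp add: hinner_add_left fd_hspace)
          then have "cmod (cf (opA L f ye w) k) \<le> cmod (cf (W' t) k) + cmod (cf (G t) k)"
            by (simp add: norm_triangle_ineq4)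
          then show ?thesis using power2_sum_le by (meson norm_ge_zero order_trans power_mono)
        qed
        then have "(\<Sum>k\<in>I \<inter> high. (cmod (cf (opA L f ye w) k))\<^sup>2)
            \<le> (\<Sum>k\<in>I \<inter> high. 2 * (cmod (cf (W' t) k))\<^sup>2 + 2 * (cmod (cf (G t) k))\<^sup>2)" by (rule sum_mono)
        also have "\<dots> = 2 * (\<Sum>k\<in>I \<inter> high. (cmod (cf (W' t) k))\<^sup>2) + 2 * (\<Sum>k\<in>I \<inter> high. (cmod (cf (G t) k))\<^sup>2)"
          by (simp only: sum.distrib sum_distrib_left)
        also have "\<dots> \<le> 2 * (A * Q t) + 2 * (M\<^sup>2 * (F\<^sup>2 * (c * Q t)))"
        proof (intro add_mono mult_left_mono energy)
          have "(\<Sum>k\<in>I \<inter> high. (cmod (cf (G t) k))\<^sup>2) \<le> M\<^sup>2 * (hnorm L (G t))\<^sup>2"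
            using M(2)[OF G(1), of "I \<inter> high"] I by (simp add: power_mult_distrib)
          also have "\<dots> \<le> M\<^sup>2 * (F\<^sup>2 * (c * Q t))" using G_le[OF t] by (intro mult_left_mono) auto
          finally show "(\<Sum>k\<in>I \<inter> high. (cmod (cf (G t) k))\<^sup>2) \<le> M\<^sup>2 * (F\<^sup>2 * (c * Q t))" .
        qed (use I in auto)
        finally show ?thesis .
      qed
      finally show ?thesis by (simp add: c7_def algebra_simps)
    qed
    have "hnorm L (opA L f ye w) \<le> Cr * sqrt (c7 * Q t)"
      using coeff c7 Q0[OF t] by (intro Cr(2) w(3)) auto
    moreover have "hnorm L w \<le> sqrt (c * Q t)" using wN by (rule real_le_rsqrt)
    ultimately have "cmod (dx L (fst w) 0) \<le> Ct * (Cr * sqrt (c7 * Q t) + sqrt (c * Q t))"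
      using Ct(2)[OF w(1)] Ct(1) by (meson add_mono mult_left_mono order_trans)
    also have "\<dots> = Ct * (Cr * sqrt c7 + sqrt c) * sqrt (Q t)" by (simp add: real_sqrt_mult algebra_simps)
    finally have "(cmod (dx L (fst w) 0))\<^sup>2 \<le> (Ct * (Cr * sqrt c7 + sqrt c) * sqrt (Q t))\<^sup>2"
      by (intro power_mono) auto
    also have "\<dots> = c8 * Q t" using Q0[OF t] by (simp add: c8_def power_mult_distrib)
    also have "\<dots> \<le> (c8 + 1) * Q t" using Q0[OF t] by (intro mult_right_mono) auto
    finally show "(cmod (dx L (fst (W t)) 0))\<^sup>2 \<le> (c8 + 1) * (exp (- 2 * \<kappa> * t) * D\<^sup>2 + S t)"
      by (simp add: w_def Q_def)
  qed
qed

end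

section \<open>Weighted suprema and passage from classical solutions to trajectories\<close>

lemma exp_weighted_SUP:
  fixes g :: "real \<Rightarrow> real" and a :: real
  assumes c: "continuous_on {0..} g" and g0: "\<And>s. 0 \<le> g s"
  defines "S \<equiv> \<lambda>t. SUP s\<in>{0..t}. exp (a * (t - s)) * g s"
  shows "0 \<le> s \<Longrightarrow> s \<le> t \<Longrightarrow> exp (a * (t - s)) * g s \<le> S t"
    and "0 \<le> t \<Longrightarrow> g t \<le> S t"
    and "0 \<le> s \<Longrightarrow> s \<le> t \<Longrightarrow> S s \<le> exp (- a * (t - s)) * S t"
proof -
  \<comment> \<open>The supremum of an unbounded set of reals would carry no information; continuity
    on the compact interval rules this out.\<close>
  have bdd: "bdd_above ((\<lambda>s. exp (a * (t - s)) * g s) ` {0..t})" for t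
  proof -
    have "continuous_on {0..t} (\<lambda>s. exp (a * (t - s)) * g s)"
      by (intro continuous_intros continuous_on_subset[OF c]) auto
    then have "compact ((\<lambda>s. exp (a * (t - s)) * g s) ` {0..t})" by (rule compact_continuous_image) auto
    then show ?thesis by (intro bounded_imp_bdd_above compact_imp_bounded)
  qed
  show 1: "exp (a * (t - s)) * g s \<le> S t" if "0 \<le> s" "s \<le> t" for s t
    unfolding S_def using that by (intro cSUP_upper bdd) auto
  show "g t \<le> S t" if "0 \<le> t" using 1[of t t] that by simp
  show "S s \<le> exp (- a * (t - s)) * S t" if "0 \<le> s" "s \<le> t"
  proof -
    \<comment> \<open>Passing from final time \<open>s\<close> to \<open>t\<close> multiplies the
      weight at every \<open>r\<close> by the same factor exp(a (t - s)) and only enlarges the index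
      set.\<close>
    have "exp (a * (s - r)) * g r \<le> exp (- a * (t - s)) * S t" if r: "r \<in> {0..s}" for r
    proof -
      have "exp (- a * (t - s)) * (exp (a * (t - r)) * g r) \<le> exp (- a * (t - s)) * S t"
        using 1[of r t] r \<open>s \<le> t\<close> by (intro mult_left_mono) auto
      also have "exp (- a * (t - s)) * (exp (a * (t - r)) * g r) = exp (- a * (t - s) + a * (t - r)) * g r"
        by (simp only: exp_add mult.assoc)
      also have "- a * (t - s) + a * (t - r) = a * (s - r)" by (simp add: algebra_simps)
      finally show ?thesis .
    qed
    then have "(SUP r\<in>{0..s}. exp (a * (s - r)) * g r) \<le> exp (- a * (t - s)) * S t"
      using \<open>0 \<le> s\<close> by (intro cSUP_least) auto
    then show ?thesis by (simp only: S_def)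
  qed
qed

lemma C1_on_imp_continuous_on: "C1_on S g \<Longrightarrow> continuous_on S g"
  unfolding C1_on_def by (auto intro: DERIV_continuous_on)

lemma C2_on_imp_continuous_on: "C2_on S g \<Longrightarrow> continuous_on S g"
  unfolding C2_on_def by (auto intro: DERIV_continuous_on)

lemma linf_norm_less_imp_AE:
  assumes "linf_norm S g < ereal b"
  shows "AE x in lebesgue_on S. norm (g x) \<le> b"
proof -
  have "AE x in lebesgue_on S. ereal (norm (g x)) \<le> linf_norm S g"
    unfolding linf_norm_def by (rule esssup_AE)
  then show ?thesis
  proof eventually_elim
    case (elim x)
    then have "ereal (norm (g x)) \<le> ereal b" using assms by (meson less_imp_le order_trans)
    then show ?case by simp
  qed
qed

lemma (in closed_loop) trajectory_of_classical_solution: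
  assumes sol: "classical_solution L \<alpha> f ye e fd lam n0 K zr \<infinity> W \<zeta> v"
    and one: "\<And>t. 0 \<le> t \<Longrightarrow> linf_norm {0..L} (fst (W t)) < 1"
  shows "\<exists>W' \<zeta>' v'. trajectory zr W \<zeta> v W' \<zeta>' v'"
proof -
  have J: "{t. 0 \<le> t \<and> ereal t < \<infinity>} = {0..}" by auto
  have "\<forall>t\<in>{0..}. bounded_by_one (W t)"
    using one linf_norm_less_imp_AE[where b=1] by (auto simp: bounded_by_one_def one_ereal_def)
  moreover obtain W' \<zeta>' v' where "\<forall>t\<in>{0..}. W t \<in> domA L \<alpha> \<and> real_valued L (W t)"
    "\<forall>t\<in>{0..}. W' t \<in> hspace L" "has_hderiv_on L {0..} W W'"
    "\<forall>t\<in>{0..}. (\<zeta> has_real_derivative \<zeta>' t) (at t within {0..})"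
    "\<forall>t\<in>{0..}. (v has_real_derivative v' t) (at t within {0..})"
    "\<forall>t\<in>{0..}. heq L (W' t) (opA L f ye (W t) + hscale (of_real (v t)) (avec L \<alpha>)
        + hscale (of_real (v' t)) (bvec L \<alpha>) + (0, residual f ye (fst (W t)))) \<and>
      complex_of_real (\<zeta>' t) = dx L (fst (W t)) 0 - of_real (zr t) \<and>
      v' t = vec_index (K *\<^sub>v Xvec L e fd lam n0 (W t) (\<zeta> t) (v t)) 0"
    using sol unfolding classical_solution_def Let_def J by (elim conjE exE) blast
  ultimately have "trajectory zr W \<zeta> v W' \<zeta>' v'" unfolding trajectory_def by blast
  then show ?thesis by blast
qed

section \<open>The tracking estimate\<close>

theorem theorem2:
  fixes L \<alpha> \<kappa> \<delta> \<eta> :: real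
    and f ye :: "real \<Rightarrow> real"
    and e fd :: "int \<Rightarrow> state"
    and lam :: "int \<Rightarrow> complex"
    and n0 :: nat
    and K :: "real mat"
  assumes L: "L > 0"
    and f: "C2_on UNIV f"
    and ye: "C2_on {0..L} ye"
      "\<And>x. 0 < x \<Longrightarrow> x < L \<Longrightarrow> deriv (deriv ye) x + f (ye x) = 0"
      "ye 0 = 0"
    and alpha: "\<alpha> > 1" "1 / (2 * L) * ln ((\<alpha> - 1) / (\<alpha> + 1)) < - 1"
    and basis: "riesz_basis L e" "dual_riesz_basis L e fd"
      "\<And>k. e k \<in> domA L \<alpha>" "\<And>k. hnorm L (e k) = 1"
    and high_modes:
      "\<And>k. \<bar>k\<bar> \<ge> int n0 + 1 \<Longrightarrow> alg_simple L \<alpha> f ye (lam k)"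
      "\<And>k. \<bar>k\<bar> \<ge> int n0 + 1 \<Longrightarrow> heq L (opA L f ye (e k)) (hscale (lam k) (e k))"
      "\<And>k. \<bar>k\<bar> \<ge> int n0 + 1 \<Longrightarrow> adjA L \<alpha> f ye (fd k) (hscale (cnj (lam k)) (fd k))"
      "\<And>k. \<bar>k\<bar> \<ge> int n0 + 1 \<Longrightarrow> Re (lam k) < - 1"
      "\<And>k. \<bar>k\<bar> \<ge> int n0 + 1 \<Longrightarrow> heq L (e (- k)) (hcnj (e k))"
      "\<And>k. \<bar>k\<bar> \<ge> int n0 + 1 \<Longrightarrow> heq L (fd (- k)) (hcnj (fd k))"
    and asymptotics:
      "(\<lambda>k. lam k - (of_real (1 / (2 * L) * ln ((\<alpha> - 1) / (\<alpha> + 1)))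
                     + \<i> * of_real (of_int k * pi / L)))
         \<in> O[cofinite](\<lambda>k. of_real (1 / \<bar>of_int k\<bar>))"
      "(\<lambda>k. dx L (fst (e k)) 0) \<in> O[cofinite](\<lambda>_. 1)"
    and low_modes:
      "\<And>k. \<bar>k\<bar> \<le> int n0 \<Longrightarrow> real_valued L (e k)"
      "\<And>k. \<bar>k\<bar> \<le> int n0 \<Longrightarrow> real_valued L (fd k)"
      "\<And>k. \<bar>k\<bar> \<le> int n0 \<Longrightarrow> in_hspan L e {p. \<bar>p\<bar> \<le> int n0} (opA L f ye (e k))"
      "\<And>k. \<bar>k\<bar> \<le> int n0 \<Longrightarrow>
         \<exists>h. adjA L \<alpha> f ye (fd k) h \<and> in_hspan L fd {p. \<bar>p\<bar> \<le> int n0} h"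
    and geometrically_simple:
      "\<And>\<mu> w. eigvecA L \<alpha> f ye \<mu> w \<Longrightarrow> geom_simple L \<alpha> f ye \<mu>"
    and controllable: "controllable (Amat L \<alpha> f ye e fd lam n0) (Bmat L \<alpha> e fd lam n0)"
    and K: "K \<in> carrier_mat 1 (2 * n0 + 3)"
      "hurwitz (Amat L \<alpha> f ye e fd lam n0 + Bmat L \<alpha> e fd lam n0 * K)"
    and kappa_delta: "0 < \<kappa>" "\<kappa> < 1" "\<delta> > 0"
    and stability: "stability_property L \<alpha> f ye e fd lam n0 K \<kappa> \<delta>"
    and eta: "0 \<le> \<eta>" "\<eta> < 1"
  shows "\<exists>C3>0. \<exists>C4>0. \<forall>W0 \<xi>0 v0 zr.
    admissible_data L \<alpha> \<delta> W0 \<xi>0 v0 zr \<longrightarrow>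
    solution_satisfies L \<alpha> f ye e fd lam n0 K W0 \<xi>0 v0 zr
      (\<lambda>w \<zeta> v t. cmod (dx L (fst w) 0 - of_real (zr t))
         \<le> C3 * exp (- \<kappa> * t) * (hnorm L W0 + \<bar>\<xi>0\<bar> + \<bar>v0\<bar> + hnorm L (opA L f ye W0))
           + C4 * (SUP s\<in>{0..t}. exp (- \<eta> * \<kappa> * (t - s)) * \<bar>zr s\<bar>))"
proof -
  have ye_cont: "continuous_on {0..L} ye" using ye(1) by (rule C2_on_imp_continuous_on)
  have f1_cont: "continuous_on UNIV (deriv f)"
    using C2_on_UNIV_deriv(2)[OF f] by (intro DERIV_continuous_on) auto
  interpret closed_loop L \<alpha> f ye e fd lam n0 K
  proof
    show "continuous_on {0..L} (\<lambda>x. deriv f (ye x))"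
      by (rule continuous_on_compose2[OF f1_cont ye_cont]) auto
  qed (use assms ye_cont in \<open>assumption | blast\<close>)+
  obtain C1 where C1: "C1 > 0" "\<And>\<eta>. 0 \<le> \<eta> \<and> \<eta> < 1 \<Longrightarrow> \<exists>C2>0. \<forall>W0 \<xi>0 v0 zr.
        admissible_data L \<alpha> \<delta> W0 \<xi>0 v0 zr \<longrightarrow>
        solution_satisfies L \<alpha> f ye e fd lam n0 K W0 \<xi>0 v0 zr
          (\<lambda>w \<zeta> v t. linf_norm {0..L} (fst w) < 1 \<and>
             (hnorm L w)\<^sup>2 + \<bar>xi L e fd lam n0 w \<zeta>\<bar>\<^sup>2 + \<bar>v\<bar>\<^sup>2
               \<le> C1 * exp (- 2 * \<kappa> * t) * ((hnorm L W0)\<^sup>2 + \<bar>\<xi>0\<bar>\<^sup>2 + \<bar>v0\<bar>\<^sup>2)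
                 + C2 * (SUP s\<in>{0..t}. exp (- 2 * \<eta> * \<kappa> * (t - s)) * \<bar>zr s\<bar>\<^sup>2))"
    using stability unfolding stability_property_def by blast
  obtain C2 where C2: "C2 > 0" "\<And>W0 \<xi>0 v0 zr. admissible_data L \<alpha> \<delta> W0 \<xi>0 v0 zr \<Longrightarrow>
        solution_satisfies L \<alpha> f ye e fd lam n0 K W0 \<xi>0 v0 zr
          (\<lambda>w \<zeta> v t. linf_norm {0..L} (fst w) < 1 \<and>
             (hnorm L w)\<^sup>2 + \<bar>xi L e fd lam n0 w \<zeta>\<bar>\<^sup>2 + \<bar>v\<bar>\<^sup>2
               \<le> C1 * exp (- 2 * \<kappa> * t) * ((hnorm L W0)\<^sup>2 + \<bar>\<xi>0\<bar>\<^sup>2 + \<bar>v0\<bar>\<^sup>2)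
                 + C2 * (SUP s\<in>{0..t}. exp (- 2 * \<eta> * \<kappa> * (t - s)) * \<bar>zr s\<bar>\<^sup>2))"
    using C1(2)[of \<eta>] eta by blast
  \<comment> \<open>The 3 converts the sum of squares in the stability property into the square of
    the sum in \<open>state_size\<close>.\<close>
  define c where "c = 3 * (C1 + C2)"
  have c: "c \<ge> 0" using C1(1) C2(1) by (simp add: c_def)
  obtain C where C: "C > 0" "\<And>zr W \<zeta> v W' \<zeta>' v' D S.
    trajectory zr W \<zeta> v W' \<zeta>' v' \<and> 0 \<le> D \<and> hnorm L (opA L f ye (W 0)) \<le> D \<and>
    (\<forall>t\<ge>0. (state_size (W t) (\<zeta> t) (v t))\<^sup>2 \<le> c * (exp (- 2 * \<kappa> * t) * D\<^sup>2 + S t) \<and> \<bar>zr t\<bar>\<^sup>2 \<le> S t) \<and>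
    (\<forall>s t. 0 \<le> s \<longrightarrow> s \<le> t \<longrightarrow> S s \<le> exp (2 * (\<eta> * \<kappa>) * (t - s)) * S t) \<Longrightarrow>
    \<forall>t\<ge>0. (cmod (dx L (fst (W t)) 0))\<^sup>2 \<le> C * (exp (- 2 * \<kappa> * t) * D\<^sup>2 + S t)"
    using trace_estimate[OF kappa_delta(1,2) eta c] by blast
  \<comment> \<open>\<open>sqrt C\<close> comes from taking the root of the squared trace bound; the
    additional 1 in the second constant accounts for z_r(t) itself, split off by the triangle
    inequality.\<close>
  have main: "cmod (dx L (fst (W t)) 0 - of_real (zr t))
      \<le> sqrt C * exp (- \<kappa> * t) * (hnorm L W0 + \<bar>\<xi>0\<bar> + \<bar>v0\<bar> + hnorm L (opA L f ye W0))
        + (sqrt C + 1) * (SUP s\<in>{0..t}. exp (- \<eta> * \<kappa> * (t - s)) * \<bar>zr s\<bar>)"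
    if adm: "admissible_data L \<alpha> \<delta> W0 \<xi>0 v0 zr"
      and sol: "classical_solution L \<alpha> f ye e fd lam n0 K zr \<infinity> W \<zeta> v"
      and init: "has_initial_data L e fd lam n0 W0 \<xi>0 v0 W \<zeta> v"
      and est: "\<forall>t\<ge>0. linf_norm {0..L} (fst (W t)) < 1 \<and>
             (hnorm L (W t))\<^sup>2 + \<bar>xi L e fd lam n0 (W t) (\<zeta> t)\<bar>\<^sup>2 + \<bar>v t\<bar>\<^sup>2
               \<le> C1 * exp (- 2 * \<kappa> * t) * ((hnorm L W0)\<^sup>2 + \<bar>\<xi>0\<bar>\<^sup>2 + \<bar>v0\<bar>\<^sup>2)
                 + C2 * (SUP s\<in>{0..t}. exp (- 2 * \<eta> * \<kappa> * (t - s)) * \<bar>zr s\<bar>\<^sup>2)"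
      and t: "0 \<le> t" for W0 \<xi>0 v0 zr W \<zeta> v t
  proof -
    define D where "D = hnorm L W0 + \<bar>\<xi>0\<bar> + \<bar>v0\<bar> + hnorm L (opA L f ye W0)"
    define S where "S t = (SUP s\<in>{0..t}. exp (- 2 * \<eta> * \<kappa> * (t - s)) * \<bar>zr s\<bar>\<^sup>2)" for t
    define s1 where "s1 t = (SUP s\<in>{0..t}. exp (- \<eta> * \<kappa> * (t - s)) * \<bar>zr s\<bar>)" for t
    have W0: "W0 \<in> domA L \<alpha>" and zr_cont: "continuous_on {0..} zr"
      using adm by (auto simp: admissible_data_def intro: C1_on_imp_continuous_on)
    have cont1: "continuous_on {0..} (\<lambda>s. \<bar>zr s\<bar>)" and cont2: "continuous_on {0..} (\<lambda>s. \<bar>zr s\<bar>\<^sup>2)"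
      by (intro continuous_intros zr_cont)+
    note Sup2 = exp_weighted_SUP[OF cont2, where a="- 2 * \<eta> * \<kappa>", folded S_def]
    note Sup1 = exp_weighted_SUP[OF cont1, where a="- \<eta> * \<kappa>", folded s1_def]
    obtain W' \<zeta>' v' where tr: "trajectory zr W \<zeta> v W' \<zeta>' v'"
      using trajectory_of_classical_solution[OF sol] est by blast
    have W_init: "heq L (W 0) W0" using init by (simp add: has_initial_data_def)
    have WD: "W 0 \<in> domA L \<alpha>" using tr by (auto simp: trajectory_def)
    \<comment> \<open>W(0) agrees with the prescribed state up to \<open>heq\<close> only, so the
      two images under the operator have to be compared.\<close>
    have A0: "hnorm L (opA L f ye (W 0)) = hnorm L (opA L f ye W0)"
      by (intro hnorm_cong L_nonneg opA_hspace WD W0 heq_opA W_init)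
    have D0: "0 \<le> D" "hnorm L (opA L f ye (W 0)) \<le> D" by (simp_all add: D_def A0)
    have "\<forall>t\<ge>0. (cmod (dx L (fst (W t)) 0))\<^sup>2 \<le> C * (exp (- 2 * \<kappa> * t) * D\<^sup>2 + S t)"
    proof (intro C(2)[of zr W \<zeta> v W' \<zeta>' v'] conjI allI impI tr D0)
      fix s :: real assume s: "0 \<le> s"
      show Ss: "\<bar>zr s\<bar>\<^sup>2 \<le> S s" using Sup2(2)[OF _ s] by simp
      have S0: "0 \<le> S s" using Ss by (meson order_trans zero_le_power2)
      have data: "(hnorm L W0)\<^sup>2 + \<bar>\<xi>0\<bar>\<^sup>2 + \<bar>v0\<bar>\<^sup>2 \<le> D\<^sup>2"
      proof -
        have "(hnorm L W0)\<^sup>2 + \<bar>\<xi>0\<bar>\<^sup>2 + \<bar>v0\<bar>\<^sup>2 \<le> (hnorm L W0 + \<bar>\<xi>0\<bar> + \<bar>v0\<bar>)\<^sup>2"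
        proof -
          have "0 \<le> hnorm L W0 * \<bar>\<xi>0\<bar>" "0 \<le> hnorm L W0 * \<bar>v0\<bar>" "0 \<le> \<bar>\<xi>0\<bar> * \<bar>v0\<bar>" by auto
          then show ?thesis by (simp add: power2_eq_square algebra_simps)
        qed
        also have "\<dots> \<le> D\<^sup>2" unfolding D_def by (intro power_mono) auto
        finally show ?thesis .
      qed
      have sq3: "(x + y + z)\<^sup>2 \<le> 3 * (x\<^sup>2 + y\<^sup>2 + z\<^sup>2)" for x y z :: real
      proof -
        have "0 \<le> (x - y)\<^sup>2 + (y - z)\<^sup>2 + (x - z)\<^sup>2" by simp
        then show ?thesis by (simp add: power2_eq_square algebra_simps)
      qed
      have "(state_size (W s) (\<zeta> s) (v s))\<^sup>2
          \<le> 3 * ((hnorm L (W s))\<^sup>2 + \<bar>xi L e fd lam n0 (W s) (\<zeta> s)\<bar>\<^sup>2 + \<bar>v s\<bar>\<^sup>2)"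
        unfolding state_size_def xi_def by (rule sq3)
      also have "\<dots> \<le> 3 * (C1 * exp (- 2 * \<kappa> * s) * ((hnorm L W0)\<^sup>2 + \<bar>\<xi>0\<bar>\<^sup>2 + \<bar>v0\<bar>\<^sup>2) + C2 * S s)"
        using est s unfolding S_def by (intro mult_left_mono) auto
      also have "\<dots> \<le> 3 * (C1 * exp (- 2 * \<kappa> * s) * D\<^sup>2 + C2 * S s)"
        using data C1(1) by (intro mult_left_mono add_right_mono) auto
      also have "\<dots> \<le> c * (exp (- 2 * \<kappa> * s) * D\<^sup>2 + S s)"
      proof -
        have "0 \<le> C1 * S s" "0 \<le> C2 * (exp (- 2 * \<kappa> * s) * D\<^sup>2)" using C1(1) C2(1) S0 by auto
        then show ?thesis by (simp add: c_def algebra_simps)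
      qed
      finally show "(state_size (W s) (\<zeta> s) (v s))\<^sup>2 \<le> c * (exp (- 2 * \<kappa> * s) * D\<^sup>2 + S s)" .
    next
      fix s t :: real assume "0 \<le> s" "s \<le> t"
      then show "S s \<le> exp (2 * (\<eta> * \<kappa>) * (t - s)) * S t"
        using Sup2(3)[of s t] by (simp add: mult.assoc)
    qed
    then have dx_le: "(cmod (dx L (fst (W t)) 0))\<^sup>2 \<le> C * (exp (- 2 * \<kappa> * t) * D\<^sup>2 + S t)" using t by blast
    have s1: "0 \<le> s1 t" "\<bar>zr t\<bar> \<le> s1 t" using Sup1(2)[OF _ t] by auto
    \<comment> \<open>The squared weight exp(-\<eta> \<kappa> (t - r)) is the weight in
      \<open>S\<close>, so each term of \<open>S t\<close> is the square of a term of
      \<open>s1 t\<close>.\<close>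
    have S_le: "S t \<le> (s1 t)\<^sup>2"
      unfolding S_def
    proof (rule cSUP_least)
      fix r assume r: "r \<in> {0..t}"
      have "exp (- 2 * \<eta> * \<kappa> * (t - r)) * \<bar>zr r\<bar>\<^sup>2 = (exp (- \<eta> * \<kappa> * (t - r)) * \<bar>zr r\<bar>)\<^sup>2"
        by (simp add: power_mult_distrib exp_double[symmetric] mult.assoc)
      also have "\<dots> \<le> (s1 t)\<^sup>2" using Sup1(1)[of r t] r by (intro power_mono) auto
      finally show "exp (- 2 * \<eta> * \<kappa> * (t - r)) * \<bar>zr r\<bar>\<^sup>2 \<le> (s1 t)\<^sup>2" .
    qed (use t in auto)
    have "cmod (dx L (fst (W t)) 0) \<le> sqrt C * (exp (- \<kappa> * t) * D + s1 t)"
    proof (rule power2_le_imp_le)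
      have "exp (- 2 * \<kappa> * t) * D\<^sup>2 = (exp (- \<kappa> * t) * D)\<^sup>2"
        by (simp add: power_mult_distrib exp_double[symmetric] mult.assoc)
      then have "exp (- 2 * \<kappa> * t) * D\<^sup>2 + S t \<le> (exp (- \<kappa> * t) * D)\<^sup>2 + (s1 t)\<^sup>2" using S_le by simp
      also have "\<dots> \<le> (exp (- \<kappa> * t) * D + s1 t)\<^sup>2"
        using D0(1) s1(1) by (simp add: power2_sum)
      finally have "C * (exp (- 2 * \<kappa> * t) * D\<^sup>2 + S t) \<le> C * (exp (- \<kappa> * t) * D + s1 t)\<^sup>2"
        using C(1) by (intro mult_left_mono) auto
      also have "\<dots> = (sqrt C * (exp (- \<kappa> * t) * D + s1 t))\<^sup>2"
        using C(1) by (simp add: power_mult_distrib)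
      finally show "(cmod (dx L (fst (W t)) 0))\<^sup>2 \<le> (sqrt C * (exp (- \<kappa> * t) * D + s1 t))\<^sup>2"
        using dx_le by (rule order_trans[rotated])
      show "0 \<le> sqrt C * (exp (- \<kappa> * t) * D + s1 t)" using C(1) D0(1) s1(1) by simp
    qed
    moreover have "cmod (dx L (fst (W t)) 0 - of_real (zr t)) \<le> cmod (dx L (fst (W t)) 0) + \<bar>zr t\<bar>"
      using norm_triangle_ineq4[of "dx L (fst (W t)) 0" "of_real (zr t)"] by simp
    ultimately have "cmod (dx L (fst (W t)) 0 - of_real (zr t)) \<le> sqrt C * exp (- \<kappa> * t) * D + (sqrt C + 1) * s1 t"
      using s1(2) by (simp add: algebra_simps)
    then show ?thesis by (simp only: D_def s1_def)
  qed
  show ?thesis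
  proof (rule exI[of _ "sqrt C"], rule conjI[rotated], rule exI[of _ "sqrt C + 1"], intro conjI allI impI)
    show "sqrt C > 0" "sqrt C + 1 > 0" using C(1) by (auto intro: add_pos_pos)
    fix W0 \<xi>0 v0 zr assume adm: "admissible_data L \<alpha> \<delta> W0 \<xi>0 v0 zr"
    \<comment> \<open>Existence and globality of the maximal solution are taken over from the
      stability property for the same data; the pointwise bound along it is replaced by
      \<open>main\<close>.\<close>
    note sat = C2(2)[OF adm, unfolded solution_satisfies_def]
    show "solution_satisfies L \<alpha> f ye e fd lam n0 K W0 \<xi>0 v0 zr
      (\<lambda>w \<zeta> v t. cmod (dx L (fst w) 0 - of_real (zr t))
         \<le> sqrt C * exp (- \<kappa> * t) * (hnorm L W0 + \<bar>\<xi>0\<bar> + \<bar>v0\<bar> + hnorm L (opA L f ye W0))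
           + (sqrt C + 1) * (SUP s\<in>{0..t}. exp (- \<eta> * \<kappa> * (t - s)) * \<bar>zr s\<bar>))"
      unfolding solution_satisfies_def
    proof (intro conjI allI impI; (elim conjE)?)
      show "\<exists>T W \<zeta> v. maximal_solution L \<alpha> f ye e fd lam n0 K zr T W \<zeta> v \<and>
        has_initial_data L e fd lam n0 W0 \<xi>0 v0 W \<zeta> v"
        using sat by (rule conjunct1)
      fix T W \<zeta> v
      assume max: "maximal_solution L \<alpha> f ye e fd lam n0 K zr T W \<zeta> v"
        and init: "has_initial_data L e fd lam n0 W0 \<xi>0 v0 W \<zeta> v"
      note est = sat[THEN conjunct2, rule_format, OF conjI[OF max init]]
      show T: "T = \<infinity>" using est by (rule conjunct1)
      fix t :: real assume t: "0 \<le> t"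
      have "classical_solution L \<alpha> f ye e fd lam n0 K zr \<infinity> W \<zeta> v"
        using max unfolding T maximal_solution_def by (rule conjunct1)
      from main[OF adm this init _ t] est
      show "cmod (dx L (fst (W t)) 0 - of_real (zr t))
         \<le> sqrt C * exp (- \<kappa> * t) * (hnorm L W0 + \<bar>\<xi>0\<bar> + \<bar>v0\<bar> + hnorm L (opA L f ye W0))
           + (sqrt C + 1) * (SUP s\<in>{0..t}. exp (- \<eta> * \<kappa> * (t - s)) * \<bar>zr s\<bar>)"
        by blast
    qed
  qed
qed

end
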